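(* Let $q$ be a fixed odd prime power, let $2\le s\le t$ and $k\ge 5$ be integers, and let $a_1,\dots,a_k\in\mathbb{F}_q^\times$ satisfy $a_1+\cdots+a_k=0$. There exist constants $c=c(q,k,s,t)>0$ and $C>0$ (depending only on $q,k,s,t,a_1,\dots,a_k$) such that for every integer $n\ge 1$, writing $N=q^n$: if $A\subseteq\mathbb{F}_q^n$ is $K_{s,t}$-free and contains no nontrivial solution to $a_1x_1+\cdots+a_kx_k=0$, then \[ |A|\le C\,N^{1-1/s}(\log N)^{-c}. \]
   Context: A set $A\subseteq\mathbb{F}_q^n$ is $K_{s,t}$-free if there do not exist pairwise distinct $x_1,\dots,x_s\in\mathbb{F}_q^n$ and pairwise distinct $y_1,\dots,y_t\in\mathbb{F}_q^n$ with $x_i+y_j\in A$ for all $1\le i\le s$, $1\le j\le t$. A solution $(x_1,\dots,x_k)\in A^k$ of $a_1x_1+\cdots+a_kx_k=0$ is trivial if $x_1=\cdots=x_k$, and nontrivial otherwise. *)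

theory Defs
  imports Complex_Main "HOL-Library.Cardinality" "Jordan_Normal_Form.Matrix"
begin

text \<open>
  The space of vectors of length \<open>n\<close> over a finite field \<open>'a\<close> is \<^term>\<open>carrier_vec n :: 'a vec set\<close>,
  so that the dimension is a term and can be quantified inside a formula.
\<close>

definition Kst_free :: "nat \<Rightarrow> nat \<Rightarrow> nat \<Rightarrow> 'a::field vec set \<Rightarrow> bool" where
  "Kst_free n s t A \<longleftrightarrow>
     \<not> (\<exists>x y. x ` {1..s} \<subseteq> carrier_vec n \<and> inj_on x {1..s} \<and>
              y ` {1..t} \<subseteq> carrier_vec n \<and> inj_on y {1..t} \<and>
              (\<forall>i\<in>{1..s}. \<forall>j\<in>{1..t}. x i + y j \<in> A))"

definition lin_solution ::
    "nat \<Rightarrow> nat \<Rightarrow> (nat \<Rightarrow> 'a::field) \<Rightarrow> 'a vec set \<Rightarrow> (nat \<Rightarrow> 'a vec) \<Rightarrow> bool" where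
  "lin_solution n k a A x \<longleftrightarrow>
     (\<forall>i\<in>{1..k}. x i \<in> A) \<and>
     finsum_vec TYPE('a) n (\<lambda>i. a i \<cdot>\<^sub>v x i) {1..k} = 0\<^sub>v n"

definition trivial_solution :: "nat \<Rightarrow> (nat \<Rightarrow> 'a vec) \<Rightarrow> bool" where
  "trivial_solution k x \<longleftrightarrow> (\<forall>i\<in>{1..k}. \<forall>j\<in>{1..k}. x i = x j)"

end

theory Submission
  imports Defs "HOL-Library.Function_Algebras" "HOL-Library.Indicator_Function"
    "HOL-Library.Real_Mod" "HOL-Analysis.Convex" "HOL-Number_Theory.Residues"
begin

text \<open>
  Merging variables whose coefficients have nonzero sum (possible since \<open>q\<close> is odd) reduces the
  equation to five variables. For \<open>d \<noteq> 0\<close>, counting copies of \<open>K\<^sub>s\<^sub>,\<^sub>t\<close> bounds \<open>|A \<inter> (A + d)|\<close> by a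
  constant multiple of \<open>R = (N / |A|)\<^bsup>s - 2\<^esup>\<close>, hence the additive energy by \<open>O(R |A|\<^sup>2)\<close>. Let \<open>H\<close> be the
  annihilator of the large Fourier spectrum of \<open>A\<close>. The energy bound shows that \<open>H\<close> has small
  codimension, that \<open>A\<close> has about the expected density on the cosets \<open>x + H\<close> for all \<open>x\<close> in a set \<open>D\<close>
  of density \<open>\<delta> \<approx> |A|\<^sup>s / N\<^bsup>s - 1\<^esup>\<close>, and that \<open>A\<close> has about as many solutions as its average over the
  cosets of \<open>H\<close>. The set \<open>D\<close> contains at least \<open>\<delta>\<^bsup>O(1)\<^esup> N\<^sup>4\<close> solutions, by the polynomial method for
  three-term equations and a Varnavides averaging. The losses are polynomial in \<open>\<delta>\<close> and the
  codimension of \<open>H\<close> may be as large as a constant times \<open>log N\<close>, so \<open>\<delta>\<close> is at most a negative power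
  of \<open>log N\<close>.
\<close>

section \<open>Slice rank of a diagonal tensor\<close>

lemma homogeneous_system_nontrivial_solution:
  fixes f :: "'j \<Rightarrow> 'b \<Rightarrow> 'a::field"
  assumes "finite J" "finite B" "card J < card B"
  shows "\<exists>z. (\<forall>j\<in>J. (\<Sum>x\<in>B. z x * f j x) = 0) \<and> (\<exists>x\<in>B. z x \<noteq> 0)"
  using assms
proof (induction J arbitrary: B f rule: finite_induct)
  case empty
  then obtain x where "x \<in> B" by fastforce
  then show ?case by (intro exI[of _ "\<lambda>_. 1"]) auto
next
  case (insert j\<^sub>0 J)
  show ?case
  proof (cases "\<forall>x\<in>B. f j\<^sub>0 x = 0")
    case True
    moreover obtain z where "\<forall>j\<in>J. (\<Sum>x\<in>B. z x * f j x) = 0" "\<exists>x\<in>B. z x \<noteq> 0"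
      using insert.IH[of B f] insert.prems insert.hyps by auto
    ultimately show ?thesis by (intro exI[of _ z]) auto
  next
    case False
    then obtain x\<^sub>0 where pivot: "x\<^sub>0 \<in> B" "f j\<^sub>0 x\<^sub>0 \<noteq> 0" by blast
    define r where "r = (\<lambda>x. f j\<^sub>0 x / f j\<^sub>0 x\<^sub>0)"
    define g where "g = (\<lambda>j x. f j x - f j x\<^sub>0 * r x)"
    have "card J < card (B - {x\<^sub>0})"
      using insert.prems insert.hyps pivot by simp
    then obtain z where reduced_solution:
        "\<forall>j\<in>J. (\<Sum>x\<in>B - {x\<^sub>0}. z x * g j x) = 0" "\<exists>x\<in>B - {x\<^sub>0}. z x \<noteq> 0"
      using insert.IH[of "B - {x\<^sub>0}" g] insert.prems by auto
    define w where "w = z(x\<^sub>0 := - (\<Sum>x\<in>B - {x\<^sub>0}. z x * r x))"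
    have "(\<Sum>x\<in>B. w x * f j x) = (\<Sum>x\<in>B - {x\<^sub>0}. z x * g j x)" for j
    proof -
      have "(\<Sum>x\<in>B. w x * f j x) = w x\<^sub>0 * f j x\<^sub>0 + (\<Sum>x\<in>B - {x\<^sub>0}. z x * f j x)"
        using insert.prems pivot by (simp add: sum.remove[of B x\<^sub>0] w_def)
      then show ?thesis
        by (simp add: w_def g_def algebra_simps sum_subtractf sum_distrib_left)
    qed
    moreover have "g j\<^sub>0 x = 0" for x using pivot by (simp add: g_def r_def)
    moreover have "\<exists>x\<in>B. w x \<noteq> 0" using reduced_solution(2) by (auto simp: w_def)
    ultimately show ?thesis using reduced_solution(1) by (intro exI[of _ w]) auto
  qed
qed

lemma card_le_of_diagonal_factorization:
  fixes u v :: "'j \<Rightarrow> 'b \<Rightarrow> 'a::field"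
  assumes "finite S" "finite J"
    and diag_nonzero: "\<And>x. x \<in> S \<Longrightarrow> g x \<noteq> 0"
    and factorization: "\<And>x y. x \<in> S \<Longrightarrow> y \<in> S \<Longrightarrow>
      (\<Sum>j\<in>J. u j x * v j y) = (if x = y then g x else 0)"
  shows "card S \<le> card J"
proof (rule ccontr)
  assume "\<not> ?thesis"
  then obtain w x where kernel: "\<And>j. j \<in> J \<Longrightarrow> (\<Sum>y\<in>S. w y * v j y) = 0" and nonzero: "x \<in> S" "w x \<noteq> 0"
    using homogeneous_system_nontrivial_solution[of J S v] assms(1,2) by force
  have "w x * g x = (\<Sum>y\<in>S. w y * (if x = y then g x else 0))"
    using nonzero assms(1) by (simp add: if_distrib cong: if_cong)
  also have "\<dots> = (\<Sum>y\<in>S. w y * (\<Sum>j\<in>J. u j x * v j y))"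
    using nonzero by (intro sum.cong) (auto simp: factorization)
  also have "\<dots> = (\<Sum>j\<in>J. u j x * (\<Sum>y\<in>S. w y * v j y))"
    unfolding sum_distrib_left by (subst sum.swap) (simp add: mult_ac)
  also have "\<dots> = 0" by (simp add: kernel)
  finally show False using nonzero diag_nonzero by simp
qed

lemma kernel_vector_with_large_support:
  fixes f :: "'j \<Rightarrow> 'b \<Rightarrow> 'a::field"
  assumes finite: "finite B" "finite J"
  obtains h where "\<And>j. j \<in> J \<Longrightarrow> (\<Sum>x\<in>B. h x * f j x) = 0"
    and "card B \<le> card {x\<in>B. h x \<noteq> 0} + card J"
proof -
  define kernel where "kernel = {h. \<forall>j\<in>J. (\<Sum>x\<in>B. h x * f j x) = 0}"
  define supp where "supp = (\<lambda>h. {x\<in>B. h x \<noteq> (0::'a)})"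
  have "(\<lambda>_. 0) \<in> kernel" by (simp add: kernel_def)
  moreover have "card (supp h) \<le> card B" for h
    unfolding supp_def by (intro card_mono finite) auto
  ultimately obtain h where h_kernel: "h \<in> kernel"
    and maximal: "\<And>h'. h' \<in> kernel \<Longrightarrow> card (supp h') \<le> card (supp h)"
    using ex_has_greatest_nat[of "\<lambda>h. h \<in> kernel" "\<lambda>_. 0" "card \<circ> supp" "Suc (card B)"]
    by (auto simp: less_Suc_eq_le)
  have "card B \<le> card (supp h) + card J"
  proof (rule ccontr)
    assume "\<not> ?thesis"
    moreover have supp_h: "supp h \<subseteq> B" "finite (supp h)" using finite by (auto simp: supp_def)
    ultimately have "card J < card (B - supp h)" by (simp add: card_Diff_subset)
    then obtain z x\<^sub>0 where z_kernel: "\<forall>j\<in>J. (\<Sum>x\<in>B - supp h. z x * f j x) = 0"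
      and nonzero: "x\<^sub>0 \<in> B - supp h" "z x\<^sub>0 \<noteq> 0"
      using homogeneous_system_nontrivial_solution[of J "B - supp h" f] finite by auto
    define h' where "h' = (\<lambda>x. if x \<in> supp h then h x else z x)"
    have "(\<Sum>x\<in>B. h' x * f j x) = 0" if "j \<in> J" for j
    proof -
      have "(\<Sum>x\<in>B. h' x * f j x) = (\<Sum>x\<in>B - supp h. z x * f j x) + (\<Sum>x\<in>supp h. h x * f j x)"
        using finite supp_h by (simp add: sum.subset_diff[of "supp h" B] h'_def)
      also have "(\<Sum>x\<in>supp h. h x * f j x) = (\<Sum>x\<in>B. h x * f j x)"
        using finite by (intro sum.mono_neutral_left) (auto simp: supp_def)
      finally show ?thesis using z_kernel h_kernel that by (simp add: kernel_def)
    qed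
    then have "card (supp h') \<le> card (supp h)" by (intro maximal) (simp add: kernel_def)
    moreover have "insert x\<^sub>0 (supp h) \<subseteq> supp h'"
      using nonzero by (auto simp: supp_def h'_def)
    then have "card (insert x\<^sub>0 (supp h)) \<le> card (supp h')"
      using finite by (intro card_mono) (auto simp: supp_def)
    ultimately show False using nonzero supp_h by simp
  qed
  then show ?thesis using h_kernel that by (auto simp: kernel_def supp_def)
qed

text \<open>Contracting the first variable with a vector \<open>h\<close> that kills the slices in that variable turns
  the tensor into a diagonal matrix of rank at most \<open>2 |J|\<close>.\<close>

lemma slice_rank_diagonal:
  fixes f\<^sub>1 f\<^sub>2 f\<^sub>3 :: "'j \<Rightarrow> 'b \<Rightarrow> 'a::field"
  assumes finite: "finite B" "finite J"
    and slices: "\<And>x y z. x \<in> B \<Longrightarrow> y \<in> B \<Longrightarrow> z \<in> B \<Longrightarrow>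
      (if x = y \<and> y = z then 1 else 0) =
        (\<Sum>j\<in>J. f\<^sub>1 j x * g\<^sub>1 j y z) + (\<Sum>j\<in>J. f\<^sub>2 j y * g\<^sub>2 j x z) + (\<Sum>j\<in>J. f\<^sub>3 j z * g\<^sub>3 j x y)"
  shows "card B \<le> 3 * card J"
proof -
  obtain h where contraction: "\<And>j. j \<in> J \<Longrightarrow> (\<Sum>x\<in>B. h x * f\<^sub>1 j x) = 0"
    and card_supp: "card B \<le> card {x\<in>B. h x \<noteq> 0} + card J"
    using kernel_vector_with_large_support[OF finite, of f\<^sub>1] by metis
  define S where "S = {x\<in>B. h x \<noteq> 0}"
  define u where "u = (\<lambda>j y. case j of Inl j \<Rightarrow> f\<^sub>2 j y | Inr j \<Rightarrow> (\<Sum>x\<in>B. h x * g\<^sub>3 j x y))"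
  define v where "v = (\<lambda>j z. case j of Inl j \<Rightarrow> (\<Sum>x\<in>B. h x * g\<^sub>2 j x z) | Inr j \<Rightarrow> f\<^sub>3 j z)"
  have "(\<Sum>j\<in>J <+> J. u j y * v j z) = (if y = z then h y else 0)" if "y \<in> S" "z \<in> S" for y z
  proof -
    have in_B: "y \<in> B" "z \<in> B" using that by (auto simp: S_def)
    have "(if y = z then h y else 0) = (\<Sum>x\<in>B. h x * (if x = y \<and> y = z then 1 else 0))"
      using in_B finite by (simp add: sum.delta' if_distrib[of "\<lambda>c. _ * c"] cong: if_cong)
    also have "\<dots> = (\<Sum>x\<in>B. h x * ((\<Sum>j\<in>J. f\<^sub>1 j x * g\<^sub>1 j y z) + (\<Sum>j\<in>J. f\<^sub>2 j y * g\<^sub>2 j x z)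
        + (\<Sum>j\<in>J. f\<^sub>3 j z * g\<^sub>3 j x y)))"
      by (intro sum.cong refl) (simp only: slices in_B)
    also have "\<dots> = (\<Sum>x\<in>B. \<Sum>j\<in>J. h x * f\<^sub>1 j x * g\<^sub>1 j y z)
        + (\<Sum>x\<in>B. \<Sum>j\<in>J. f\<^sub>2 j y * (h x * g\<^sub>2 j x z)) + (\<Sum>x\<in>B. \<Sum>j\<in>J. h x * g\<^sub>3 j x y * f\<^sub>3 j z)"
      by (simp add: distrib_left sum.distrib sum_distrib_left mult_ac)
    also have "(\<Sum>x\<in>B. \<Sum>j\<in>J. h x * f\<^sub>1 j x * g\<^sub>1 j y z) = 0"
      by (subst sum.swap) (simp add: contraction flip: sum_distrib_right)
    also have "(\<Sum>x\<in>B. \<Sum>j\<in>J. f\<^sub>2 j y * (h x * g\<^sub>2 j x z)) = (\<Sum>j\<in>J. u (Inl j) y * v (Inl j) z)"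
      by (subst sum.swap) (simp add: u_def v_def sum_distrib_left)
    also have "(\<Sum>x\<in>B. \<Sum>j\<in>J. h x * g\<^sub>3 j x y * f\<^sub>3 j z) = (\<Sum>j\<in>J. u (Inr j) y * v (Inr j) z)"
      by (subst sum.swap) (simp add: u_def v_def sum_distrib_right)
    finally show ?thesis
      by (simp add: sum.Plus finite)
  qed
  then have "card S \<le> card (J <+> J)"
    by (intro card_le_of_diagonal_factorization[where g = h and u = u and v = v])
      (auto simp: S_def finite)
  then show ?thesis using card_supp finite by (simp add: S_def card_Plus)
qed

lemma sum_group_by_label:
  fixes F :: "'c \<Rightarrow> 'a::comm_ring_1"
  assumes "finite C" "finite J" "p ` C \<subseteq> J"
  shows "(\<Sum>\<tau>\<in>C. f (p \<tau>) * F \<tau>) = (\<Sum>j\<in>J. f j * (\<Sum>\<tau>\<in>{\<tau>\<in>C. p \<tau> = j}. F \<tau>))"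
  by (subst sum.group[OF assms, symmetric]) (auto simp: sum_distrib_left intro!: sum.cong)

lemma card_le_of_diagonal_expansion:
  fixes c :: "'t \<Rightarrow> 'a::field" and \<phi> :: "'j \<Rightarrow> 'b \<Rightarrow> 'a"
  assumes finite: "finite B" "finite P" "finite J"
    and cover: "\<And>\<tau>. \<tau> \<in> P \<Longrightarrow> p\<^sub>1 \<tau> \<in> J \<or> p\<^sub>2 \<tau> \<in> J \<or> p\<^sub>3 \<tau> \<in> J"
    and expansion: "\<And>x y z. x \<in> B \<Longrightarrow> y \<in> B \<Longrightarrow> z \<in> B \<Longrightarrow>
      (if x = y \<and> y = z then 1 else 0) = (\<Sum>\<tau>\<in>P. c \<tau> * \<phi> (p\<^sub>1 \<tau>) x * \<phi> (p\<^sub>2 \<tau>) y * \<phi> (p\<^sub>3 \<tau>) z)"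
  shows "card B \<le> 3 * card J"
proof -
  define P\<^sub>1 where "P\<^sub>1 = {\<tau>\<in>P. p\<^sub>1 \<tau> \<in> J}"
  define P\<^sub>2 where "P\<^sub>2 = {\<tau>\<in>P - P\<^sub>1. p\<^sub>2 \<tau> \<in> J}"
  define P\<^sub>3 where "P\<^sub>3 = P - P\<^sub>1 - P\<^sub>2"
  have finite_parts: "finite P\<^sub>1" "finite P\<^sub>2" "finite P\<^sub>3"
    using finite by (auto simp: P\<^sub>1_def P\<^sub>2_def P\<^sub>3_def)
  have labels: "p\<^sub>1 ` P\<^sub>1 \<subseteq> J" "p\<^sub>2 ` P\<^sub>2 \<subseteq> J" "p\<^sub>3 ` P\<^sub>3 \<subseteq> J"
    using cover by (auto simp: P\<^sub>1_def P\<^sub>2_def P\<^sub>3_def)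
  have split: "sum F P = sum F P\<^sub>1 + sum F P\<^sub>2 + sum F P\<^sub>3" for F :: "'t \<Rightarrow> 'a"
  proof -
    have "sum F P = sum F (P - P\<^sub>1) + sum F P\<^sub>1"
      by (rule sum.subset_diff) (auto simp: finite P\<^sub>1_def)
    also have "sum F (P - P\<^sub>1) = sum F P\<^sub>3 + sum F P\<^sub>2"
      unfolding P\<^sub>3_def by (rule sum.subset_diff) (auto simp: finite P\<^sub>2_def)
    finally show ?thesis by (simp add: add_ac)
  qed
  show ?thesis
  proof (rule slice_rank_diagonal[OF finite(1,3)])
    fix x y z assume "x \<in> B" "y \<in> B" "z \<in> B"
    then have "(if x = y \<and> y = z then 1 else 0) =
        (\<Sum>\<tau>\<in>P\<^sub>1. \<phi> (p\<^sub>1 \<tau>) x * (c \<tau> * \<phi> (p\<^sub>2 \<tau>) y * \<phi> (p\<^sub>3 \<tau>) z))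
      + (\<Sum>\<tau>\<in>P\<^sub>2. \<phi> (p\<^sub>2 \<tau>) y * (c \<tau> * \<phi> (p\<^sub>1 \<tau>) x * \<phi> (p\<^sub>3 \<tau>) z))
      + (\<Sum>\<tau>\<in>P\<^sub>3. \<phi> (p\<^sub>3 \<tau>) z * (c \<tau> * \<phi> (p\<^sub>1 \<tau>) x * \<phi> (p\<^sub>2 \<tau>) y))"
      by (simp add: expansion split mult_ac)
    then show "(if x = y \<and> y = z then 1 else 0) =
        (\<Sum>j\<in>J. \<phi> j x * (\<Sum>\<tau>\<in>{\<tau>\<in>P\<^sub>1. p\<^sub>1 \<tau> = j}. c \<tau> * \<phi> (p\<^sub>2 \<tau>) y * \<phi> (p\<^sub>3 \<tau>) z))
      + (\<Sum>j\<in>J. \<phi> j y * (\<Sum>\<tau>\<in>{\<tau>\<in>P\<^sub>2. p\<^sub>2 \<tau> = j}. c \<tau> * \<phi> (p\<^sub>1 \<tau>) x * \<phi> (p\<^sub>3 \<tau>) z))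
      + (\<Sum>j\<in>J. \<phi> j z * (\<Sum>\<tau>\<in>{\<tau>\<in>P\<^sub>3. p\<^sub>3 \<tau> = j}. c \<tau> * \<phi> (p\<^sub>1 \<tau>) x * \<phi> (p\<^sub>2 \<tau>) y))"
      by (simp only:
          sum_group_by_label[OF finite_parts(1) finite(3) labels(1), where f = "\<lambda>j. \<phi> j x"]
          sum_group_by_label[OF finite_parts(2) finite(3) labels(2), where f = "\<lambda>j. \<phi> j y"]
          sum_group_by_label[OF finite_parts(3) finite(3) labels(3), where f = "\<lambda>j. \<phi> j z"])
  qed
qed

section \<open>Three-term equations in vector spaces over a finite field\<close>

definition coord_space :: "nat \<Rightarrow> (nat \<Rightarrow> 'a::zero) set" where
  "coord_space n = {x. \<forall>i\<ge>n. x i = 0}"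

definition scale :: "'a::times \<Rightarrow> (nat \<Rightarrow> 'a) \<Rightarrow> nat \<Rightarrow> 'a" (infixr "\<star>" 75) where
  "c \<star> x = (\<lambda>i. c * x i)"

lemma scale_apply [simp]: "(c \<star> x) i = c * x i"
  by (simp add: scale_def)

interpretation coord: vector_space "(\<star>) :: 'a::field \<Rightarrow> (nat \<Rightarrow> 'a) \<Rightarrow> nat \<Rightarrow> 'a"
  by unfold_locales (auto simp: fun_eq_iff algebra_simps)

lemma subspace_coord_space: "coord.subspace (coord_space n :: (nat \<Rightarrow> 'a::field) set)"
  by (auto simp: coord.subspace_def coord_space_def)

lemmas coord_space_closed [simp] =
  coord.subspace_0[OF subspace_coord_space] coord.subspace_add[OF subspace_coord_space]
  coord.subspace_diff[OF subspace_coord_space] coord.subspace_scale[OF subspace_coord_space]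
  coord.subspace_sum[OF subspace_coord_space]

lemma sum_fun_apply: "(\<Sum>j\<in>J. x j) i = (\<Sum>j\<in>J. x j i)"
  by (induction J rule: infinite_finite_induct) auto

lemma bij_betw_coord_space:
  "bij_betw (\<lambda>x. restrict x {..<n}) (coord_space n) ({..<n} \<rightarrow>\<^sub>E (UNIV :: 'a::field set))"
proof (rule bij_betwI[where g = "\<lambda>x i. if i < n then x i else 0"])
  fix x :: "nat \<Rightarrow> 'a" assume "x \<in> coord_space n"
  then show "(\<lambda>i. if i < n then restrict x {..<n} i else 0) = x"
    by (auto simp: coord_space_def fun_eq_iff)
next
  fix y :: "nat \<Rightarrow> 'a" assume "y \<in> {..<n} \<rightarrow>\<^sub>E UNIV"
  then show "restrict (\<lambda>i. if i < n then y i else 0) {..<n} = y"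
    by (auto simp: fun_eq_iff PiE_def extensional_def)
qed (auto simp: coord_space_def)

lemma finite_coord_space [simp]: "finite (coord_space n :: (nat \<Rightarrow> 'a::{field,finite}) set)"
  using bij_betw_finite[OF bij_betw_coord_space[of n]] by (auto intro: finite_PiE)

lemma card_coord_space: "card (coord_space n :: (nat \<Rightarrow> 'a::{field,finite}) set) = CARD('a) ^ n"
  using bij_betw_same_card[OF bij_betw_coord_space[of n, where 'a = 'a]] by (simp add: card_PiE)

lemma card_subset_coord_space_le:
  assumes "(A :: (nat \<Rightarrow> 'a::{field,finite}) set) \<subseteq> coord_space n"
  shows "card A \<le> CARD('a) ^ n"
  using card_mono[OF finite_coord_space assms] by (simp add: card_coord_space)

lemma card_field_ge_2: "2 \<le> CARD('a::{field,finite})"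
proof -
  have "card {0, 1::'a} \<le> CARD('a)" by (intro card_mono) auto
  then show ?thesis by simp
qed

lemma power_card_minus_1_eq_1:
  fixes u :: "'a::{field,finite}"
  assumes "u \<noteq> 0"
  shows "u ^ (CARD('a) - 1) = 1"
proof -
  have "(\<Prod>y\<in>UNIV - {0}. u * y) = (\<Prod>y\<in>UNIV - {0}. y)"
    by (rule prod.reindex_bij_witness[of _ "\<lambda>y. y / u" "\<lambda>y. u * y"]) (use assms in auto)
  then have "u ^ (CARD('a) - 1) * (\<Prod>y\<in>UNIV - {0}. y) = (\<Prod>y\<in>UNIV - {0}. y)"
    by (simp add: prod.distrib card_Diff_singleton)
  then show ?thesis by simp
qed

lemma indicator_zero_vector_eq_prod:
  fixes w :: "nat \<Rightarrow> 'a::{field,finite}"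
  assumes "w \<in> coord_space d"
  shows "(if w = 0 then 1 else 0) = (\<Prod>j<d. 1 - w j ^ (CARD('a) - 1))"
proof (cases "w = 0")
  case True
  then show ?thesis using card_field_ge_2[where 'a = 'a] by (simp add: power_0_left)
next
  case False
  then obtain i where nonzero: "w i \<noteq> 0" by (auto simp: fun_eq_iff)
  then have "i < d" using assms by (auto simp: coord_space_def not_less[symmetric])
  then show ?thesis using False power_card_minus_1_eq_1[OF nonzero] by (auto intro!: bexI[of _ i])
qed

definition exponent_triples :: "nat \<Rightarrow> (nat \<times> nat \<times> nat) set" where
  "exponent_triples m = {(i, j, k). i + j + k \<le> m}"

lemma finite_exponent_triples [simp]: "finite (exponent_triples m)"
  by (rule finite_subset[of _ "{..m} \<times> {..m} \<times> {..m}"]) (auto simp: exponent_triples_def)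

lemma trinomial_power_expansion:
  fixes x :: "'a::comm_semiring_1"
  shows "(x + y + z) ^ m = (\<Sum>(i, j, k)\<in>exponent_triples m.
    (if i + j + k = m then of_nat (m choose i) * of_nat ((m - i) choose j) else 0)
      * x ^ i * y ^ j * z ^ k)"
    (is "_ = ?expansion")
proof -
  have "(x + y + z) ^ m = (\<Sum>i\<le>m. of_nat (m choose i) * x ^ i * (y + z) ^ (m - i))"
    unfolding add.assoc by (rule binomial_ring)
  also have "\<dots> = (\<Sum>i\<le>m. \<Sum>j\<le>m - i. of_nat (m choose i) * x ^ i *
      (of_nat ((m - i) choose j) * y ^ j * z ^ (m - i - j)))"
    by (simp add: binomial_ring sum_distrib_left)
  also have "\<dots> = (\<Sum>(i, j)\<in>(SIGMA i:{..m}. {..m - i}). of_nat (m choose i) * x ^ i *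
      (of_nat ((m - i) choose j) * y ^ j * z ^ (m - i - j)))"
    by (subst sum.Sigma) auto
  also have "\<dots> = (\<Sum>(i, j, k)\<in>{(i, j, k). i + j + k = m}.
      of_nat (m choose i) * of_nat ((m - i) choose j) * x ^ i * y ^ j * z ^ k)"
    by (rule sum.reindex_bij_witness[of _ "\<lambda>(i, j, k). (i, j)" "\<lambda>(i, j). (i, j, m - i - j)"])
      (auto simp: mult_ac)
  also have "\<dots> = ?expansion"
    by (rule sum.mono_neutral_cong_left[OF finite_exponent_triples])
      (auto simp: exponent_triples_def split: if_splits)
  finally show ?thesis .
qed

lemma one_minus_trinomial_power_expansion:
  fixes b\<^sub>1 b\<^sub>2 b\<^sub>3 :: "'a::field"
  obtains c where "\<And>x y z. 1 - (b\<^sub>1 * x + b\<^sub>2 * y + b\<^sub>3 * z) ^ m =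
    (\<Sum>(i, j, k)\<in>exponent_triples m. c (i, j, k) * x ^ i * y ^ j * z ^ k)"
proof -
  define t where "t = (\<lambda>(i, j, k).
    (if i + j + k = m then of_nat (m choose i) * of_nat ((m - i) choose j) else 0)
    * b\<^sub>1 ^ i * b\<^sub>2 ^ j * b\<^sub>3 ^ k)"
  define c where "c = (\<lambda>e. (if e = (0, 0, 0) then 1 else 0) - t e)"
  have "1 - (b\<^sub>1 * x + b\<^sub>2 * y + b\<^sub>3 * z) ^ m =
      (\<Sum>(i, j, k)\<in>exponent_triples m. c (i, j, k) * x ^ i * y ^ j * z ^ k)" for x y z
  proof -
    have "(\<Sum>e\<in>exponent_triples m. if e = (0, 0, 0) then 1 else 0) = (1::'a)"
      by (subst sum.delta[OF finite_exponent_triples]) (simp add: exponent_triples_def)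
    moreover have "(b\<^sub>1 * x + b\<^sub>2 * y + b\<^sub>3 * z) ^ m =
        (\<Sum>(i, j, k)\<in>exponent_triples m. t (i, j, k) * x ^ i * y ^ j * z ^ k)"
      unfolding trinomial_power_expansion
      by (intro sum.cong) (auto simp: t_def power_mult_distrib)
    ultimately have "1 - (b\<^sub>1 * x + b\<^sub>2 * y + b\<^sub>3 * z) ^ m = (\<Sum>e\<in>exponent_triples m.
        (if e = (0, 0, 0) then 1 else 0)
          - (case e of (i, j, k) \<Rightarrow> t (i, j, k) * x ^ i * y ^ j * z ^ k))"
      by (simp add: sum_subtractf)
    also have "\<dots> = (\<Sum>(i, j, k)\<in>exponent_triples m. c (i, j, k) * x ^ i * y ^ j * z ^ k)"
      by (intro sum.cong) (auto simp: c_def left_diff_distrib split: if_splits)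
    finally show ?thesis .
  qed
  then show ?thesis using that by blast
qed

definition low_exponents :: "nat \<Rightarrow> nat \<Rightarrow> (nat \<Rightarrow> nat) set" where
  "low_exponents m d = {e \<in> {..<d} \<rightarrow>\<^sub>E {..m}. 3 * (\<Sum>j<d. e j) \<le> m * d}"

lemma finite_low_exponents [simp]: "finite (low_exponents m d)"
  unfolding low_exponents_def
  by (rule finite_subset[of _ "{..<d} \<rightarrow>\<^sub>E {..m}"]) (auto intro: finite_PiE)

lemma card_low_exponents_chernoff:
  fixes w :: real
  assumes w_bounds: "0 < w" "w < 1"
  shows "card (low_exponents m d) * (w ^ m) ^ d \<le> (\<Sum>i\<le>m. w ^ (3 * i)) ^ d"
proof -
  have "card (low_exponents m d) * (w ^ m) ^ d = (\<Sum>e\<in>low_exponents m d. w ^ (m * d))"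
    by (simp add: power_mult)
  also have "\<dots> \<le> (\<Sum>e\<in>low_exponents m d. w ^ (3 * (\<Sum>j<d. e j)))"
    using w_bounds by (intro sum_mono power_decreasing) (auto simp: low_exponents_def)
  also have "\<dots> \<le> (\<Sum>e\<in>{..<d} \<rightarrow>\<^sub>E {..m}. w ^ (3 * (\<Sum>j<d. e j)))"
    using w_bounds by (intro sum_mono2) (auto simp: low_exponents_def intro: finite_PiE)
  also have "\<dots> = (\<Sum>e\<in>{..<d} \<rightarrow>\<^sub>E {..m}. \<Prod>j<d. w ^ (3 * e j))"
    by (simp add: power_sum sum_distrib_left)
  also have "\<dots> = (\<Prod>j<d. \<Sum>i\<le>m. w ^ (3 * i))"
    by (subst prod_sum_PiE) auto
  finally show ?thesis by simp
qed

text \<open>Both sides agree at \<open>w = 1\<close>, where the left-hand side has the larger derivative.\<close>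

lemma ex_tilt:
  assumes "m \<ge> 1"
  obtains w :: real where "0 < w" "w < 1" "(\<Sum>i\<le>m. w ^ (3 * i)) < (real m + 1) * w ^ m"
proof -
  define f where "f = (\<lambda>w::real. real (m + 1) * w ^ m - (\<Sum>i\<le>m. w ^ (3 * i)))"
  have "2 * (\<Sum>i\<le>m. 3 * i) = 3 * (m * (m + 1))"
    by (induction m) auto
  then have "2 * (\<Sum>i\<le>m. real (3 * i)) = 3 * (real m * real (m + 1))"
    by (simp only: of_nat_mult of_nat_sum flip: of_nat_eq_iff[where 'a = real])
  moreover have "0 < real m * real (m + 1)" using assms by simp
  ultimately have "real m * real (m + 1) - (\<Sum>i\<le>m. real (3 * i)) < 0" by linarith
  moreover have "(f has_real_derivative (real m * real (m + 1) - (\<Sum>i\<le>m. real (3 * i)))) (at 1)"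
    unfolding f_def by (auto intro!: derivative_eq_intros simp: algebra_simps)
  ultimately obtain \<delta> where increase: "\<delta> > 0" "\<And>u. 0 < u \<Longrightarrow> u < \<delta> \<Longrightarrow> f 1 < f (1 - u)"
    using DERIV_neg_dec_left by blast
  define u where "u = min (\<delta> / 2) (1 / 2)"
  have u_bounds: "0 < u" "u < \<delta>" "u < 1" using increase(1) by (auto simp: u_def)
  then have "f 1 < f (1 - u)" by (intro increase(2))
  then show ?thesis using that[of "1 - u"] u_bounds by (simp add: f_def add.commute)
qed

lemma card_low_exponents_le:
  assumes "m \<ge> 1"
  obtains \<theta> :: real where "0 < \<theta>" "\<theta> < real m + 1" "\<And>d. card (low_exponents m d) \<le> \<theta> ^ d"
proof -
  obtain w :: real where tilt: "0 < w" "w < 1" "(\<Sum>i\<le>m. w ^ (3 * i)) < (real m + 1) * w ^ m"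
    by (rule ex_tilt[OF assms])
  show thesis
  proof (rule that[of "(\<Sum>i\<le>m. w ^ (3 * i)) / w ^ m"])
    show "0 < (\<Sum>i\<le>m. w ^ (3 * i)) / w ^ m" using tilt by (intro divide_pos_pos sum_pos) auto
    show "(\<Sum>i\<le>m. w ^ (3 * i)) / w ^ m < real m + 1" using tilt by (simp add: field_simps)
    show "card (low_exponents m d) \<le> ((\<Sum>i\<le>m. w ^ (3 * i)) / w ^ m) ^ d" for d
      using card_low_exponents_chernoff[OF tilt(1,2), of m d] tilt(1)
      by (simp add: power_divide field_simps)
  qed
qed

definition sols3 ::
    "'a::field \<Rightarrow> 'a \<Rightarrow> 'a \<Rightarrow> (nat \<Rightarrow> 'a) set \<Rightarrow> ((nat \<Rightarrow> 'a) \<times> (nat \<Rightarrow> 'a) \<times> (nat \<Rightarrow> 'a)) set" where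
  "sols3 b\<^sub>1 b\<^sub>2 b\<^sub>3 D = {(x, y, z). x \<in> D \<and> y \<in> D \<and> z \<in> D \<and> b\<^sub>1 \<star> x + b\<^sub>2 \<star> y + b\<^sub>3 \<star> z = 0}"

definition only_trivial_sols3 :: "'a::field \<Rightarrow> 'a \<Rightarrow> 'a \<Rightarrow> (nat \<Rightarrow> 'a) set \<Rightarrow> bool" where
  "only_trivial_sols3 b\<^sub>1 b\<^sub>2 b\<^sub>3 D \<longleftrightarrow> (\<forall>(x, y, z)\<in>sols3 b\<^sub>1 b\<^sub>2 b\<^sub>3 D. x = y \<and> y = z)"

lemma only_trivial_sols3D:
  assumes "only_trivial_sols3 b\<^sub>1 b\<^sub>2 b\<^sub>3 D" "x \<in> D" "y \<in> D" "z \<in> D"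
    and "b\<^sub>1 \<star> x + b\<^sub>2 \<star> y + b\<^sub>3 \<star> z = 0"
  shows "x = y \<and> y = z"
  using bspec[OF assms(1)[unfolded only_trivial_sols3_def], of "(x, y, z)"] assms(2-)
  by (simp add: sols3_def)

lemma finite_sols3 [simp]: "finite D \<Longrightarrow> finite (sols3 b\<^sub>1 b\<^sub>2 b\<^sub>3 D)"
  by (rule finite_subset[of _ "D \<times> D \<times> D"]) (auto simp: sols3_def)

lemma solution3_first_eq_second_imp_trivial:
  assumes "b\<^sub>3 \<noteq> (0::'a::field)" "b\<^sub>1 + b\<^sub>2 + b\<^sub>3 = 0" "b\<^sub>1 \<star> x + b\<^sub>2 \<star> x + b\<^sub>3 \<star> z = 0"
  shows "z = x"
proof -
  have "b\<^sub>1 + b\<^sub>2 = - b\<^sub>3" using assms(2) by (simp add: eq_neg_iff_add_eq_0)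
  then have "b\<^sub>1 \<star> x + b\<^sub>2 \<star> x = - (b\<^sub>3 \<star> x)" by (simp flip: coord.scale_left_distrib)
  then have "b\<^sub>3 \<star> z = b\<^sub>3 \<star> x" using assms(3) by (simp add: algebra_simps)
  then show ?thesis using assms(1) by simp
qed

lemma low_exponents_cover:
  assumes "\<tau> \<in> {..<d} \<rightarrow>\<^sub>E exponent_triples m"
  shows "(\<lambda>j\<in>{..<d}. fst (\<tau> j)) \<in> low_exponents m d
    \<or> (\<lambda>j\<in>{..<d}. fst (snd (\<tau> j))) \<in> low_exponents m d
    \<or> (\<lambda>j\<in>{..<d}. snd (snd (\<tau> j))) \<in> low_exponents m d"
proof -
  have degree: "fst (\<tau> j) + fst (snd (\<tau> j)) + snd (snd (\<tau> j)) \<le> m" if "j < d" for j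
    using PiE_mem[OF assms, of j] that by (auto simp: exponent_triples_def)
  have "(\<Sum>j<d. fst (\<tau> j)) + (\<Sum>j<d. fst (snd (\<tau> j))) + (\<Sum>j<d. snd (snd (\<tau> j))) \<le> (\<Sum>j<d. m)"
    unfolding sum.distrib[symmetric] using degree by (intro sum_mono) auto
  then have "3 * (\<Sum>j<d. fst (\<tau> j)) \<le> m * d \<or> 3 * (\<Sum>j<d. fst (snd (\<tau> j))) \<le> m * d
      \<or> 3 * (\<Sum>j<d. snd (snd (\<tau> j))) \<le> m * d"
    by (auto simp: mult.commute)
  moreover have "fst (\<tau> j) \<le> m" "fst (snd (\<tau> j)) \<le> m" "snd (snd (\<tau> j)) \<le> m" if "j < d" for j
    using degree[OF that] by auto
  ultimately show ?thesis by (auto simp: low_exponents_def)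
qed

lemma card_le_low_exponents:
  fixes B :: "(nat \<Rightarrow> 'a::{field,finite}) set"
  assumes coeffs: "b\<^sub>1 + b\<^sub>2 + b\<^sub>3 = 0" and B_sub: "B \<subseteq> coord_space d"
    and triv: "only_trivial_sols3 b\<^sub>1 b\<^sub>2 b\<^sub>3 B"
  shows "card B \<le> 3 * card (low_exponents (CARD('a) - 1) d)"
proof -
  let ?m = "CARD('a) - 1"
  define P where "P = {..<d} \<rightarrow>\<^sub>E exponent_triples ?m"
  define monomial where "monomial = (\<lambda>(e::nat \<Rightarrow> nat) (x::nat \<Rightarrow> 'a). \<Prod>j<d. x j ^ e j)"
  define p\<^sub>1 p\<^sub>2 p\<^sub>3 :: "(nat \<Rightarrow> nat \<times> nat \<times> nat) \<Rightarrow> nat \<Rightarrow> nat"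
    where "p\<^sub>1 = (\<lambda>\<tau>. \<lambda>j\<in>{..<d}. fst (\<tau> j))" and "p\<^sub>2 = (\<lambda>\<tau>. \<lambda>j\<in>{..<d}. fst (snd (\<tau> j)))"
      and "p\<^sub>3 = (\<lambda>\<tau>. \<lambda>j\<in>{..<d}. snd (snd (\<tau> j)))"
  obtain c where expansion: "\<And>x y z. 1 - (b\<^sub>1 * x + b\<^sub>2 * y + b\<^sub>3 * z) ^ ?m
      = (\<Sum>(i, j, k)\<in>exponent_triples ?m. c (i, j, k) * x ^ i * y ^ j * z ^ k)"
    using one_minus_trinomial_power_expansion by blast
  show ?thesis
  proof (rule card_le_of_diagonal_expansion)
    show "finite B" "finite P" using finite_subset[OF B_sub] by (auto simp: P_def intro: finite_PiE)
    show "p\<^sub>1 \<tau> \<in> low_exponents ?m d \<or> p\<^sub>2 \<tau> \<in> low_exponents ?m d \<or> p\<^sub>3 \<tau> \<in> low_exponents ?m d"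
      if "\<tau> \<in> P" for \<tau>
      using low_exponents_cover that unfolding P_def p\<^sub>1_def p\<^sub>2_def p\<^sub>3_def by blast
    fix x y z assume in_B: "x \<in> B" "y \<in> B" "z \<in> B"
    have "b\<^sub>1 \<star> x + b\<^sub>2 \<star> x + b\<^sub>3 \<star> x = 0" by (simp add: coeffs flip: coord.scale_left_distrib)
    then have "(x = y \<and> y = z) \<longleftrightarrow> b\<^sub>1 \<star> x + b\<^sub>2 \<star> y + b\<^sub>3 \<star> z = 0"
      using only_trivial_sols3D[OF triv in_B] by auto
    then have "(if x = y \<and> y = z then 1 else 0 :: 'a)
      = (if b\<^sub>1 \<star> x + b\<^sub>2 \<star> y + b\<^sub>3 \<star> z = 0 then 1 else 0)"
      by simp
    also have "\<dots> = (\<Prod>j<d. 1 - ((b\<^sub>1 \<star> x + b\<^sub>2 \<star> y + b\<^sub>3 \<star> z) j) ^ ?m)"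
      using in_B B_sub by (intro indicator_zero_vector_eq_prod coord_space_closed) auto
    also have "\<dots> = (\<Prod>j<d. \<Sum>t\<in>exponent_triples ?m. c t * x j ^ fst t * y j ^ fst (snd t)
      * z j ^ snd (snd t))"
      by (simp only: plus_fun_apply scale_apply expansion split_def prod.collapse)
    also have "\<dots> = (\<Sum>\<tau>\<in>P. \<Prod>j<d. c (\<tau> j) * x j ^ fst (\<tau> j) * y j ^ fst (snd (\<tau> j))
      * z j ^ snd (snd (\<tau> j)))"
      unfolding P_def by (rule prod_sum_PiE) auto
    also have "\<dots> = (\<Sum>\<tau>\<in>P. (\<Prod>j<d. c (\<tau> j)) * monomial (p\<^sub>1 \<tau>) x * monomial (p\<^sub>2 \<tau>) y
      * monomial (p\<^sub>3 \<tau>) z)"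
      by (simp add: monomial_def p\<^sub>1_def p\<^sub>2_def p\<^sub>3_def prod.distrib)
    finally show "(if x = y \<and> y = z then 1 else 0) =
      (\<Sum>\<tau>\<in>P. (\<Prod>j<d. c (\<tau> j)) * monomial (p\<^sub>1 \<tau>) x * monomial (p\<^sub>2 \<tau>) y * monomial (p\<^sub>3 \<tau>) z)" .
  qed simp
qed

locale cap_set_bound =
  fixes field_type :: "'a::{field,finite} itself" and \<theta> :: real
  assumes \<theta>_pos: "0 < \<theta>" and \<theta>_less: "\<theta> < CARD('a)"
    and card_only_trivial_sols3_le: "\<And>d (B :: (nat \<Rightarrow> 'a) set) b\<^sub>1 b\<^sub>2 b\<^sub>3.
      b\<^sub>1 + b\<^sub>2 + b\<^sub>3 = 0 \<Longrightarrow> B \<subseteq> coord_space d \<Longrightarrow> only_trivial_sols3 b\<^sub>1 b\<^sub>2 b\<^sub>3 B \<Longrightarrow>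
      card B \<le> 3 * \<theta> ^ d"

lemma ex_cap_set_bound: "\<exists>\<theta>. cap_set_bound TYPE('a::{field,finite}) \<theta>"
proof -
  let ?m = "CARD('a) - 1"
  have "?m \<ge> 1" using card_field_ge_2[where 'a = 'a] by simp
  then obtain \<theta> :: real where "0 < \<theta>" "\<theta> < real ?m + 1"
    and low_exponents: "\<And>d. card (low_exponents ?m d) \<le> \<theta> ^ d"
    using card_low_exponents_le by metis
  moreover have "card B \<le> 3 * \<theta> ^ d"
    if "b\<^sub>1 + b\<^sub>2 + b\<^sub>3 = 0" "B \<subseteq> coord_space d" "only_trivial_sols3 b\<^sub>1 b\<^sub>2 b\<^sub>3 B"
    for d and B :: "(nat \<Rightarrow> 'a) set" and b\<^sub>1 b\<^sub>2 b\<^sub>3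
    using card_le_low_exponents[OF that] low_exponents[of d] by linarith
  ultimately have "cap_set_bound TYPE('a) \<theta>" by unfold_locales auto
  then show ?thesis by blast
qed

section \<open>Supersaturation\<close>

lemma sum_le_sum_popular:
  fixes f :: "'b \<Rightarrow> real"
  assumes "finite V" "0 \<le> \<tau>"
  shows "sum f V \<le> (\<Sum>v\<in>{v\<in>V. \<tau> \<le> f v}. f v) + \<tau> * card V"
proof -
  let ?P = "{v\<in>V. \<tau> \<le> f v}"
  have "sum f V = sum f (V - ?P) + sum f ?P"
    using assms(1) by (intro sum.subset_diff) auto
  moreover have "sum f (V - ?P) \<le> (\<Sum>v\<in>V - ?P. \<tau>)"
    by (intro sum_mono) auto
  moreover have "(\<Sum>v\<in>V - ?P. \<tau>) \<le> (\<Sum>v\<in>V. \<tau>)"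
    using assms by (intro sum_mono2) auto
  ultimately show ?thesis by (simp add: mult.commute)
qed

definition affine_maps :: "nat \<Rightarrow> nat \<Rightarrow> ((nat \<Rightarrow> 'a::field) \<times> (nat \<Rightarrow> nat \<Rightarrow> 'a)) set" where
  "affine_maps d n = coord_space n \<times> ({..<d} \<rightarrow>\<^sub>E coord_space n)"

definition affine_map :: "nat \<Rightarrow> (nat \<Rightarrow> 'a::field) \<times> (nat \<Rightarrow> nat \<Rightarrow> 'a) \<Rightarrow> (nat \<Rightarrow> 'a) \<Rightarrow> nat \<Rightarrow> 'a" where
  "affine_map d v u = fst v + (\<Sum>j<d. u j \<star> snd v j)"

definition affine_preimage ::
    "nat \<Rightarrow> (nat \<Rightarrow> 'a::field) \<times> (nat \<Rightarrow> nat \<Rightarrow> 'a) \<Rightarrow> (nat \<Rightarrow> 'a) set \<Rightarrow> (nat \<Rightarrow> 'a) set" where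
  "affine_preimage d v D = {u \<in> coord_space d. affine_map d v u \<in> D}"

lemma finite_affine_maps [simp]:
  "finite (affine_maps d n :: ((nat \<Rightarrow> 'a::{field,finite}) \<times> (nat \<Rightarrow> nat \<Rightarrow> 'a)) set)"
  unfolding affine_maps_def by (intro finite_cartesian_product finite_PiE) auto

lemma card_affine_maps:
  "card (affine_maps d n :: ((nat \<Rightarrow> 'a::{field,finite}) \<times> (nat \<Rightarrow> nat \<Rightarrow> 'a)) set)
    = (CARD('a) ^ n) ^ (d + 1)"
  by (simp add: affine_maps_def card_cartesian_product card_PiE card_coord_space)

lemma affine_map_combination:
  assumes "b\<^sub>1 + b\<^sub>2 + b\<^sub>3 = (0::'a::field)" "b\<^sub>1 \<star> u\<^sub>1 + b\<^sub>2 \<star> u\<^sub>2 + b\<^sub>3 \<star> u\<^sub>3 = 0"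
  shows "b\<^sub>1 \<star> affine_map d v u\<^sub>1 + b\<^sub>2 \<star> affine_map d v u\<^sub>2 + b\<^sub>3 \<star> affine_map d v u\<^sub>3 = 0"
proof -
  have "b\<^sub>1 \<star> affine_map d v u\<^sub>1 + b\<^sub>2 \<star> affine_map d v u\<^sub>2 + b\<^sub>3 \<star> affine_map d v u\<^sub>3
      = (b\<^sub>1 + b\<^sub>2 + b\<^sub>3) \<star> fst v + (\<Sum>j<d. (b\<^sub>1 \<star> u\<^sub>1 + b\<^sub>2 \<star> u\<^sub>2 + b\<^sub>3 \<star> u\<^sub>3) j \<star> snd v j)"
    by (simp add: affine_map_def coord.scale_right_distrib coord.scale_left_distrib
        coord.scale_sum_right sum.distrib add_ac)
  then show ?thesis using assms by simp
qed

lemma card_affine_maps_into: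
  fixes D :: "(nat \<Rightarrow> 'a::{field,finite}) set"
  assumes D_sub: "D \<subseteq> coord_space n"
  shows "card {v \<in> affine_maps d n. affine_map d v u \<in> D} = card D * (CARD('a) ^ n) ^ d"
proof -
  let ?linear = "\<lambda>w. \<Sum>j<d. u j \<star> w j" and ?W = "{..<d} \<rightarrow>\<^sub>E (coord_space n :: (nat \<Rightarrow> 'a) set)"
  have linear: "?linear w \<in> coord_space n" if "w \<in> ?W" for w
    using that by (intro coord_space_closed) auto
  have "bij_betw (\<lambda>(y, w). (y - ?linear w, w)) (D \<times> ?W) {v \<in> affine_maps d n. affine_map d v u \<in> D}"
    by (rule bij_betwI[where g = "\<lambda>(x, w). (x + ?linear w, w)"])
      (use D_sub linear in \<open>auto simp: affine_maps_def affine_map_def\<close>)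
  then have "card (D \<times> ?W) = card {v \<in> affine_maps d n. affine_map d v u \<in> D}"
    by (rule bij_betw_same_card)
  then show ?thesis by (simp add: card_cartesian_product card_PiE card_coord_space)
qed

lemma affine_map_determined_by_two_values:
  fixes v v' :: "(nat \<Rightarrow> 'a::field) \<times> (nat \<Rightarrow> nat \<Rightarrow> 'a)"
  assumes affine: "v \<in> affine_maps d n" "v' \<in> affine_maps d n"
    and differ: "i < d" "u i \<noteq> u' i"
    and agree: "\<And>j. j < d \<Longrightarrow> j \<noteq> i \<Longrightarrow> snd v j = snd v' j"
      "affine_map d v u = affine_map d v' u" "affine_map d v u' = affine_map d v' u'"
  shows "v = v'"
proof -
  have "affine_map d v u - affine_map d v u' = affine_map d v' u - affine_map d v' u'"
    by (simp add: agree)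
  then have "(\<Sum>j<d. (u j - u' j) \<star> snd v j) = (\<Sum>j<d. (u j - u' j) \<star> snd v' j)"
    by (simp add: affine_map_def coord.scale_left_diff_distrib sum_subtractf)
  moreover have "(\<Sum>j\<in>{..<d} - {i}. (u j - u' j) \<star> snd v j)
    = (\<Sum>j\<in>{..<d} - {i}. (u j - u' j) \<star> snd v' j)"
    by (intro sum.cong) (auto simp: agree)
  ultimately have "(u i - u' i) \<star> snd v i = (u i - u' i) \<star> snd v' i"
    using differ by (simp add: sum.remove[of "{..<d}" i])
  then have snd_eq: "snd v j = snd v' j" if "j < d" for j
    using differ agree(1) that by (cases "j = i") auto
  then have "snd v = snd v'"
    using affine by (intro PiE_ext[of "snd v" "{..<d}" "\<lambda>_. coord_space n"])
      (auto simp: affine_maps_def)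
  moreover have "fst v = fst v'"
    using agree(2) snd_eq by (simp add: affine_map_def)
  ultimately show ?thesis by (simp add: prod_eq_iff)
qed

lemma card_affine_maps_through_two_points:
  fixes x x' :: "nat \<Rightarrow> 'a::{field,finite}"
  assumes points: "u \<in> coord_space d" "u' \<in> coord_space d" "u \<noteq> u'"
  shows "card {v \<in> affine_maps d n. affine_map d v u = x \<and> affine_map d v u' = x'}
    * (CARD('a) ^ n)\<^sup>2
    \<le> (CARD('a) ^ n) ^ (d + 1)"
proof -
  let ?V = "{v \<in> affine_maps d n. affine_map d v u = x \<and> affine_map d v u' = x'}"
  obtain i where differ: "u i \<noteq> u' i" using points by (auto simp: fun_eq_iff)
  then have "i < d" using points by (auto simp: coord_space_def not_less[symmetric])
  let ?I = "{..<d} - {i}"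
  have "inj_on (\<lambda>v. restrict (snd v) ?I) ?V"
  proof (rule inj_onI)
    fix v v' assume in_V: "v \<in> ?V" "v' \<in> ?V" and eq: "restrict (snd v) ?I = restrict (snd v') ?I"
    show "v = v'"
    proof (rule affine_map_determined_by_two_values[where u = u and u' = u' and i = i])
      show "snd v j = snd v' j" if "j < d" "j \<noteq> i" for j
        using fun_cong[OF eq, of j] that by simp
    qed (use in_V differ \<open>i < d\<close> in auto)
  qed
  moreover have "(\<lambda>v. restrict (snd v) ?I) ` ?V \<subseteq> ?I \<rightarrow>\<^sub>E coord_space n"
    by (auto simp: affine_maps_def PiE_def Pi_def)
  ultimately have "card ?V \<le> card (?I \<rightarrow>\<^sub>E (coord_space n :: (nat \<Rightarrow> 'a) set))"
    by (intro card_inj_on_le finite_PiE) auto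
  also have "\<dots> = (CARD('a) ^ n) ^ (d - 1)"
    using \<open>i < d\<close> by (simp add: card_PiE card_coord_space)
  finally have "card ?V * (CARD('a) ^ n)\<^sup>2 \<le> (CARD('a) ^ n) ^ (d - 1) * (CARD('a) ^ n)\<^sup>2"
    by simp
  also have "\<dots> = (CARD('a) ^ n) ^ (d + 1)"
    using \<open>i < d\<close> by (simp flip: power_add)
  finally show ?thesis .
qed

lemma card_affine_maps_dense_preimage_ge:
  fixes D :: "(nat \<Rightarrow> 'a::{field,finite}) set" and \<alpha> :: real
  assumes D_sub: "D \<subseteq> coord_space n" and density: "0 \<le> \<alpha>" "\<alpha> * CARD('a) ^ n \<le> card D"
  shows "\<alpha> / 2 * (CARD('a) ^ n) ^ (d + 1)
    \<le> card {v \<in> affine_maps d n. \<alpha> / 2 * CARD('a) ^ d \<le> card (affine_preimage d v D)}"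
proof -
  let ?dense = "{v \<in> affine_maps d n. \<alpha> / 2 * CARD('a) ^ d \<le> card (affine_preimage d v D)}"
  let ?V = "affine_maps d n :: ((nat \<Rightarrow> 'a) \<times> (nat \<Rightarrow> nat \<Rightarrow> 'a)) set"
  define N Q where "N = real (CARD('a) ^ n)" and "Q = real (CARD('a) ^ d)"
  have pos: "N > 0" "Q > 0" by (auto simp: N_def Q_def)
  have "Q * (\<alpha> * N * N ^ d) \<le> Q * (card D * N ^ d)"
    using density pos by (intro mult_left_mono mult_right_mono) (auto simp: N_def)
  also have "\<dots> = real (\<Sum>u\<in>(coord_space d :: (nat \<Rightarrow> 'a) set). card D * (CARD('a) ^ n) ^ d)"
    by (simp add: card_coord_space Q_def N_def)
  also have "\<dots> = (\<Sum>v\<in>?V. real (card (affine_preimage d v D)))"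
    unfolding affine_preimage_def of_nat_sum[symmetric]
    by (intro arg_cong[where f = real] sum_multicount_gen[symmetric])
      (auto simp: card_affine_maps_into[OF D_sub])
  also have "\<dots> \<le> (\<Sum>v\<in>?dense. real (card (affine_preimage d v D))) + \<alpha> / 2 * Q * card ?V"
    unfolding Q_def using sum_le_sum_popular[of ?V "\<alpha> / 2 * real (CARD('a) ^ d)"] density by simp
  also have "(\<Sum>v\<in>?dense. real (card (affine_preimage d v D))) \<le> (\<Sum>v\<in>?dense. Q)"
    unfolding Q_def
    by (intro sum_mono of_nat_mono card_subset_coord_space_le) (auto simp: affine_preimage_def)
  finally have "Q * (\<alpha> / 2 * N ^ (d + 1)) \<le> Q * card ?dense"
    by (simp add: card_affine_maps N_def algebra_simps)
  then have "\<alpha> / 2 * N ^ (d + 1) \<le> card ?dense" using pos by simp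
  then show ?thesis by (simp add: N_def)
qed

lemma nontrivial_affine_preimage_obtains:
  assumes coeffs: "b\<^sub>3 \<noteq> 0" "b\<^sub>1 + b\<^sub>2 + b\<^sub>3 = 0"
    and nontrivial: "\<not> only_trivial_sols3 b\<^sub>1 b\<^sub>2 b\<^sub>3 (affine_preimage d v D)"
  obtains u u' z where "u \<in> coord_space d" "u' \<in> coord_space d" "u \<noteq> u'"
    and "(affine_map d v u, affine_map d v u', z) \<in> sols3 b\<^sub>1 b\<^sub>2 b\<^sub>3 D"
proof -
  obtain u\<^sub>1 u\<^sub>2 u\<^sub>3 where solution: "(u\<^sub>1, u\<^sub>2, u\<^sub>3) \<in> sols3 b\<^sub>1 b\<^sub>2 b\<^sub>3 (affine_preimage d v D)"
    and not_all_equal: "\<not> (u\<^sub>1 = u\<^sub>2 \<and> u\<^sub>2 = u\<^sub>3)"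
    using nontrivial unfolding only_trivial_sols3_def by blast
  have sum_0: "b\<^sub>1 \<star> u\<^sub>1 + b\<^sub>2 \<star> u\<^sub>2 + b\<^sub>3 \<star> u\<^sub>3 = 0" using solution by (simp add: sols3_def)
  have "u\<^sub>1 \<noteq> u\<^sub>2"
    using solution3_first_eq_second_imp_trivial[OF coeffs, of u\<^sub>1 u\<^sub>3] sum_0 not_all_equal by blast
  moreover have "(affine_map d v u\<^sub>1, affine_map d v u\<^sub>2, affine_map d v u\<^sub>3) \<in> sols3 b\<^sub>1 b\<^sub>2 b\<^sub>3 D"
    using solution affine_map_combination[OF coeffs(2) sum_0]
    by (auto simp: sols3_def affine_preimage_def)
  ultimately show ?thesis
    using that[of u\<^sub>1 u\<^sub>2] solution by (auto simp: sols3_def affine_preimage_def)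
qed

lemma card_affine_maps_nontrivial_preimage_le:
  fixes D :: "(nat \<Rightarrow> 'a::{field,finite}) set"
  assumes coeffs: "b\<^sub>3 \<noteq> 0" "b\<^sub>1 + b\<^sub>2 + b\<^sub>3 = 0" and finite_D: "finite D"
  shows "card {v \<in> affine_maps d n. \<not> only_trivial_sols3 b\<^sub>1 b\<^sub>2 b\<^sub>3 (affine_preimage d v D)}
    * (CARD('a) ^ n)\<^sup>2
    \<le> (CARD('a) ^ d)\<^sup>2 * card (sols3 b\<^sub>1 b\<^sub>2 b\<^sub>3 D) * (CARD('a) ^ n) ^ (d + 1)"
proof -
  let ?nontrivial =
    "{v \<in> affine_maps d n. \<not> only_trivial_sols3 b\<^sub>1 b\<^sub>2 b\<^sub>3 (affine_preimage d v D)}"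
  let ?S = "sols3 b\<^sub>1 b\<^sub>2 b\<^sub>3 D" and ?N = "CARD('a) ^ n" and ?Q = "CARD('a) ^ d"
  define U where "U = {(u, u'). u \<in> coord_space d \<and> u' \<in> coord_space d \<and> u \<noteq> (u' :: nat \<Rightarrow> 'a)}"
  define through where "through = (\<lambda>((u, u'), (x :: nat \<Rightarrow> 'a, x', z :: nat \<Rightarrow> 'a)).
    {v\<in>affine_maps d n. affine_map d v u = x \<and> affine_map d v u' = x'})"
  have U_sub: "U \<subseteq> coord_space d \<times> coord_space d" by (auto simp: U_def)
  have finU: "finite U" using finite_subset[OF U_sub] by simp
  have "card U \<le> ?Q\<^sup>2"
    using card_mono[OF _ U_sub]
    by (simp add: card_cartesian_product card_coord_space power2_eq_square)
  have "?nontrivial \<subseteq> (\<Union>p\<in>U \<times> ?S. through p)"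
  proof
    fix v assume nontrivial: "v \<in> ?nontrivial"
    then obtain u u' z where "u \<in> coord_space d" "u' \<in> coord_space d" "u \<noteq> u'"
        "(affine_map d v u, affine_map d v u', z) \<in> ?S"
      using nontrivial_affine_preimage_obtains[OF coeffs] by blast
    then have "((u, u'), (affine_map d v u, affine_map d v u', z)) \<in> U \<times> ?S"
      by (simp add: U_def)
    then show "v \<in> (\<Union>p\<in>U \<times> ?S. through p)"
      by (rule UN_I) (use nontrivial in \<open>auto simp: through_def\<close>)
  qed
  then have "card ?nontrivial \<le> card (\<Union>p\<in>U \<times> ?S. through p)"
    by (intro card_mono) (auto simp: finU finite_D through_def)
  also have "\<dots> \<le> (\<Sum>p\<in>U \<times> ?S. card (through p))"
    by (intro card_UN_le) (auto simp: finU finite_D)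
  finally have "card ?nontrivial * ?N\<^sup>2 \<le> (\<Sum>p\<in>U \<times> ?S. card (through p) * ?N\<^sup>2)"
    by (simp flip: sum_distrib_right)
  also have "\<dots> \<le> (\<Sum>p\<in>U \<times> ?S. ?N ^ (d + 1))"
  proof (rule sum_mono)
    fix p assume "p \<in> U \<times> ?S"
    then obtain u u' x x' z where p_eq: "p = ((u, u'), x, x', z)"
      and distinct: "u \<in> coord_space d" "u' \<in> coord_space d" "u \<noteq> u'"
      by (auto simp: U_def)
    show "card (through p) * ?N\<^sup>2 \<le> ?N ^ (d + 1)"
      unfolding p_eq through_def using card_affine_maps_through_two_points[OF distinct, of n x x']
      by simp
  qed
  also have "\<dots> = card U * card ?S * ?N ^ (d + 1)" by (simp add: card_cartesian_product)
  also have "\<dots> \<le> ?Q\<^sup>2 * card ?S * ?N ^ (d + 1)"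
    using \<open>card U \<le> ?Q\<^sup>2\<close> by simp
  finally show ?thesis .
qed

lemma varnavides:
  fixes D :: "(nat \<Rightarrow> 'a::{field,finite}) set" and \<alpha> :: real
  assumes coeffs: "b\<^sub>3 \<noteq> 0" "b\<^sub>1 + b\<^sub>2 + b\<^sub>3 = 0" and D_sub: "D \<subseteq> coord_space n"
    and density: "0 \<le> \<alpha>" "\<alpha> * CARD('a) ^ n \<le> card D"
    and dense: "\<And>B. B \<subseteq> coord_space d \<Longrightarrow> \<alpha> / 2 * CARD('a) ^ d \<le> card B \<Longrightarrow>
      \<not> only_trivial_sols3 b\<^sub>1 b\<^sub>2 b\<^sub>3 B"
  shows "\<alpha> / 2 * (CARD('a) ^ n)\<^sup>2 \<le> (CARD('a) ^ d)\<^sup>2 * card (sols3 b\<^sub>1 b\<^sub>2 b\<^sub>3 D)"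
proof -
  define N Q S where "N = real (CARD('a) ^ n)" and "Q = real (CARD('a) ^ d)"
    and "S = real (card (sols3 b\<^sub>1 b\<^sub>2 b\<^sub>3 D))"
  let ?dense = "{v \<in> affine_maps d n. \<alpha> / 2 * CARD('a) ^ d \<le> card (affine_preimage d v D)}"
  let ?nontrivial =
    "{v \<in> affine_maps d n. \<not> only_trivial_sols3 b\<^sub>1 b\<^sub>2 b\<^sub>3 (affine_preimage d v D)}"
  have N_pos: "N > 0" by (simp add: N_def)
  have finite_D: "finite D" using finite_subset[OF D_sub] by simp
  have "\<not> only_trivial_sols3 b\<^sub>1 b\<^sub>2 b\<^sub>3 (affine_preimage d v D)" if "v \<in> ?dense" for v
    using that by (intro dense) (auto simp: affine_preimage_def)
  then have "card ?dense \<le> card ?nontrivial" by (intro card_mono) auto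
  then have "\<alpha> / 2 * N ^ (d + 1) * N\<^sup>2 \<le> card ?nontrivial * N\<^sup>2"
    using card_affine_maps_dense_preimage_ge[OF D_sub density, of d]
    by (intro mult_right_mono) (auto simp: N_def)
  also have "\<dots> \<le> Q\<^sup>2 * S * N ^ (d + 1)"
    using of_nat_mono[where 'a = real,
        OF card_affine_maps_nontrivial_preimage_le[OF coeffs finite_D, of d n]]
    by (simp add: N_def Q_def S_def)
  finally have "N ^ (d + 1) * (\<alpha> / 2 * N\<^sup>2) \<le> N ^ (d + 1) * (Q\<^sup>2 * S)" by (simp add: mult_ac)
  then have "\<alpha> / 2 * N\<^sup>2 \<le> Q\<^sup>2 * S" using N_pos by simp
  then show ?thesis by (simp add: N_def Q_def S_def)
qed

locale three_term_supersaturation =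
  fixes field_type :: "'a::{field,finite} itself" and c :: real and K :: nat
  assumes c_pos: "0 < c"
    and card_sols3_ge: "\<And>n (D :: (nat \<Rightarrow> 'a) set) (\<alpha>::real) b\<^sub>1 b\<^sub>2 b\<^sub>3.
      b\<^sub>3 \<noteq> 0 \<Longrightarrow> b\<^sub>1 + b\<^sub>2 + b\<^sub>3 = 0 \<Longrightarrow> D \<subseteq> coord_space n \<Longrightarrow> 0 < \<alpha> \<Longrightarrow> \<alpha> * CARD('a) ^ n \<le> card D \<Longrightarrow>
      c * \<alpha> ^ K * (CARD('a) ^ n)\<^sup>2 \<le> card (sols3 b\<^sub>1 b\<^sub>2 b\<^sub>3 D)"

lemma ex_power_between:
  fixes \<rho> x :: real
  assumes "1 < \<rho>" "1 \<le> x"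
  obtains d where "1 \<le> d" "x < \<rho> ^ d" "\<rho> ^ (d - 1) \<le> x"
proof -
  define d where "d = (LEAST d. x < \<rho> ^ d)"
  have d_large: "x < \<rho> ^ d" unfolding d_def using real_arch_pow[OF assms(1)] by (rule LeastI_ex)
  have "d \<noteq> 0" using d_large assms(2) by (intro notI) simp
  moreover from this have "\<rho> ^ (d - 1) \<le> x"
    using not_less_Least[of "d - 1" "\<lambda>d. x < \<rho> ^ d"] by (simp add: d_def)
  ultimately show ?thesis using that[of d] d_large by simp
qed

lemma density_le_1:
  fixes D :: "(nat \<Rightarrow> 'a::{field,finite}) set" and \<alpha> :: real
  assumes "D \<subseteq> coord_space n" "\<alpha> * CARD('a) ^ n \<le> card D"
  shows "\<alpha> \<le> 1"
proof -
  have "real (card D) \<le> real (CARD('a) ^ n)"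
    using card_subset_coord_space_le[OF assms(1)] by (rule of_nat_mono)
  then have "\<alpha> * CARD('a) ^ n \<le> 1 * CARD('a) ^ n" using assms(2) by linarith
  then show ?thesis by (simp add: mult_le_cancel_right)
qed

lemma (in cap_set_bound) card_sols3_ge:
  fixes D :: "(nat \<Rightarrow> 'a) set" and \<alpha> :: real
  assumes coeffs: "b\<^sub>3 \<noteq> 0" "b\<^sub>1 + b\<^sub>2 + b\<^sub>3 = 0" and D_sub: "D \<subseteq> coord_space n"
    and density: "0 < \<alpha>" "\<alpha> * CARD('a) ^ n \<le> card D"
    and L_large: "CARD('a) < (CARD('a) / \<theta>) ^ L"
  shows "1 / (2 * (real CARD('a))\<^sup>2 * 6 ^ (2 * L)) * \<alpha> ^ (2 * L + 1) * (CARD('a) ^ n)\<^sup>2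
    \<le> card (sols3 b\<^sub>1 b\<^sub>2 b\<^sub>3 D)"
proof -
  define q \<rho> S where "q = real CARD('a)" and "\<rho> = q / \<theta>" and "S = real (card (sols3 b\<^sub>1 b\<^sub>2 b\<^sub>3 D))"
  have q_pos: "q > 0" by (simp add: q_def)
  have \<rho>_gt_1: "\<rho> > 1" using \<theta>_pos \<theta>_less by (simp add: \<rho>_def q_def)
  have "1 \<le> 6 / \<alpha>" using density_le_1[OF D_sub density(2)] density by simp
  then obtain d where d_between: "1 \<le> d" "6 / \<alpha> < \<rho> ^ d" "\<rho> ^ (d - 1) \<le> 6 / \<alpha>"
    using ex_power_between[OF \<rho>_gt_1] by blast
  have "\<alpha> / 2 * (CARD('a) ^ n)\<^sup>2 \<le> (CARD('a) ^ d)\<^sup>2 * card (sols3 b\<^sub>1 b\<^sub>2 b\<^sub>3 D)"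
  proof (rule varnavides[OF coeffs D_sub less_imp_le[OF density(1)] density(2)], rule notI)
    fix B :: "(nat \<Rightarrow> 'a) set"
    assume cap_set: "B \<subseteq> coord_space d" "\<alpha> / 2 * CARD('a) ^ d \<le> card B"
      "only_trivial_sols3 b\<^sub>1 b\<^sub>2 b\<^sub>3 B"
    have "\<alpha> / 2 * q ^ d \<le> 3 * \<theta> ^ d"
      using card_only_trivial_sols3_le[OF coeffs(2) cap_set(1,3)] cap_set(2) by (simp add: q_def)
    then have "\<rho> ^ d \<le> 6 / \<alpha>" using density \<theta>_pos by (simp add: \<rho>_def power_divide field_simps)
    then show False using d_between by simp
  qed
  then have "\<alpha> / 2 * (q ^ n)\<^sup>2 \<le> (q ^ d)\<^sup>2 * S" by (simp add: q_def S_def)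
  also have "q ^ d = q * q ^ (d - 1)" using d_between(1) by (cases d) auto
  also have "(q * q ^ (d - 1))\<^sup>2 * S \<le> (q * (6 / \<alpha>) ^ L)\<^sup>2 * S"
  proof -
    have "q ^ (d - 1) \<le> (\<rho> ^ L) ^ (d - 1)"
      using L_large q_pos by (intro power_mono) (auto simp: \<rho>_def q_def)
    also have "\<dots> = (\<rho> ^ (d - 1)) ^ L" by (simp flip: power_mult add: mult.commute)
    also have "\<dots> \<le> (6 / \<alpha>) ^ L" using d_between \<rho>_gt_1 by (intro power_mono) auto
    finally show ?thesis
      using q_pos by (intro mult_right_mono power_mono mult_left_mono) (auto simp: S_def)
  qed
  finally have "1 / (2 * q\<^sup>2 * 6 ^ (2 * L)) * \<alpha> ^ (2 * L + 1) * (q ^ n)\<^sup>2 \<le> S"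
    using density q_pos by (simp add: power_mult_distrib power_divide field_simps flip: power_mult)
  then show ?thesis by (simp add: q_def S_def)
qed

lemma (in cap_set_bound) ex_three_term_supersaturation:
  "\<exists>c K. three_term_supersaturation TYPE('a) c K"
proof -
  have "1 < CARD('a) / \<theta>" using \<theta>_pos \<theta>_less by simp
  then obtain L where L_large: "CARD('a) < (CARD('a) / \<theta>) ^ L" using real_arch_pow by blast
  have "three_term_supersaturation TYPE('a) (1 / (2 * (real CARD('a))\<^sup>2 * 6 ^ (2 * L))) (2 * L + 1)"
    by unfold_locales (simp, rule card_sols3_ge[OF _ _ _ _ _ L_large])
  then show ?thesis by blast
qed

definition mean_pairs ::
    "'a::field \<Rightarrow> 'a \<Rightarrow> (nat \<Rightarrow> 'a) set \<Rightarrow> (nat \<Rightarrow> 'a) \<Rightarrow> ((nat \<Rightarrow> 'a) \<times> (nat \<Rightarrow> 'a)) set" where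
  "mean_pairs b\<^sub>1 b\<^sub>2 D x = {(y, z). y \<in> D \<and> z \<in> D \<and> b\<^sub>1 \<star> y + b\<^sub>2 \<star> z = (b\<^sub>1 + b\<^sub>2) \<star> x}"

lemma finite_mean_pairs [simp]: "finite D \<Longrightarrow> finite (mean_pairs b\<^sub>1 b\<^sub>2 D x)"
  by (rule finite_subset[of _ "D \<times> D"]) (auto simp: mean_pairs_def)

lemma mean_pairs_mono: "D \<subseteq> D' \<Longrightarrow> mean_pairs b\<^sub>1 b\<^sub>2 D x \<subseteq> mean_pairs b\<^sub>1 b\<^sub>2 D' x"
  by (auto simp: mean_pairs_def)

lemma card_mean_pairs_le:
  assumes "finite D" "b\<^sub>2 \<noteq> 0"
  shows "card (mean_pairs b\<^sub>1 b\<^sub>2 D x) \<le> card D"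
proof (rule card_inj_on_le[where f = fst])
  show "inj_on fst (mean_pairs b\<^sub>1 b\<^sub>2 D x)"
  proof (rule inj_onI)
    fix p p' assume pairs: "p \<in> mean_pairs b\<^sub>1 b\<^sub>2 D x" "p' \<in> mean_pairs b\<^sub>1 b\<^sub>2 D x"
      "fst p = fst p'"
    then have "b\<^sub>1 \<star> fst p + b\<^sub>2 \<star> snd p = (b\<^sub>1 + b\<^sub>2) \<star> x"
        "b\<^sub>1 \<star> fst p + b\<^sub>2 \<star> snd p' = (b\<^sub>1 + b\<^sub>2) \<star> x"
      by (auto simp: mean_pairs_def)
    then have "b\<^sub>2 \<star> snd p = b\<^sub>2 \<star> snd p'" by (metis add_left_cancel)
    then show "p = p'" using pairs(3) assms(2) by (simp add: prod_eq_iff)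
  qed
qed (use assms in \<open>auto simp: mean_pairs_def\<close>)

lemma card_sols3_eq_sum_mean_pairs:
  assumes "finite D"
  shows "card (sols3 b\<^sub>1 b\<^sub>2 (- (b\<^sub>1 + b\<^sub>2)) D) = (\<Sum>x\<in>D. card (mean_pairs b\<^sub>1 b\<^sub>2 D x))"
proof -
  have "b\<^sub>1 \<star> y + b\<^sub>2 \<star> z + (- (b\<^sub>1 + b\<^sub>2)) \<star> x = 0 \<longleftrightarrow> b\<^sub>1 \<star> y + b\<^sub>2 \<star> z = (b\<^sub>1 + b\<^sub>2) \<star> x" for x y z
    by (simp only: coord.scale_minus_left add_uminus_conv_diff right_minus_eq)
  then have "bij_betw (\<lambda>(x, y, z). (y, z, x)) (SIGMA x:D. mean_pairs b\<^sub>1 b\<^sub>2 D x)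
      (sols3 b\<^sub>1 b\<^sub>2 (- (b\<^sub>1 + b\<^sub>2)) D)"
    by (intro bij_betwI[where g = "\<lambda>(y, z, x). (x, y, z)"])
      (auto simp: sols3_def mean_pairs_def simp del: minus_add_distrib)
  then have "card (SIGMA x:D. mean_pairs b\<^sub>1 b\<^sub>2 D x) = card (sols3 b\<^sub>1 b\<^sub>2 (- (b\<^sub>1 + b\<^sub>2)) D)"
    by (rule bij_betw_same_card)
  then show ?thesis using assms by (simp add: card_SigmaI)
qed

lemma (in three_term_supersaturation) popular_means:
  fixes D :: "(nat \<Rightarrow> 'a) set" and \<alpha> :: real
  assumes coeffs: "b\<^sub>2 \<noteq> 0" "b\<^sub>1 + b\<^sub>2 \<noteq> 0" and D_sub: "D \<subseteq> coord_space n"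
    and density: "0 < \<alpha>" "\<alpha> * CARD('a) ^ n \<le> card D"
  obtains D' where "D' \<subseteq> D" "c / 2 * \<alpha> ^ K * CARD('a) ^ n \<le> card D'"
    and "\<And>x. x \<in> D' \<Longrightarrow> c / 2 * \<alpha> ^ K * CARD('a) ^ n \<le> card (mean_pairs b\<^sub>1 b\<^sub>2 D x)"
proof -
  define N \<beta> where "N = real (CARD('a) ^ n)" and "\<beta> = c / 2 * \<alpha> ^ K"
  have N_pos: "N > 0" by (simp add: N_def)
  have \<beta>_nonneg: "0 \<le> \<beta>" using c_pos density by (simp add: \<beta>_def)
  have finite_D: "finite D" using finite_subset[OF D_sub] by simp
  have card_D_le: "card D \<le> N"
    unfolding N_def by (intro of_nat_mono card_subset_coord_space_le D_sub)
  define D' where "D' = {x\<in>D. \<beta> * N \<le> card (mean_pairs b\<^sub>1 b\<^sub>2 D x)}"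
  have "2 * (\<beta> * N\<^sup>2) = c * \<alpha> ^ K * (CARD('a) ^ n)\<^sup>2" by (simp add: \<beta>_def N_def)
  also have "\<dots> \<le> card (sols3 b\<^sub>1 b\<^sub>2 (- (b\<^sub>1 + b\<^sub>2)) D)"
    using coeffs D_sub density by (intro card_sols3_ge) auto
  also have "\<dots> = (\<Sum>x\<in>D. real (card (mean_pairs b\<^sub>1 b\<^sub>2 D x)))"
    by (simp only: card_sols3_eq_sum_mean_pairs[OF finite_D] of_nat_sum)
  also have "\<dots> \<le> (\<Sum>x\<in>D'. real (card (mean_pairs b\<^sub>1 b\<^sub>2 D x))) + \<beta> * N * card D"
    unfolding D'_def using finite_D \<beta>_nonneg N_pos by (intro sum_le_sum_popular) auto
  also have "(\<Sum>x\<in>D'. real (card (mean_pairs b\<^sub>1 b\<^sub>2 D x))) \<le> (\<Sum>x\<in>D'. N)"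
    using card_mean_pairs_le[OF finite_D coeffs(1)] card_D_le
    by (intro sum_mono) (meson of_nat_mono order_trans)
  also have "\<beta> * N * card D \<le> \<beta> * N * N"
    using card_D_le \<beta>_nonneg N_pos by (intro mult_left_mono) auto
  finally have "N * (\<beta> * N) \<le> N * card D'" by (simp add: power2_eq_square algebra_simps)
  then have "\<beta> * N \<le> card D'" using N_pos by simp
  then show ?thesis
    using that[of D'] by (auto simp: D'_def \<beta>_def N_def)
qed

definition solutions :: "'i set \<Rightarrow> ('i \<Rightarrow> 'a::field) \<Rightarrow> (nat \<Rightarrow> 'a) set \<Rightarrow> ('i \<Rightarrow> nat \<Rightarrow> 'a) set" where
  "solutions J a D = {x \<in> J \<rightarrow>\<^sub>E D. (\<Sum>j\<in>J. a j \<star> x j) = 0}"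

lemma finite_solutions [simp]: "finite J \<Longrightarrow> finite D \<Longrightarrow> finite (solutions J a D)"
  by (rule finite_subset[of _ "J \<rightarrow>\<^sub>E D"]) (auto simp: solutions_def intro: finite_PiE)

lemma solutions_mono: "D \<subseteq> D' \<Longrightarrow> solutions J a D \<subseteq> solutions J a D'"
  unfolding solutions_def using PiE_mono[of J "\<lambda>_. D" "\<lambda>_. D'"] by blast

definition pairable :: "(nat \<Rightarrow> 'a::field) \<Rightarrow> bool" where
  "pairable a \<longleftrightarrow> (\<forall>j<5. a j \<noteq> 0) \<and> (\<Sum>j<5. a j) = 0 \<and> a 0 + a 1 \<noteq> 0 \<and> a 2 + a 3 \<noteq> 0"

lemma lessThan_5: "{..<5::nat} = {0, 1, 2, 3, 4}"
  by auto

lemma card_solutions5_ge: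
  fixes a :: "nat \<Rightarrow> 'a::field"
  assumes finite_D: "finite D" and sums: "a 0 + a 1 \<noteq> 0" "a 2 + a 3 \<noteq> 0" and D'_sub: "D' \<subseteq> D"
  shows "(\<Sum>(x, y, z)\<in>sols3 (a 0 + a 1) (a 2 + a 3) (a 4) D'.
      card (mean_pairs (a 0) (a 1) D x) * card (mean_pairs (a 2) (a 3) D y))
        \<le> card (solutions {..<5} a D)"
proof -
  let ?T = "sols3 (a 0 + a 1) (a 2 + a 3) (a 4) D'"
  let ?S = "SIGMA p:?T. mean_pairs (a 0) (a 1) D (fst p) \<times> mean_pairs (a 2) (a 3) D (fst (snd p))"
  define F where "F = (\<lambda>((x :: nat \<Rightarrow> 'a, y :: nat \<Rightarrow> 'a, z), (x\<^sub>0, x\<^sub>1), (x\<^sub>2, x\<^sub>3)).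
    (\<lambda>j\<in>{..<5}. [x\<^sub>0, x\<^sub>1, x\<^sub>2, x\<^sub>3, z :: nat \<Rightarrow> 'a] ! j))"
  have finite_D': "finite D'" using finite_D D'_sub finite_subset by blast
  have inj_F: "inj_on F ?S"
  proof (rule inj_onI)
    fix p p' assume in_S: "p \<in> ?S" "p' \<in> ?S" and F_eq: "F p = F p'"
    obtain x y z x\<^sub>0 x\<^sub>1 x\<^sub>2 x\<^sub>3 where p_eq: "p = ((x, y, z), (x\<^sub>0, x\<^sub>1), (x\<^sub>2, x\<^sub>3))"
      by (metis surj_pair)
    obtain x' y' z' x\<^sub>0' x\<^sub>1' x\<^sub>2' x\<^sub>3'
      where p'_eq: "p' = ((x', y', z'), (x\<^sub>0', x\<^sub>1'), (x\<^sub>2', x\<^sub>3'))" by (metis surj_pair)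
    have "F p j = F p' j" for j using F_eq by simp
    from this[of 0] this[of 1] this[of 2] this[of 3] this[of 4]
    have comps: "x\<^sub>0 = x\<^sub>0'" "x\<^sub>1 = x\<^sub>1'" "x\<^sub>2 = x\<^sub>2'" "x\<^sub>3 = x\<^sub>3'" "z = z'"
      by (simp_all add: F_def p_eq p'_eq)
    then have "(a 0 + a 1) \<star> x = (a 0 + a 1) \<star> x'" "(a 2 + a 3) \<star> y = (a 2 + a 3) \<star> y'"
      using in_S by (auto simp: p_eq p'_eq mean_pairs_def)
    then show "p = p'" using sums comps by (simp add: p_eq p'_eq)
  qed
  have F_into: "F p \<in> solutions {..<5} a D" if "p \<in> ?S" for p
  proof -
    obtain x y z x\<^sub>0 x\<^sub>1 x\<^sub>2 x\<^sub>3 where p_eq: "p = ((x, y, z), (x\<^sub>0, x\<^sub>1), (x\<^sub>2, x\<^sub>3))"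
      by (metis surj_pair)
    have pairs: "a 0 \<star> x\<^sub>0 + a 1 \<star> x\<^sub>1 = (a 0 + a 1) \<star> x" "a 2 \<star> x\<^sub>2 + a 3 \<star> x\<^sub>3 = (a 2 + a 3) \<star> y"
      and triple: "(a 0 + a 1) \<star> x + (a 2 + a 3) \<star> y + a 4 \<star> z = 0"
      and in_D: "{x\<^sub>0, x\<^sub>1, x\<^sub>2, x\<^sub>3, z} \<subseteq> D"
      using that D'_sub by (auto simp: p_eq mean_pairs_def sols3_def)
    have "(\<Sum>j<5. a j \<star> F p j) = (a 0 \<star> x\<^sub>0 + a 1 \<star> x\<^sub>1) + (a 2 \<star> x\<^sub>2 + a 3 \<star> x\<^sub>3) + a 4 \<star> z"
      by (simp add: lessThan_5 p_eq F_def add_ac)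
    then have "(\<Sum>j<5. a j \<star> F p j) = 0" using pairs triple by simp
    moreover have "F p \<in> {..<5} \<rightarrow>\<^sub>E D"
      unfolding lessThan_5 using in_D by (auto simp: p_eq F_def lessThan_5)
    ultimately show ?thesis by (simp add: solutions_def)
  qed
  have "(\<Sum>(x, y, z)\<in>?T. card (mean_pairs (a 0) (a 1) D x) * card (mean_pairs (a 2) (a 3) D y))
    = card ?S"
    using finite_D finite_D'
    by (subst card_SigmaI) (auto simp: card_cartesian_product intro!: sum.cong)
  also have "\<dots> \<le> card (solutions {..<5} a D)"
    using inj_F F_into finite_D by (intro card_inj_on_le[where f = F]) auto
  finally show ?thesis .
qed

locale five_term_supersaturation =
  fixes field_type :: "'a::{field,finite} itself" and c :: real and K :: nat
  assumes c_pos: "0 < c"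
    and card_solutions_ge: "\<And>n (D :: (nat \<Rightarrow> 'a) set) (\<alpha>::real) a.
      pairable a \<Longrightarrow> D \<subseteq> coord_space n \<Longrightarrow> 0 < \<alpha> \<Longrightarrow> \<alpha> * CARD('a) ^ n \<le> card D \<Longrightarrow>
      c * \<alpha> ^ K * (CARD('a) ^ n) ^ 4 \<le> card (solutions {..<5} a D)"

lemma card_solutions5_ge_of_popular:
  fixes a :: "nat \<Rightarrow> 'a::field" and u v :: real
  assumes finite_D: "finite D" and sums: "a 0 + a 1 \<noteq> 0" "a 2 + a 3 \<noteq> 0"
    and nested: "D\<^sub>2 \<subseteq> D\<^sub>1" "D\<^sub>1 \<subseteq> D" and nonneg: "0 \<le> u" "0 \<le> v"
    and popular\<^sub>1: "\<And>x. x \<in> D\<^sub>1 \<Longrightarrow> u \<le> card (mean_pairs (a 0) (a 1) D x)"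
    and popular\<^sub>2: "\<And>x. x \<in> D\<^sub>2 \<Longrightarrow> v \<le> card (mean_pairs (a 2) (a 3) D\<^sub>1 x)"
  shows "card (sols3 (a 0 + a 1) (a 2 + a 3) (a 4) D\<^sub>2) * (u * v) \<le> card (solutions {..<5} a D)"
proof -
  let ?T = "sols3 (a 0 + a 1) (a 2 + a 3) (a 4) D\<^sub>2"
  let ?m\<^sub>1 = "\<lambda>x. card (mean_pairs (a 0) (a 1) D x)"
    and ?m\<^sub>2 = "\<lambda>y. card (mean_pairs (a 2) (a 3) D y)"
  have "card ?T * (u * v) = (\<Sum>p\<in>?T. u * v)" by simp
  also have "\<dots> \<le> (\<Sum>(x, y, z)\<in>?T. real (?m\<^sub>1 x) * real (?m\<^sub>2 y))"
  proof (rule sum_mono, clarify)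
    fix x y z assume "(x, y, z) \<in> ?T"
    then have popular: "x \<in> D\<^sub>1" "y \<in> D\<^sub>2" using nested by (auto simp: sols3_def)
    have "card (mean_pairs (a 2) (a 3) D\<^sub>1 y) \<le> ?m\<^sub>2 y"
      by (intro card_mono finite_mean_pairs finite_D mean_pairs_mono nested)
    then have "v \<le> ?m\<^sub>2 y" using popular\<^sub>2[OF popular(2)] by linarith
    then show "u * v \<le> real (?m\<^sub>1 x) * real (?m\<^sub>2 y)"
      using popular\<^sub>1[OF popular(1)] nonneg by (intro mult_mono) auto
  qed
  also have "\<dots> = real (\<Sum>(x, y, z)\<in>?T. ?m\<^sub>1 x * ?m\<^sub>2 y)" by (simp add: case_prod_unfold)
  also have "\<dots> \<le> card (solutions {..<5} a D)"
    using nested by (intro of_nat_mono card_solutions5_ge finite_D sums) auto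
  finally show ?thesis .
qed

text \<open>Solve the three-term equation with coefficients \<open>a\<^sub>0 + a\<^sub>1\<close>, \<open>a\<^sub>2 + a\<^sub>3\<close>, \<open>a\<^sub>4\<close> among elements that
  are weighted means of many pairs, and split the first two terms into such pairs.\<close>

lemma (in three_term_supersaturation) ex_five_term_supersaturation:
  "\<exists>C L. five_term_supersaturation TYPE('a) C L"
proof -
  define k where "k = c / 2"
  have k_pos: "k > 0" using c_pos by (simp add: k_def)
  define C where "C = c * (k * k ^ K) ^ K * k * (k * k ^ K)"
  define L where "L = K * K * K + K + K * K"
  have "five_term_supersaturation TYPE('a) C L"
  proof
    show "0 < C" using k_pos c_pos by (simp add: C_def)
    fix n and D :: "(nat \<Rightarrow> 'a) set" and \<alpha> :: real and a :: "nat \<Rightarrow> 'a"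
    assume "pairable a" and D_sub: "D \<subseteq> coord_space n"
      and density: "0 < \<alpha>" "\<alpha> * CARD('a) ^ n \<le> card D"
    then have coeffs: "a 1 \<noteq> 0" "a 3 \<noteq> 0" "a 4 \<noteq> 0" "a 0 + a 1 \<noteq> 0" "a 2 + a 3 \<noteq> 0"
      "(\<Sum>j<5. a j) = 0"
      by (auto simp: pairable_def)
    define N \<gamma> \<delta> where "N = real (CARD('a) ^ n)" and "\<gamma> = k * \<alpha> ^ K" and "\<delta> = k * \<gamma> ^ K"
    have pos: "N > 0" "\<gamma> > 0" "\<delta> > 0" using k_pos density by (auto simp: N_def \<gamma>_def \<delta>_def)
    obtain D\<^sub>1 where popular\<^sub>1: "D\<^sub>1 \<subseteq> D" "\<gamma> * N \<le> card D\<^sub>1"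
      "\<And>x. x \<in> D\<^sub>1 \<Longrightarrow> \<gamma> * N \<le> card (mean_pairs (a 0) (a 1) D x)"
      using popular_means[OF coeffs(1,4) D_sub density] unfolding \<gamma>_def k_def N_def by auto
    obtain D\<^sub>2 where popular\<^sub>2: "D\<^sub>2 \<subseteq> D\<^sub>1" "\<delta> * N \<le> card D\<^sub>2"
      "\<And>x. x \<in> D\<^sub>2 \<Longrightarrow> \<delta> * N \<le> card (mean_pairs (a 2) (a 3) D\<^sub>1 x)"
      using popular_means[OF coeffs(2,5) subset_trans[OF popular\<^sub>1(1) D_sub] pos(2)] popular\<^sub>1(2)
      unfolding \<delta>_def k_def N_def by auto
    let ?T = "sols3 (a 0 + a 1) (a 2 + a 3) (a 4) D\<^sub>2"
    have "(a 0 + a 1) + (a 2 + a 3) + a 4 = 0" using coeffs(6) by (simp add: lessThan_5 add_ac)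
    then have "c * \<delta> ^ K * (CARD('a) ^ n)\<^sup>2 \<le> card ?T"
      using popular\<^sub>1 popular\<^sub>2 D_sub by (intro card_sols3_ge coeffs(3) pos) (auto simp: N_def)
    then have "c * \<delta> ^ K * N\<^sup>2 * ((\<gamma> * N) * (\<delta> * N)) \<le> card ?T * ((\<gamma> * N) * (\<delta> * N))"
      using pos by (intro mult_right_mono) (auto simp: N_def)
    also have "\<dots> \<le> card (solutions {..<5} a D)"
      using pos
      by (intro card_solutions5_ge_of_popular[OF _ coeffs(4,5) popular\<^sub>2(1) popular\<^sub>1(1)]
          popular\<^sub>1(3) popular\<^sub>2(3)) (auto intro: finite_subset[OF D_sub])
    finally show "C * \<alpha> ^ L * (CARD('a) ^ n) ^ 4 \<le> card (solutions {..<5} a D)"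
      by (simp add: C_def L_def \<delta>_def \<gamma>_def N_def power_mult_distrib power_add power_mult[symmetric]
          power_numeral_reduce mult_ac)
  qed
  then show ?thesis by blast
qed

lemma ex_five_term_supersaturation: "\<exists>c K. five_term_supersaturation TYPE('a::{field,finite}) c K"
  using ex_cap_set_bound cap_set_bound.ex_three_term_supersaturation
    three_term_supersaturation.ex_five_term_supersaturation by metis

section \<open>Differences in finite abelian groups\<close>

definition difference_count :: "'g::plus set \<Rightarrow> 'g set \<Rightarrow> 'g \<Rightarrow> real" where
  "difference_count A B d = card {b \<in> B. b + d \<in> A}"

lemma difference_count_nonneg [simp]: "0 \<le> difference_count A B d"
  by (simp add: difference_count_def)

lemma difference_count_0 [simp]: "difference_count A A (0 :: 'g::monoid_add) = card A"
  by (simp add: difference_count_def)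

lemma difference_count_le_card: "finite B \<Longrightarrow> difference_count A B d \<le> card B"
  unfolding difference_count_def by (intro of_nat_mono card_mono) auto

definition translate_density :: "'g::plus set \<Rightarrow> 'g set \<Rightarrow> 'g \<Rightarrow> real" where
  "translate_density A B x = difference_count A B x / card B"

lemma translate_density_nonneg [simp]: "0 \<le> translate_density A B x"
  by (simp add: translate_density_def)

definition additive_energy :: "'g::plus set \<Rightarrow> 'g set \<Rightarrow> real" where
  "additive_energy G A = (\<Sum>d\<in>G. (difference_count A A d)\<^sup>2)"

definition popular_density :: "'g set \<Rightarrow> 'g set \<Rightarrow> real \<Rightarrow> real" where
  "popular_density G A R = real ((card A)\<^sup>2) / (8 * R * real (card G))"

definition Kst_free_in :: "'g::plus set \<Rightarrow> nat \<Rightarrow> nat \<Rightarrow> 'g set \<Rightarrow> bool" where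
  "Kst_free_in G s t A \<longleftrightarrow>
    \<not> (\<exists>X Y. X \<subseteq> G \<and> Y \<subseteq> G \<and> card X = s \<and> card Y = t \<and> (\<forall>x\<in>X. \<forall>y\<in>Y. x + y \<in> A))"

locale finite_subgroup =
  fixes G :: "'g::ab_group_add set"
  assumes finite_G: "finite G"
    and zero_closed: "0 \<in> G"
    and add_closed: "x \<in> G \<Longrightarrow> y \<in> G \<Longrightarrow> x + y \<in> G"
    and diff_closed: "x \<in> G \<Longrightarrow> y \<in> G \<Longrightarrow> x - y \<in> G"
begin

lemma finite_subset_G: "A \<subseteq> G \<Longrightarrow> finite A"
  using finite_subset finite_G by blast

lemma card_G_pos: "0 < card G"
  using finite_G zero_closed by (auto simp: card_gt_0_iff)

lemma sum_difference_count_mult: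
  fixes w :: "'g \<Rightarrow> 'b::real_normed_field"
  assumes A_sub: "A \<subseteq> G" and B_sub: "B \<subseteq> G"
  shows "(\<Sum>d\<in>G. of_real (difference_count A B d) * w d) = (\<Sum>b\<in>B. \<Sum>a\<in>A. w (a - b))"
proof -
  have "of_real (difference_count A B d) * w d = (\<Sum>b\<in>B. if b + d \<in> A then w d else 0)" for d
    using finite_subset_G[OF B_sub] by (simp add: difference_count_def sum.If_cases Int_def)
  then have "(\<Sum>d\<in>G. of_real (difference_count A B d) * w d)
    = (\<Sum>b\<in>B. \<Sum>d\<in>G. if b + d \<in> A then w d else 0)"
    by (simp add: sum.swap[of _ G])
  also have "\<dots> = (\<Sum>b\<in>B. \<Sum>d\<in>{d\<in>G. b + d \<in> A}. w d)"
    using finite_G by (simp add: sum.If_cases Int_def)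
  also have "\<dots> = (\<Sum>b\<in>B. \<Sum>a\<in>A. w (a - b))"
  proof (rule sum.cong[OF refl])
    fix b assume "b \<in> B"
    then have "b \<in> G" using B_sub by auto
    then show "(\<Sum>d\<in>{d\<in>G. b + d \<in> A}. w d) = (\<Sum>a\<in>A. w (a - b))"
      using subsetD[OF A_sub]
      by (intro sum.reindex_bij_witness[of _ "\<lambda>a. a - b" "\<lambda>d. b + d"]) (auto intro: diff_closed)
  qed
  finally show ?thesis .
qed

lemma sum_difference_count:
  "A \<subseteq> G \<Longrightarrow> B \<subseteq> G \<Longrightarrow> (\<Sum>d\<in>G. difference_count A B d) = card A * card B"
  using sum_difference_count_mult[of A B "\<lambda>_. 1::real"] by simp

lemma sum_difference_count_squared:
  assumes A_sub: "A \<subseteq> G" and B_sub: "B \<subseteq> G"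
  shows "(\<Sum>d\<in>G. (difference_count A B d)\<^sup>2)
    = (\<Sum>d\<in>G. difference_count B B d * difference_count A A d)"
proof -
  have "(\<Sum>a\<in>A. difference_count A B (a - b)) = (\<Sum>b'\<in>B. difference_count A A (b' - b))" for b
  proof -
    have "(\<Sum>a\<in>A. difference_count A B (a - b)) = (\<Sum>a\<in>A. \<Sum>b'\<in>B. if a + (b' - b) \<in> A then 1 else 0)"
      using finite_subset_G[OF B_sub]
      by (intro sum.cong) (auto simp: difference_count_def sum.If_cases Int_def algebra_simps)
    also have "\<dots> = (\<Sum>b'\<in>B. \<Sum>a\<in>A. if a + (b' - b) \<in> A then 1 else 0)" by (rule sum.swap)
    also have "\<dots> = (\<Sum>b'\<in>B. difference_count A A (b' - b))"
      using finite_subset_G[OF A_sub] by (simp add: difference_count_def sum.If_cases Int_def)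
    finally show ?thesis .
  qed
  then show ?thesis
    using sum_difference_count_mult[OF A_sub B_sub, of "difference_count A B"]
      sum_difference_count_mult[OF B_sub B_sub, of "difference_count A A"]
    by (simp add: power2_eq_square)
qed

end

locale small_correlations = finite_subgroup +
  fixes A and R :: real
  assumes A_subset: "A \<subseteq> G" and A_nonempty: "A \<noteq> {}" and R_ge_1: "1 \<le> R"
    and correlation_le: "d \<in> G \<Longrightarrow> d \<noteq> 0 \<Longrightarrow> difference_count A A d \<le> R"
begin

lemma card_A_pos: "0 < card A"
  using finite_subset_G[OF A_subset] A_nonempty by (simp add: card_gt_0_iff)

lemma card_A_le: "card A \<le> card G"
  by (intro card_mono finite_G A_subset)

lemma sum_difference_count_squared_le:
  assumes B_sub: "B \<subseteq> G"
  shows "(\<Sum>x\<in>G. (difference_count A B x)\<^sup>2) \<le> card A * card B + R * (card B)\<^sup>2"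
proof -
  have "(\<Sum>x\<in>G. (difference_count A B x)\<^sup>2)
      = card A * card B + (\<Sum>d\<in>G - {0}. difference_count B B d * difference_count A A d)"
    unfolding sum_difference_count_squared[OF A_subset B_sub]
    using finite_G zero_closed by (subst sum.remove[of _ 0]) auto
  also have "(\<Sum>d\<in>G - {0}. difference_count B B d * difference_count A A d)
      \<le> (\<Sum>d\<in>G - {0}. difference_count B B d * R)"
    by (intro sum_mono mult_left_mono correlation_le) auto
  also have "\<dots> \<le> (\<Sum>d\<in>G. difference_count B B d * R)"
    using finite_G R_ge_1 by (intro sum_mono2) auto
  also have "\<dots> = R * (card B)\<^sup>2"
    by (simp add: sum_difference_count[OF B_sub B_sub] power2_eq_square flip: sum_distrib_right)
  finally show ?thesis by simp
qed

lemma popular_density_pos: "0 < popular_density G A R"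
  using card_A_pos card_G_pos R_ge_1 by (simp add: popular_density_def)

lemma popular_density_le_1: "popular_density G A R \<le> 1"
proof -
  have "real ((card A)\<^sup>2) = (\<Sum>d\<in>G. difference_count A A d)"
    by (simp add: sum_difference_count[OF A_subset A_subset] power2_eq_square)
  also have "\<dots> = card A + (\<Sum>d\<in>G - {0}. difference_count A A d)"
    using finite_G zero_closed by (subst sum.remove[of _ 0]) auto
  also have "(\<Sum>d\<in>G - {0}. difference_count A A d) \<le> (\<Sum>d\<in>G - {0}. R)"
    by (intro sum_mono correlation_le) auto
  also have "\<dots> \<le> (\<Sum>d\<in>G. R)" using R_ge_1 finite_G by (intro sum_mono2) auto
  also have "\<dots> = R * card G" by simp
  also have "real (card A) \<le> R * card G"
    using mult_mono[OF R_ge_1 of_nat_mono[OF card_A_le]] R_ge_1 by simp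
  finally have "real ((card A)\<^sup>2) \<le> 2 * (R * card G)" by simp
  also have "\<dots> \<le> 8 * (R * card G)" using R_ge_1 by simp
  finally show ?thesis
    using R_ge_1 card_G_pos by (simp add: popular_density_def)
qed

lemma mult_card_le_of_le_card:
  fixes x :: real
  assumes "8 * x \<le> card A"
  shows "x * card A \<le> card G * R"
proof -
  have "8 * x * card A \<le> real (card A) * card A" using assms by (intro mult_right_mono) auto
  also have "\<dots> = popular_density G A R * (8 * R * card G)"
    using R_ge_1 card_G_pos by (simp add: popular_density_def power2_eq_square)
  also have "\<dots> \<le> 1 * (8 * R * card G)"
    using popular_density_le_1 R_ge_1 by (intro mult_right_mono) auto
  finally show ?thesis by (simp add: mult.commute)
qed

lemma additive_energy_le:
  "additive_energy G A \<le> card A ^ 4 / (4 * popular_density G A R * card G)"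
proof -
  have "additive_energy G A \<le> card A * card A + R * (card A)\<^sup>2"
    using sum_difference_count_squared_le[OF A_subset] by (simp add: additive_energy_def)
  also have "real (card A * card A) \<le> R * (card A)\<^sup>2"
    using mult_right_mono[OF R_ge_1, of "(card A)\<^sup>2"] by (simp add: power2_eq_square)
  also have "R * (card A)\<^sup>2 + R * (card A)\<^sup>2 = card A ^ 4 / (4 * popular_density G A R * card G)"
    using card_A_pos card_G_pos R_ge_1
    by (simp add: popular_density_def power2_eq_square power4_eq_xxxx)
  finally show ?thesis by simp
qed

lemma le_of_mult_power4_le_energy:
  fixes \<epsilon> k :: real
  assumes "0 < \<epsilon>" "k * (\<epsilon> * card A) ^ 4 \<le> card G * additive_energy G A"
  shows "k \<le> 1 / (4 * popular_density G A R * \<epsilon> ^ 4)"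
proof -
  have "k * (\<epsilon> * card A) ^ 4 \<le> card G * (card A ^ 4 / (4 * popular_density G A R * card G))"
    using assms(2) mult_left_mono[OF additive_energy_le, of "real (card G)"] by simp
  then show ?thesis
    using assms(1) card_A_pos card_G_pos popular_density_pos
    by (simp add: power_mult_distrib field_simps)
qed

lemma card_popular_translates_ge:
  assumes B_sub: "B \<subseteq> G" and large: "card A \<le> card B * R"
  shows "popular_density G A R * card G
    \<le> card {x \<in> G. card A / (2 * card G) \<le> translate_density A B x}"
proof -
  let ?\<tau> = "card A * card B / (2 * card G)"
    and ?D = "{x \<in> G. card A / (2 * card G) \<le> translate_density A B x}"
  have B_pos: "0 < card B"
    using large card_A_pos by (cases "card B = 0") auto
  then have D_eq: "?D = {x \<in> G. ?\<tau> \<le> difference_count A B x}"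
    by (simp add: translate_density_def le_divide_eq)
  have "real (card A * card B) = (\<Sum>x\<in>G. difference_count A B x)"
    by (simp add: sum_difference_count[OF A_subset B_sub])
  also have "\<dots> \<le> (\<Sum>x\<in>?D. difference_count A B x) + ?\<tau> * card G"
    unfolding D_eq by (intro sum_le_sum_popular finite_G) auto
  finally have "card A * card B / 2 \<le> (\<Sum>x\<in>?D. difference_count A B x)"
    using card_G_pos by simp
  then have "(card A * card B / 2)\<^sup>2 \<le> (\<Sum>x\<in>?D. difference_count A B x)\<^sup>2"
    by (intro power_mono) auto
  also have "\<dots> \<le> (\<Sum>x\<in>?D. (difference_count A B x)\<^sup>2) * card ?D"
    by (rule sum_squared_le_sum_of_squares)
  also have "\<dots> \<le> (\<Sum>x\<in>G. (difference_count A B x)\<^sup>2) * card ?D"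
    using finite_G by (intro mult_right_mono sum_mono2) auto
  also have "\<dots> \<le> (card A * card B + R * (card B)\<^sup>2) * card ?D"
    by (intro mult_right_mono sum_difference_count_squared_le B_sub) auto
  also have "\<dots> \<le> (2 * R * (card B)\<^sup>2) * card ?D"
    using mult_right_mono[OF large, of "real (card B)"]
    by (intro mult_right_mono) (auto simp: power2_eq_square algebra_simps)
  finally have "(card B)\<^sup>2 * real ((card A)\<^sup>2) \<le> (card B)\<^sup>2 * (8 * R * card ?D)"
    by (simp add: power_mult_distrib power_divide field_simps)
  then have "real ((card A)\<^sup>2) \<le> 8 * R * card ?D" using B_pos by simp
  then show ?thesis
    using R_ge_1 card_G_pos by (simp add: popular_density_def field_simps)
qed

end

lemma binomial_ge_power:
  assumes "2 \<le> s" "2 * s \<le> m"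
  shows "(m / (2 * s)) ^ (s - 2) \<le> ((m - 2) choose (s - 2))"
proof (cases "s = 2")
  case False
  then have s_gt_2: "0 < s - 2" using assms by simp
  have "real m / (2 * s) \<le> real (m - 2) / (s - 2)"
  proof -
    have "real m / (2 * s) \<le> real m / (2 * (s - 2))"
      using s_gt_2 by (intro divide_left_mono) auto
    also have "\<dots> = (real m / 2) / (s - 2)" by simp
    also have "\<dots> \<le> real (m - 2) / (s - 2)"
      using assms by (intro divide_right_mono) (auto simp: of_nat_diff)
    finally show ?thesis .
  qed
  then have "(m / (2 * s)) ^ (s - 2) \<le> (real (m - 2) / (s - 2)) ^ (s - 2)"
    by (intro power_mono) auto
  also have "\<dots> \<le> ((m - 2) choose (s - 2))"
    using assms by (intro binomial_ge_n_over_k_pow_k) auto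
  finally show ?thesis by simp
qed simp

context finite_subgroup
begin

lemma Kst_free_in_card_less:
  assumes "Kst_free_in G s t A" "X \<subseteq> G" "card X = s"
  shows "card {y \<in> G. \<forall>x\<in>X. x + y \<in> A} < t"
proof (rule ccontr)
  assume "\<not> ?thesis"
  then obtain Y where "Y \<subseteq> {y \<in> G. \<forall>x\<in>X. x + y \<in> A}" "card Y = t"
    using obtain_subset_with_card_n[of t "{y \<in> G. \<forall>x\<in>X. x + y \<in> A}"] by auto
  then show False using assms unfolding Kst_free_in_def by blast
qed

lemma card_translate:
  assumes "A \<subseteq> G" "y \<in> G"
  shows "card {z \<in> G. z + y \<in> A} = card A"
proof -
  have "bij_betw (\<lambda>z. z + y) {z \<in> G. z + y \<in> A} A"
    by (rule bij_betwI[where g = "\<lambda>x. x - y"]) (use assms diff_closed in auto)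
  then show ?thesis by (rule bij_betw_same_card)
qed

text \<open>Count the pairs of a translate \<open>y\<close> and a set \<open>Z\<close> of size \<open>s - 2\<close> such that
  \<open>{0, d} \<union> Z + y \<subseteq> A\<close>.\<close>

lemma Kst_free_in_difference_count_mult_binomial_le:
  assumes A_sub: "A \<subseteq> G" and Kst: "Kst_free_in G s t A" and s_ge_2: "2 \<le> s"
    and d_nonzero: "d \<in> G" "d \<noteq> 0"
  shows "difference_count A A d * ((card A - 2) choose (s - 2)) \<le> t * (card G choose (s - 2))"
proof -
  define Y where "Y = {y \<in> A. y + d \<in> A}"
  define W where "W = (\<lambda>y. {z \<in> G. z + y \<in> A} - {0, d})"
  define \<Z> where "\<Z> = {Z. Z \<subseteq> G \<and> card Z = s - 2}"
  have finite_Y: "finite Y" using finite_subset_G[OF A_sub] by (simp add: Y_def)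
  have finite_\<Z>: "finite \<Z>"
    unfolding \<Z>_def by (rule finite_subset[of _ "Pow G"]) (auto simp: finite_G)
  have per_translate: "card {Z\<in>\<Z>. Z \<subseteq> W y} = (card A - 2) choose (s - 2)" if "y \<in> Y" for y
  proof -
    have y_in: "y \<in> A" "y + d \<in> A" "y \<in> G" using that A_sub by (auto simp: Y_def)
    have "{0, d} \<subseteq> {z \<in> G. z + y \<in> A}" using y_in d_nonzero by (auto simp: add.commute zero_closed)
    then have "card (W y) = card A - 2"
      using d_nonzero card_translate[OF A_sub y_in(3)] by (simp add: W_def card_Diff_subset)
    moreover have "{Z\<in>\<Z>. Z \<subseteq> W y} = {Z. Z \<subseteq> W y \<and> card Z = s - 2}"
      by (auto simp: \<Z>_def W_def)
    ultimately show ?thesis using finite_G by (simp add: n_subsets W_def)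
  qed
  have per_set: "card {y\<in>Y. Z \<subseteq> W y} \<le> t" if Z_in: "Z \<in> \<Z>" for Z
  proof (cases "{y\<in>Y. Z \<subseteq> W y} = {}")
    case False
    then have "0 \<notin> Z" "d \<notin> Z" by (auto simp: W_def)
    moreover have "finite Z" using Z_in finite_subset_G by (auto simp: \<Z>_def)
    ultimately have "card ({0, d} \<union> Z) = s" using Z_in d_nonzero s_ge_2 by (simp add: \<Z>_def)
    moreover have "{0, d} \<union> Z \<subseteq> G" using Z_in d_nonzero zero_closed by (auto simp: \<Z>_def)
    ultimately have "card {y \<in> G. \<forall>x\<in>{0, d} \<union> Z. x + y \<in> A} < t"
      by (intro Kst_free_in_card_less[OF Kst])
    moreover have "card {y\<in>Y. Z \<subseteq> W y} \<le> card {y \<in> G. \<forall>x\<in>{0, d} \<union> Z. x + y \<in> A}"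
      using A_sub finite_G by (intro card_mono) (auto simp: Y_def W_def add.commute)
    ultimately show ?thesis by linarith
  qed (simp only: card.empty)
  have "card Y * ((card A - 2) choose (s - 2)) = (\<Sum>y\<in>Y. card {Z\<in>\<Z>. Z \<subseteq> W y})"
    by (simp add: per_translate)
  also have "\<dots> = (\<Sum>Z\<in>\<Z>. card {y\<in>Y. Z \<subseteq> W y})"
    by (rule sum_multicount_gen) (auto simp: finite_Y finite_\<Z>)
  also have "\<dots> \<le> (\<Sum>Z\<in>\<Z>. t)" by (intro sum_mono per_set)
  also have "\<dots> = t * (card G choose (s - 2))"
    using n_subsets[OF finite_G, of "s - 2"] by (simp add: \<Z>_def)
  finally show ?thesis
    by (simp add: difference_count_def Y_def flip: of_nat_mult)
qed

lemma Kst_free_in_difference_count_le: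
  assumes A_sub: "A \<subseteq> G" and Kst: "Kst_free_in G s t A" and s_ge_2: "2 \<le> s" and t_ge_1: "1 \<le> t"
    and d_nonzero: "d \<in> G" "d \<noteq> 0"
  shows "difference_count A A d \<le> t * (2 * s * card G / card A) ^ (s - 2)"
proof -
  note binomial_count = Kst_free_in_difference_count_mult_binomial_le[OF A_sub Kst s_ge_2 d_nonzero]
  consider "s = 2" | "3 \<le> s" "card A = 0" | "3 \<le> s" "0 < card A" "card A < 2 * s"
    | "2 * s \<le> card A"
    using s_ge_2 by linarith
  then show ?thesis
  proof cases
    case 1
    then show ?thesis using binomial_count by simp
  next
    case 2
    then show ?thesis
      using difference_count_le_card[OF finite_subset_G[OF A_sub], of A d]
      by (simp add: power_0_left)
  next
    case 3
    let ?X = "2 * s * card G / card A"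
    have X_ge: "card G \<le> ?X" using 3 card_G_pos by (simp add: field_simps)
    then have X_ge_1: "1 \<le> ?X" using card_G_pos by linarith
    have "difference_count A A d \<le> card A"
      by (intro difference_count_le_card finite_subset_G A_sub)
    also have "\<dots> \<le> card G" by (intro of_nat_mono card_mono finite_G A_sub)
    also note X_ge
    also have "?X \<le> ?X ^ (s - 2)" using 3 X_ge_1 by (intro self_le_power) auto
    also have "\<dots> \<le> t * ?X ^ (s - 2)"
      using t_ge_1 mult_right_mono[of 1 "real t" "?X ^ (s - 2)"] by simp
    finally show ?thesis .
  next
    case 4
    have "difference_count A A d * (card A / (2 * s)) ^ (s - 2)
        \<le> difference_count A A d * ((card A - 2) choose (s - 2))"
      using binomial_ge_power[OF s_ge_2 4] by (intro mult_left_mono) auto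
    also note binomial_count
    also have "t * (card G choose (s - 2)) \<le> t * real (card G) ^ (s - 2)"
      by (cases "s - 2 \<le> card G")
        (auto simp: binomial_eq_0
          intro!: mult_left_mono of_nat_mono[OF binomial_le_pow, simplified])
    finally show ?thesis
      using 4 s_ge_2 by (simp add: power_divide power_mult_distrib field_simps)
  qed
qed

lemma Kst_free_in_small_correlations:
  assumes A_sub: "A \<subseteq> G" "A \<noteq> {}" and Kst: "Kst_free_in G s t A" and s_ge_2: "2 \<le> s"
    and t_ge_1: "1 \<le> t"
  shows "small_correlations G A (t * (2 * s * card G / card A) ^ (s - 2))"
proof unfold_locales
  have "0 < card A" using A_sub finite_subset_G by (auto simp: card_gt_0_iff)
  moreover have "card A \<le> card G" by (intro card_mono finite_G A_sub)
  ultimately have "1 * real (card A) \<le> 2 * s * card G" "0 < card A"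
    using s_ge_2 by (auto intro!: mult_mono simp del: mult_1)
  then have "1 \<le> (2 * s * card G / card A) ^ (s - 2)"
    by (intro one_le_power) (simp add: field_simps)
  then show "1 \<le> t * (2 * s * card G / card A) ^ (s - 2)"
    using t_ge_1 mult_mono[of 1 "real t" 1 "(2 * s * card G / card A) ^ (s - 2)"] by simp
  show "difference_count A A d \<le> t * (2 * s * card G / card A) ^ (s - 2)" if "d \<in> G" "d \<noteq> 0" for d
    by (intro Kst_free_in_difference_count_le A_sub Kst s_ge_2 t_ge_1 that)
qed (use A_sub in auto)

lemma card_power_eq_popular_density:
  assumes A_sub: "A \<subseteq> G" and A_nonempty: "A \<noteq> {}" and s_ge_2: "2 \<le> s" and t_ge_1: "1 \<le> t"
  shows "real (card A) ^ s = popular_density G A (t * (2 * s * card G / card A) ^ (s - 2))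
    * (8 * t * (2 * s) ^ (s - 2) * card G ^ (s - 1))"
proof -
  define M N X r where "M = real (card A)" and "N = real (card G)" and "X = 2 * real s"
    and "r = s - 2"
  have "0 < card A" using A_nonempty finite_subset_G[OF A_sub] by (simp add: card_gt_0_iff)
  then have pos: "0 < M" "0 < N" "0 < X" "0 < real t"
    using card_G_pos s_ge_2 t_ge_1 by (auto simp: M_def N_def X_def)
  have s_eq: "s = r + 2" using s_ge_2 by (simp add: r_def)
  have "M ^ s = M ^ r * M\<^sup>2" using s_eq by (simp only: power_add)
  also have "\<dots> = M\<^sup>2 / (8 * (t * (X * N / M) ^ r) * N) * (8 * t * X ^ r * (N ^ r * N))"
    using pos by (simp add: power_divide power_mult_distrib field_simps)
  also have "N ^ r * N = N ^ (s - 1)" using s_eq by simp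
  finally show ?thesis
    by (simp only: popular_density_def M_def N_def X_def r_def
        of_nat_mult of_nat_power of_nat_numeral)
qed

end

section \<open>Fourier analysis\<close>

lemma of_int_invertible:
  assumes "of_int j \<noteq> (0::'a::{field,finite})"
  obtains l where "of_int l * of_int j = (1::'a)"
proof -
  have "prime (int CHAR('a))" by (simp add: prime_CHAR_semidom finite_imp_CHAR_pos)
  moreover have "\<not> int CHAR('a) dvd j" using assms by (simp add: of_int_eq_0_iff_char_dvd)
  ultimately have "coprime j (int CHAR('a))"
    using prime_imp_coprime coprime_commute by blast
  then obtain l where "[j * l = 1] (mod int CHAR('a))" using cong_solve_coprime_int by blast
  then have "of_int (j * l) = (of_int 1 :: 'a)" by (simp only: of_int_eq_iff_cong_CHAR)
  then show ?thesis using that[of l] by (simp add: mult.commute)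
qed

lemma finite_subgroup_of_int_mult:
  assumes "finite_subgroup K" "x \<in> K"
  shows "of_int l * x \<in> (K :: 'a::ring_1 set)"
proof -
  interpret finite_subgroup K by fact
  show ?thesis
  proof (induction l rule: int_induct[of _ 0])
    case (step1 l)
    then show ?case using add_closed[OF step1(2) assms(2)] by (simp add: distrib_right)
  next
    case (step2 l)
    then show ?case using diff_closed[OF step2(2) assms(2)] by (simp add: left_diff_distrib)
  qed (simp add: zero_closed)
qed

lemma finite_subgroup_adjoin:
  assumes "finite_subgroup (K :: 'a::{ring_1,finite} set)"
  shows "finite_subgroup {y + of_int j * x |y j. y \<in> K}"
proof -
  interpret finite_subgroup K by fact
  show ?thesis
  proof
    show "0 \<in> {y + of_int j * x |y j. y \<in> K}"
      using zero_closed by (intro CollectI exI[of _ 0]) simp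
    fix u v assume "u \<in> {y + of_int j * x |y j. y \<in> K}" "v \<in> {y + of_int j * x |y j. y \<in> K}"
    then obtain y j z l where "u = y + of_int j * x" "v = z + of_int l * x" "y \<in> K" "z \<in> K" by blast
    then have "u + v = (y + z) + of_int (j + l) * x" "y + z \<in> K"
      "u - v = (y - z) + of_int (j - l) * x" "y - z \<in> K"
      by (auto simp: algebra_simps add_closed diff_closed)
    then show "u + v \<in> {y + of_int j * x |y j. y \<in> K}" "u - v \<in> {y + of_int j * x |y j. y \<in> K}"
      by blast+
  qed simp
qed

lemma maximal_subgroup_avoiding_1_cosets:
  fixes K :: "'a::{field,finite} set"
  assumes avoids_1: "finite_subgroup K" "1 \<notin> K"
    and maximal: "\<And>K' :: 'a set. finite_subgroup K' \<Longrightarrow> 1 \<notin> K' \<Longrightarrow> card K' \<le> card K"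
  shows "\<exists>i. x - of_int i \<in> K"
proof (cases "x \<in> K")
  case False
  define K' where "K' = {y + of_int j * x | y j. y \<in> K}"
  have "y + of_int j * x \<in> K'" if "y \<in> K" for y j using that by (auto simp: K'_def)
  from this[of _ 0] this[OF finite_subgroup.zero_closed[OF avoids_1(1)], of 1]
  have "K \<subseteq> K'" "x \<in> K'" by auto
  then have "card K < card K'" using False by (intro psubset_card_mono) auto
  moreover have "finite_subgroup K'"
    unfolding K'_def by (rule finite_subgroup_adjoin[OF avoids_1(1)])
  ultimately have "1 \<in> K'" using maximal by fastforce
  then obtain y j where one_eq: "1 = y + of_int j * x" "y \<in> K" by (auto simp: K'_def)
  then have "of_int j \<noteq> (0::'a)" using avoids_1(2) by auto
  then obtain l where inverse: "of_int l * of_int j = (1::'a)" by (rule of_int_invertible)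
  have "of_int l = of_int l * (y + of_int j * x)" using one_eq(1) by simp
  also have "\<dots> = of_int l * y + x" using inverse by (simp add: distrib_left flip: mult.assoc)
  finally have "x = of_int l - of_int l * y" by (simp only: eq_diff_eq add.commute)
  then have "x - of_int l = of_int (- l) * y" by simp
  then show ?thesis using finite_subgroup_of_int_mult[OF avoids_1(1) one_eq(2)] by metis
qed (auto intro: exI[of _ 0])

text \<open>A subgroup maximal among those avoiding \<open>1\<close> is a hyperplane over the prime field,
  complementary to the line spanned by \<open>1\<close>; the functional reads off the coordinate along \<open>1\<close>.\<close>

lemma ex_additive_functional:
  obtains \<phi> :: "'a::{field,finite} \<Rightarrow> int"
  where "\<And>x y. int CHAR('a) dvd \<phi> (x + y) - \<phi> x - \<phi> y" "\<not> int CHAR('a) dvd \<phi> 1"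
proof -
  have "finite_subgroup {0::'a}" by unfold_locales auto
  then obtain K :: "'a set" where avoids_1: "finite_subgroup K" "1 \<notin> K"
    and maximal: "\<And>K' :: 'a set. finite_subgroup K' \<Longrightarrow> 1 \<notin> K' \<Longrightarrow> card K' \<le> card K"
    using ex_has_greatest_nat[of "\<lambda>K. finite_subgroup K \<and> (1::'a) \<notin> K" "{0}" card "Suc CARD('a)"]
    by (auto simp: less_Suc_eq_le card_mono)
  interpret K: finite_subgroup K by (rule avoids_1)
  obtain \<phi> where coset: "\<And>x. x - of_int (\<phi> x) \<in> K"
    using maximal_subgroup_avoiding_1_cosets[OF avoids_1 maximal] by metis
  have dvd_of_int_in_K: "int CHAR('a) dvd i" if "of_int i \<in> K" for i
  proof (rule ccontr)
    assume "\<not> ?thesis"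
    then have "of_int i \<noteq> (0::'a)" by (simp add: of_int_eq_0_iff_char_dvd)
    then obtain l where "of_int l * of_int i = (1::'a)" by (rule of_int_invertible)
    then show False using finite_subgroup_of_int_mult[OF avoids_1(1) that, of l] avoids_1(2) by simp
  qed
  show ?thesis
  proof (rule that[of \<phi>])
    fix x y
    have "(x - of_int (\<phi> x)) + (y - of_int (\<phi> y)) - ((x + y) - of_int (\<phi> (x + y))) \<in> K"
      by (intro K.add_closed K.diff_closed coset)
    then have "of_int (\<phi> (x + y) - \<phi> x - \<phi> y) \<in> K" by (simp add: algebra_simps)
    then show "int CHAR('a) dvd \<phi> (x + y) - \<phi> x - \<phi> y" by (rule dvd_of_int_in_K)
  next
    have "of_int (\<phi> 1) \<noteq> (0::'a)" using coset[of 1] avoids_1(2) by auto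
    then show "\<not> int CHAR('a) dvd \<phi> 1" by (simp add: of_int_eq_0_iff_char_dvd)
  qed
qed

lemma cis_2pi_fraction_eq_1_iff:
  assumes "0 < p"
  shows "cis (2 * pi * of_int i / real p) = 1 \<longleftrightarrow> int p dvd i"
proof -
  have "2 * pi * of_int i / real p = of_int m * (2 * pi) \<longleftrightarrow> i = m * int p" for m
  proof -
    have "2 * pi * of_int i / real p = of_int m * (2 * pi) \<longleftrightarrow> real_of_int i = of_int (m * int p)"
      using assms by (simp add: field_simps)
    then show ?thesis by (simp only: of_int_eq_iff)
  qed
  then show ?thesis by (auto simp: cis_eq_1_iff dvd_def mult.commute)
qed

locale additive_character =
  fixes e :: "'a::{field,finite} \<Rightarrow> complex"
  assumes e_add: "e (x + y) = e x * e y"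
    and norm_e [simp]: "norm (e x) = 1"
    and e_nontrivial: "\<exists>x. e x \<noteq> 1"

lemma ex_additive_character: "\<exists>e :: 'a::{field,finite} \<Rightarrow> complex. additive_character e"
proof -
  define p where "p = CHAR('a)"
  have p_pos: "p > 0" unfolding p_def by (rule finite_imp_CHAR_pos) simp
  obtain \<phi> :: "'a \<Rightarrow> int" where functional: "\<And>x y. int p dvd \<phi> (x + y) - \<phi> x - \<phi> y" "\<not> int p dvd \<phi> 1"
    using ex_additive_functional unfolding p_def by metis
  define e where "e = (\<lambda>x. cis (2 * pi * of_int (\<phi> x) / real p))"
  have "additive_character e"
  proof
    show "norm (e x) = 1" for x by (simp add: e_def)
    show "\<exists>x. e x \<noteq> 1" using functional(2) cis_2pi_fraction_eq_1_iff[OF p_pos] by (auto simp: e_def)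
    show "e (x + y) = e x * e y" for x y
    proof -
      have "e (x + y) / (e x * e y) = cis (2 * pi * of_int (\<phi> (x + y) - \<phi> x - \<phi> y) / real p)"
        by (simp add: e_def cis_mult cis_divide diff_divide_distrib add_divide_distrib
            algebra_simps)
      also have "\<dots> = 1" using functional(1) cis_2pi_fraction_eq_1_iff[OF p_pos] by blast
      finally show ?thesis by simp
    qed
  qed
  then show ?thesis by blast
qed

definition dot :: "nat \<Rightarrow> (nat \<Rightarrow> 'a::field) \<Rightarrow> (nat \<Rightarrow> 'a) \<Rightarrow> 'a" where
  "dot n u x = (\<Sum>i<n. u i * x i)"

lemma dot_simps:
  "dot n u (x + y) = dot n u x + dot n u y" "dot n u (x - y) = dot n u x - dot n u y"
  "dot n (c \<star> u) x = c * dot n u x" "dot n u (c \<star> x) = c * dot n u x" "dot n u 0 = 0"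
  by (simp_all add: dot_def algebra_simps sum.distrib sum_distrib_left sum_subtractf)

lemma dot_commute: "dot n u x = dot n x u"
  by (simp add: dot_def mult.commute)

lemma dot_sum: "dot n u (\<Sum>j\<in>J. x j) = (\<Sum>j\<in>J. dot n u (x j))"
  by (simp add: dot_def sum_fun_apply sum_distrib_left sum.swap[of _ "{..<n}"])

lemma dot_nondegenerate:
  assumes "x \<in> coord_space n" "\<And>u. u \<in> coord_space n \<Longrightarrow> dot n x u = 0"
  shows "x = 0"
proof
  fix i show "x i = 0 i"
  proof (cases "i < n")
    case True
    have "dot n x (\<lambda>j. if j = i then 1 else 0) = 0"
      using True by (intro assms(2)) (auto simp: coord_space_def)
    then show ?thesis using True by (simp add: dot_def if_distrib cong: if_cong)
  qed (use assms(1) in \<open>auto simp: coord_space_def\<close>)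
qed

definition annihilator :: "nat \<Rightarrow> (nat \<Rightarrow> 'a::field) set \<Rightarrow> (nat \<Rightarrow> 'a) set" where
  "annihilator n S = {x \<in> coord_space n. \<forall>u\<in>S. dot n u x = 0}"

lemma subspace_annihilator: "coord.subspace (annihilator n S)"
  by (auto simp: coord.subspace_def annihilator_def dot_simps)

lemma card_annihilator_ge:
  fixes S :: "(nat \<Rightarrow> 'a::{field,finite}) set"
  assumes "finite S"
  shows "CARD('a) ^ n \<le> CARD('a) ^ card S * card (annihilator n S)"
proof -
  let ?G = "coord_space n :: (nat \<Rightarrow> 'a) set"
  define ev where "ev = (\<lambda>x. \<lambda>u\<in>S. dot n u x)"
  define P where "P = S \<rightarrow>\<^sub>E (UNIV :: 'a set)"
  have finite_P: "finite P" unfolding P_def by (intro finite_PiE assms) auto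
  have fibre: "card {x\<in>?G. ev x = w} \<le> card (annihilator n S)" for w
  proof (cases "{x\<in>?G. ev x = w} = {}")
    case False
    then obtain x\<^sub>0 where base_point: "x\<^sub>0 \<in> ?G" "ev x\<^sub>0 = w" by blast
    have "x - x\<^sub>0 \<in> annihilator n S" if "x \<in> ?G" "ev x = w" for x
    proof -
      have "dot n u x = dot n u x\<^sub>0" if "u \<in> S" for u
      proof -
        have "ev x u = ev x\<^sub>0 u" using base_point \<open>ev x = w\<close> by simp
        then show ?thesis using that by (simp add: ev_def)
      qed
      then show ?thesis using that base_point by (auto simp: annihilator_def dot_simps)
    qed
    then show ?thesis
      by (intro card_inj_on_le[where f = "\<lambda>x. x - x\<^sub>0"]) (auto simp: inj_on_def annihilator_def)
  qed (simp only: card.empty)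
  have "card ?G \<le> card (\<Union>w\<in>P. {x\<in>?G. ev x = w})"
    by (intro card_mono) (auto simp: finite_P, auto simp: P_def ev_def)
  also have "\<dots> \<le> (\<Sum>w\<in>P. card {x\<in>?G. ev x = w})" by (rule card_UN_le[OF finite_P])
  also have "\<dots> \<le> (\<Sum>w\<in>P. card (annihilator n S))" by (intro sum_mono fibre)
  finally show ?thesis by (simp add: card_coord_space P_def card_PiE assms)
qed

interpretation coord_space: finite_subgroup "coord_space n :: (nat \<Rightarrow> 'a::{field,finite}) set" for n
  by unfold_locales auto

lemma four_term_mean_inequality:
  fixes w x y z :: real
  shows "w * x * y * z \<le> (w ^ 4 + x ^ 4 + y ^ 4 + z ^ 4) / 4"
proof -
  have "w * x * y * z \<le> ((w * x)\<^sup>2 + (y * z)\<^sup>2) / 2"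
    using sum_squares_bound[of "w * x" "y * z"] by (simp add: mult_ac)
  moreover have "(w * x)\<^sup>2 \<le> (w ^ 4 + x ^ 4) / 2" "(y * z)\<^sup>2 \<le> (y ^ 4 + z ^ 4) / 2"
    using sum_squares_bound[of "w\<^sup>2" "x\<^sup>2"] sum_squares_bound[of "y\<^sup>2" "z\<^sup>2"]
    by (auto simp: power_mult_distrib simp flip: power_mult)
  ultimately show ?thesis by simp
qed

lemma sum_prod_indicator_solutions:
  fixes A :: "(nat \<Rightarrow> 'a::{field,finite}) set"
  assumes A_sub: "A \<subseteq> coord_space n" and finite_J: "finite J"
  shows "(\<Sum>x\<in>solutions J a (coord_space n). \<Prod>j\<in>J. indicat_real A (x j)) = card (solutions J a A)"
proof -
  have "(\<Sum>x\<in>solutions J a (coord_space n). \<Prod>j\<in>J. indicat_real A (x j)) = (\<Sum>x\<in>solutions J a A. 1)"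
  proof (rule sum.mono_neutral_cong_right)
    show "\<forall>x\<in>solutions J a (coord_space n) - solutions J a A. (\<Prod>j\<in>J. indicat_real A (x j)) = 0"
      using finite_J by (auto simp: solutions_def PiE_def Pi_def indicator_eq_0_iff)
    show "(\<Prod>j\<in>J. indicat_real A (x j)) = 1" if "x \<in> solutions J a A" for x
      using that by (intro prod.neutral) (auto simp: solutions_def indicator_eq_1_iff)
  qed (simp_all add: finite_J solutions_mono[OF A_sub])
  then show ?thesis by simp
qed

context additive_character
begin

lemma e_nonzero [simp]: "e x \<noteq> 0"
  using norm_e[of x] by (metis norm_zero zero_neq_one)

lemma e_0 [simp]: "e 0 = 1"
  using e_add[of 0 0] by simp

lemma e_diff: "e (x - y) = e x * cnj (e y)"
proof -
  have "e y * cnj (e y) = 1" by (simp flip: complex_norm_square)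
  moreover have "e (x - y) * e y = e x" by (simp flip: e_add)
  ultimately show ?thesis by (metis mult.assoc mult.right_neutral)
qed

lemma e_sum: "e (\<Sum>j\<in>J. x j) = (\<Prod>j\<in>J. e (x j))"
  by (induction J rule: infinite_finite_induct) (auto simp: e_add)

lemma sum_character_subspace:
  assumes subspace: "coord.subspace H"
  shows "(\<Sum>x\<in>H. e (dot n u x)) = (if \<forall>x\<in>H. dot n u x = 0 then of_nat (card H) else 0)"
proof (cases "\<forall>x\<in>H. dot n u x = 0")
  case False
  then obtain h where not_annihilated: "h \<in> H" "dot n u h \<noteq> 0" by blast
  obtain c where nontrivial: "e c \<noteq> 1" using e_nontrivial by blast
  define k where "k = (c / dot n u h) \<star> h"
  have shift: "k \<in> H" "dot n u k = c"
    using not_annihilated by (auto simp: k_def dot_simps coord.subspace_scale[OF subspace])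
  have "(\<Sum>x\<in>H. e (dot n u x)) = (\<Sum>x\<in>H. e (dot n u (x + k)))"
    by (rule sum.reindex_bij_witness[of _ "\<lambda>x. x + k" "\<lambda>x. x - k"])
      (auto simp: coord.subspace_add[OF subspace] coord.subspace_diff[OF subspace] shift(1))
  also have "\<dots> = (\<Sum>x\<in>H. e (dot n u x)) * e c"
    by (simp add: dot_simps e_add shift sum_distrib_right)
  finally have "(\<Sum>x\<in>H. e (dot n u x)) = 0" using nontrivial by simp
  then show ?thesis by (simp add: False)
qed simp

lemma sum_character_dual:
  assumes "x \<in> coord_space n"
  shows "(\<Sum>u\<in>coord_space n. e (dot n u x)) = (if x = 0 then of_nat (CARD('a) ^ n) else 0)"
proof -
  have "(\<forall>u\<in>coord_space n. dot n x u = 0) \<longleftrightarrow> x = 0"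
    using dot_nondegenerate[OF assms] by (auto simp: dot_def)
  then show ?thesis
    using sum_character_subspace[OF subspace_coord_space[of n], where n = n and u = x]
    by (simp add: dot_commute[of n _ x] card_coord_space)
qed

definition fourier :: "nat \<Rightarrow> ((nat \<Rightarrow> 'a) \<Rightarrow> real) \<Rightarrow> (nat \<Rightarrow> 'a) \<Rightarrow> complex" where
  "fourier n g u = (\<Sum>x\<in>coord_space n. of_real (g x) * e (dot n u x))"

lemma parseval:
  fixes g :: "(nat \<Rightarrow> 'a) \<Rightarrow> real"
  shows "(\<Sum>u\<in>coord_space n. (norm (fourier n g u))\<^sup>2) = CARD('a) ^ n * (\<Sum>x\<in>coord_space n. (g x)\<^sup>2)"
proof -
  let ?G = "coord_space n :: (nat \<Rightarrow> 'a) set"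
  have "complex_of_real ((norm (fourier n g u))\<^sup>2)
      = (\<Sum>x\<in>?G. \<Sum>y\<in>?G. of_real (g x * g y) * e (dot n u (x - y)))" for u
  proof -
    have "complex_of_real ((norm (fourier n g u))\<^sup>2) = fourier n g u * cnj (fourier n g u)"
      by (simp add: complex_norm_square flip: of_real_power)
    also have "\<dots> = (\<Sum>x\<in>?G. \<Sum>y\<in>?G. of_real (g x * g y) * e (dot n u (x - y)))"
      by (simp add: fourier_def sum_product dot_simps e_diff mult_ac)
    finally show ?thesis .
  qed
  then have "complex_of_real (\<Sum>u\<in>?G. (norm (fourier n g u))\<^sup>2)
      = (\<Sum>u\<in>?G. \<Sum>x\<in>?G. \<Sum>y\<in>?G. of_real (g x * g y) * e (dot n u (x - y)))"
    unfolding of_real_sum by (intro sum.cong refl) auto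
  also have "\<dots> = (\<Sum>x\<in>?G. \<Sum>u\<in>?G. \<Sum>y\<in>?G. of_real (g x * g y) * e (dot n u (x - y)))"
    by (rule sum.swap)
  also have "\<dots> = (\<Sum>x\<in>?G. \<Sum>y\<in>?G. \<Sum>u\<in>?G. of_real (g x * g y) * e (dot n u (x - y)))"
    by (intro sum.cong refl sum.swap)
  also have "\<dots> = (\<Sum>x\<in>?G. \<Sum>y\<in>?G. if y = x then of_real (g x * g x * CARD('a) ^ n) else 0)"
    by (intro sum.cong refl) (auto simp: sum_character_dual simp flip: sum_distrib_left)
  also have "\<dots> = of_real (CARD('a) ^ n * (\<Sum>x\<in>?G. (g x)\<^sup>2))"
    by (simp add: sum_distrib_left power2_eq_square mult_ac)
  finally show ?thesis by (simp only: of_real_eq_iff)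
qed

lemma sum_prod_fourier:
  fixes g :: "(nat \<Rightarrow> 'a) \<Rightarrow> real"
  assumes finite_J: "finite J"
  shows "(\<Sum>u\<in>coord_space n. \<Prod>j\<in>J. fourier n g (a j \<star> u))
    = of_real (CARD('a) ^ n * (\<Sum>x\<in>solutions J a (coord_space n). \<Prod>j\<in>J. g (x j)))"
proof -
  let ?G = "coord_space n :: (nat \<Rightarrow> 'a) set"
  let ?P = "J \<rightarrow>\<^sub>E ?G"
  have "(\<Prod>j\<in>J. fourier n g (a j \<star> u))
    = (\<Sum>x\<in>?P. of_real (\<Prod>j\<in>J. g (x j)) * e (dot n u (\<Sum>j\<in>J. a j \<star> x j)))" for u
  proof -
    have "(\<Prod>j\<in>J. fourier n g (a j \<star> u))
      = (\<Sum>x\<in>?P. \<Prod>j\<in>J. of_real (g (x j)) * e (dot n (a j \<star> u) (x j)))"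
      unfolding fourier_def by (rule prod_sum_PiE) (auto simp: finite_J)
    also have "\<dots> = (\<Sum>x\<in>?P. of_real (\<Prod>j\<in>J. g (x j)) * e (dot n u (\<Sum>j\<in>J. a j \<star> x j)))"
      by (simp add: prod.distrib dot_sum e_sum dot_simps)
    finally show ?thesis .
  qed
  then have "(\<Sum>u\<in>?G. \<Prod>j\<in>J. fourier n g (a j \<star> u))
      = (\<Sum>x\<in>?P. of_real (\<Prod>j\<in>J. g (x j)) * (\<Sum>u\<in>?G. e (dot n u (\<Sum>j\<in>J. a j \<star> x j))))"
    by (simp add: sum.swap[of _ ?G] sum_distrib_left)
  also have "\<dots> = (\<Sum>x\<in>?P. of_real (\<Prod>j\<in>J. g (x j))
    * (if (\<Sum>j\<in>J. a j \<star> x j) = 0 then of_nat (CARD('a) ^ n) else 0))"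
    by (intro sum.cong refl arg_cong2[where f = "(*)"] sum_character_dual coord_space_closed) auto
  also have "\<dots> = (\<Sum>x\<in>solutions J a ?G. of_real (\<Prod>j\<in>J. g (x j)) * of_nat (CARD('a) ^ n))"
    unfolding solutions_def by (rule sum.mono_neutral_cong_right) (auto intro!: finite_PiE finite_J)
  also have "\<dots> = of_real (CARD('a) ^ n * (\<Sum>x\<in>solutions J a ?G. \<Prod>j\<in>J. g (x j)))"
    by (simp add: sum_distrib_left mult.commute)
  finally show ?thesis .
qed

abbreviation fourier_set :: "nat \<Rightarrow> (nat \<Rightarrow> 'a) set \<Rightarrow> (nat \<Rightarrow> 'a) \<Rightarrow> complex" where
  "fourier_set n A \<equiv> fourier n (indicat_real A)"

lemma fourier_set_eq: "A \<subseteq> coord_space n \<Longrightarrow> fourier_set n A u = (\<Sum>x\<in>A. e (dot n u x))"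
  unfolding fourier_def by (rule sum.mono_neutral_cong_right) (auto simp: indicator_def)

lemma fourier_difference_count:
  assumes A_sub: "A \<subseteq> coord_space n" and B_sub: "B \<subseteq> coord_space n"
  shows "fourier n (difference_count A B) u = cnj (fourier_set n B u) * fourier_set n A u"
proof -
  have "fourier n (difference_count A B) u = (\<Sum>b\<in>B. \<Sum>a\<in>A. e (dot n u (a - b)))"
    unfolding fourier_def by (rule coord_space.sum_difference_count_mult[OF A_sub B_sub])
  also have "\<dots> = cnj (fourier_set n B u) * fourier_set n A u"
    by (simp add: fourier_set_eq A_sub B_sub dot_simps e_diff sum_product mult.commute)
      (rule sum.swap)
  finally show ?thesis .
qed

lemma sum_fourier_set_fourth_power:
  assumes A_sub: "A \<subseteq> coord_space n"
  shows "(\<Sum>u\<in>coord_space n. norm (fourier_set n A u) ^ 4)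
    = CARD('a) ^ n * additive_energy (coord_space n) A"
proof -
  have "(norm (fourier n (difference_count A A) u))\<^sup>2 = norm (fourier_set n A u) ^ 4" for u
    by (simp add: fourier_difference_count[OF A_sub A_sub] norm_mult power_mult_distrib
        flip: power_add)
  then show ?thesis using parseval[of n "difference_count A A"] by (simp add: additive_energy_def)
qed

lemma sum_fourier_set_fourth_power_dilate:
  assumes "A \<subseteq> coord_space n" "c \<noteq> 0"
  shows "(\<Sum>u\<in>coord_space n. norm (fourier_set n A (c \<star> u)) ^ 4)
    = CARD('a) ^ n * additive_energy (coord_space n) A"
proof -
  have "(\<Sum>u\<in>coord_space n. norm (fourier_set n A (c \<star> u)) ^ 4)
    = (\<Sum>u\<in>coord_space n. norm (fourier_set n A u) ^ 4)"
    by (rule sum.reindex_bij_witness[of _ "\<lambda>u. inverse c \<star> u" "\<lambda>u. c \<star> u"]) (auto simp: assms)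
  then show ?thesis by (simp only: sum_fourier_set_fourth_power[OF assms(1)])
qed

lemma fourier_translate_density:
  assumes A_sub: "A \<subseteq> coord_space n" and subspace: "coord.subspace H" "H \<subseteq> coord_space n"
  shows "fourier n (translate_density A H) u
    = (if \<forall>h\<in>H. dot n u h = 0 then fourier_set n A u else 0)"
proof -
  have "card H \<noteq> 0"
    using coord.subspace_0[OF subspace(1)] finite_subset[OF subspace(2)] by auto
  moreover have "fourier n (translate_density A H) u = fourier n (difference_count A H) u / card H"
    by (simp add: fourier_def translate_density_def sum_divide_distrib)
  ultimately show ?thesis
    by (simp add: fourier_difference_count[OF A_sub subspace(2)] fourier_set_eq[OF subspace(2)]
        sum_character_subspace[OF subspace(1)])
qed

definition large_spectrum :: "nat \<Rightarrow> (nat \<Rightarrow> 'a) set \<Rightarrow> real \<Rightarrow> (nat \<Rightarrow> 'a) set" where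
  "large_spectrum n A \<tau> = {u \<in> coord_space n. \<tau> < norm (fourier_set n A u)}"

lemma card_large_spectrum_le:
  fixes \<tau> :: real
  assumes A_sub: "A \<subseteq> coord_space n" and \<tau>_nonneg: "0 \<le> \<tau>"
  shows "card (large_spectrum n A \<tau>) * \<tau> ^ 4
    \<le> CARD('a) ^ n * additive_energy (coord_space n) A"
proof -
  have "card (large_spectrum n A \<tau>) * \<tau> ^ 4 = (\<Sum>u\<in>large_spectrum n A \<tau>. \<tau> ^ 4)" by simp
  also have "\<dots> \<le> (\<Sum>u\<in>large_spectrum n A \<tau>. norm (fourier_set n A u) ^ 4)"
    using \<tau>_nonneg by (intro sum_mono power_mono) (auto simp: large_spectrum_def)
  also have "\<dots> \<le> (\<Sum>u\<in>coord_space n. norm (fourier_set n A u) ^ 4)"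
    by (intro sum_mono2) (auto simp: large_spectrum_def)
  finally show ?thesis by (simp add: sum_fourier_set_fourth_power[OF A_sub])
qed

lemma solution_count_difference:
  assumes A_sub: "A \<subseteq> coord_space n" and subspace: "coord.subspace H" "H \<subseteq> coord_space n"
    and nonzero: "\<And>j. j \<in> J \<Longrightarrow> a j \<noteq> 0"
    and index_set: "finite J" "J \<noteq> {}"
  shows "complex_of_real (CARD('a) ^ n * (card (solutions J a A)
      - (\<Sum>x\<in>solutions J a (coord_space n). \<Prod>j\<in>J. translate_density A H (x j))))
    = (\<Sum>u\<in>{u\<in>coord_space n. \<exists>h\<in>H. dot n u h \<noteq> 0}. \<Prod>j\<in>J. fourier_set n A (a j \<star> u))"
proof -
  let ?G = "coord_space n :: (nat \<Rightarrow> 'a) set" and ?F = "\<lambda>u. \<Prod>j\<in>J. fourier_set n A (a j \<star> u)"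
  have "(\<Prod>j\<in>J. fourier n (translate_density A H) (a j \<star> u))
    = (if \<forall>h\<in>H. dot n u h = 0 then ?F u else 0)" for u
  proof -
    have "(\<Prod>j\<in>J. fourier n (translate_density A H) (a j \<star> u))
        = (\<Prod>j\<in>J. if \<forall>h\<in>H. dot n u h = 0 then fourier_set n A (a j \<star> u) else 0)"
      using nonzero
      by (intro prod.cong refl) (simp add: fourier_translate_density[OF A_sub subspace] dot_simps)
    then show ?thesis using index_set by (auto simp: power_0_left)
  qed
  then have "complex_of_real (CARD('a) ^ n
    * (\<Sum>x\<in>solutions J a ?G. \<Prod>j\<in>J. translate_density A H (x j)))
      = (\<Sum>u\<in>?G. if \<forall>h\<in>H. dot n u h = 0 then ?F u else 0)"
    unfolding sum_prod_fourier[OF index_set(1), symmetric] by simp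
  moreover have "complex_of_real (CARD('a) ^ n * card (solutions J a A)) = (\<Sum>u\<in>?G. ?F u)"
    using sum_prod_fourier[OF index_set(1), of n "indicat_real A" a]
    unfolding sum_prod_indicator_solutions[OF A_sub index_set(1)] by simp
  ultimately have "complex_of_real (CARD('a) ^ n * (card (solutions J a A)
      - (\<Sum>x\<in>solutions J a ?G. \<Prod>j\<in>J. translate_density A H (x j))))
    = (\<Sum>u\<in>?G. ?F u - (if \<forall>h\<in>H. dot n u h = 0 then ?F u else 0))"
    by (simp add: right_diff_distrib sum_subtractf)
  also have "\<dots> = (\<Sum>u\<in>{u\<in>?G. \<exists>h\<in>H. dot n u h \<noteq> 0}. ?F u)"
    by (rule sum.mono_neutral_cong_right) auto
  finally show ?thesis .
qed

text \<open>Outside the annihilator of \<open>H\<close> one Fourier factor is at most \<open>\<tau>\<close>; the other four are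
  controlled by the additive energy.\<close>

lemma transference_error:
  fixes a :: "nat \<Rightarrow> 'a" and \<tau> :: real
  assumes A_sub: "A \<subseteq> coord_space n" and nonzero: "\<And>j. j < 5 \<Longrightarrow> a j \<noteq> 0" and \<tau>_nonneg: "0 \<le> \<tau>"
  defines "H \<equiv> annihilator n (large_spectrum n A \<tau>)"
  shows "\<bar>card (solutions {..<5} a A)
      - (\<Sum>x\<in>solutions {..<5} a (coord_space n). \<Prod>j<5. translate_density A H (x j))\<bar>
    \<le> \<tau> * additive_energy (coord_space n) A" (is "\<bar>?error\<bar> \<le> \<tau> * ?E")
proof -
  let ?G = "coord_space n :: (nat \<Rightarrow> 'a) set" and ?F = "\<lambda>j u. norm (fourier_set n A (a j \<star> u))"
  define outside where "outside = {u\<in>?G. \<exists>h\<in>H. dot n u h \<noteq> 0}"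
  define N where "N = real (CARD('a) ^ n)"
  have subspace: "coord.subspace H" "H \<subseteq> ?G"
    using subspace_annihilator by (auto simp: H_def annihilator_def)
  have product_le: "norm (\<Prod>j<5. fourier_set n A (a j \<star> u)) \<le> (\<Sum>j<4. ?F j u ^ 4) / 4 * \<tau>"
    if u_outside: "u \<in> outside" for u
  proof -
    have "a 4 \<star> u \<notin> large_spectrum n A \<tau>"
      using u_outside nonzero[of 4] by (auto simp: outside_def H_def annihilator_def dot_simps)
    then have "?F 4 u \<le> \<tau>" using u_outside by (auto simp: large_spectrum_def outside_def)
    then have "?F 0 u * ?F 1 u * ?F 2 u * ?F 3 u * ?F 4 u
        \<le> (?F 0 u ^ 4 + ?F 1 u ^ 4 + ?F 2 u ^ 4 + ?F 3 u ^ 4) / 4 * \<tau>"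
      by (intro mult_mono four_term_mean_inequality) auto
    moreover have "{..<4::nat} = {0, 1, 2, 3}" by auto
    ultimately show ?thesis by (simp add: lessThan_5 norm_mult mult.assoc add.assoc)
  qed
  have "N * \<bar>?error\<bar> = norm (complex_of_real (N * ?error))"
    by (simp add: N_def abs_mult del: of_real_mult)
  also have "\<dots> = norm (\<Sum>u\<in>outside. \<Prod>j<5. fourier_set n A (a j \<star> u))"
    unfolding N_def outside_def
    by (subst solution_count_difference[OF A_sub subspace]) (auto simp: nonzero lessThan_empty_iff)
  also have "\<dots> \<le> (\<Sum>u\<in>outside. (\<Sum>j<4. ?F j u ^ 4) / 4 * \<tau>)"
    by (intro sum_norm_le product_le)
  also have "\<dots> \<le> (\<Sum>u\<in>?G. (\<Sum>j<4. ?F j u ^ 4) / 4 * \<tau>)"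
    using \<tau>_nonneg
    by (intro sum_mono2) (auto simp: outside_def intro!: mult_nonneg_nonneg sum_nonneg)
  also have "\<dots> = (\<Sum>j<4. \<Sum>u\<in>?G. ?F j u ^ 4) / 4 * \<tau>"
    by (subst sum.swap) (simp add: sum_distrib_right sum_divide_distrib)
  also have "(\<Sum>j<4. \<Sum>u\<in>?G. ?F j u ^ 4) = (\<Sum>j<4::nat. N * ?E)"
    unfolding N_def by (intro sum.cong refl sum_fourier_set_fourth_power_dilate A_sub nonzero) auto
  finally have "N * \<bar>?error\<bar> \<le> N * (\<tau> * ?E)" by (simp add: mult_ac)
  then show ?thesis by (simp add: N_def)
qed

end

lemma ex_smoothing_subset:
  fixes A :: "(nat \<Rightarrow> 'a::{field,finite}) set" and \<tau> :: real
  assumes A_sub: "A \<subseteq> coord_space n" and \<tau>_nonneg: "0 \<le> \<tau>"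
  obtains H k where "H \<subseteq> coord_space n" "CARD('a) ^ n \<le> CARD('a) ^ k * card H"
    and "k * \<tau> ^ 4 \<le> CARD('a) ^ n * additive_energy (coord_space n) A"
    and "\<And>a :: nat \<Rightarrow> 'a. (\<And>j. j < 5 \<Longrightarrow> a j \<noteq> 0) \<Longrightarrow> \<bar>card (solutions {..<5} a A)
      - (\<Sum>x\<in>solutions {..<5} a (coord_space n). \<Prod>j<5. translate_density A H (x j))\<bar>
    \<le> \<tau> * additive_energy (coord_space n) A"
proof -
  obtain e :: "'a \<Rightarrow> complex" where "additive_character e" using ex_additive_character by blast
  then interpret additive_character e .
  let ?S = "large_spectrum n A \<tau>"
  have "finite ?S" by (simp add: large_spectrum_def)
  show ?thesis
  proof (rule that)
    show "annihilator n ?S \<subseteq> coord_space n" by (auto simp: annihilator_def)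
    show "CARD('a) ^ n \<le> CARD('a) ^ card ?S * card (annihilator n ?S)"
      by (rule card_annihilator_ge[OF \<open>finite ?S\<close>])
    show "card ?S * \<tau> ^ 4 \<le> CARD('a) ^ n * additive_energy (coord_space n) A"
      by (rule card_large_spectrum_le[OF A_sub \<tau>_nonneg])
  qed (rule transference_error[OF A_sub _ \<tau>_nonneg])
qed

section \<open>The bound for five variables\<close>

definition only_trivial_solutions :: "'i set \<Rightarrow> ('i \<Rightarrow> 'a::field) \<Rightarrow> (nat \<Rightarrow> 'a) set \<Rightarrow> bool" where
  "only_trivial_solutions J a A \<longleftrightarrow> (\<forall>x\<in>solutions J a A. \<forall>i\<in>J. \<forall>j\<in>J. x i = x j)"

lemma card_only_trivial_solutions_le:
  assumes triv: "only_trivial_solutions J a A" and finite_A: "finite A" and i_in: "i \<in> J"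
  shows "card (solutions J a A) \<le> card A"
proof (rule card_inj_on_le[where f = "\<lambda>x. x i"])
  show "inj_on (\<lambda>x. x i) (solutions J a A)"
  proof (rule inj_onI)
    fix x y assume agree: "x \<in> solutions J a A" "y \<in> solutions J a A" "x i = y i"
    then have "x j = y j" if "j \<in> J" for j
      using triv i_in that unfolding only_trivial_solutions_def by metis
    then show "x = y" using agree by (intro PiE_ext[of x J "\<lambda>_. A"]) (auto simp: solutions_def)
  qed
qed (use i_in finite_A in \<open>auto simp: solutions_def\<close>)

lemma exponential_beats_linear:
  fixes q T \<delta> :: real and n :: nat
  assumes q_gt_1: "1 < q" and T_ge_1: "1 \<le> T" and \<delta>_bounds: "0 < \<delta>" "\<delta> \<le> 1"
    and large: "8 * T / ln q < \<delta> ^ Q * n"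
  shows "T < q powr (n / 8)" and "i \<le> Q \<Longrightarrow> 1 < q powr (n / 8) * \<delta> ^ i"
proof -
  define Y where "Y = q powr (n / 8)"
  have ln_q: "0 < ln q" using q_gt_1 by simp
  have Y_ge: "n * ln q / 8 + 1 \<le> Y"
    using exp_ge_add_one_self[of "n / 8 * ln q"] q_gt_1 by (simp add: Y_def powr_def add.commute)
  have "\<delta> ^ Q * n \<le> 1 * real n" using \<delta>_bounds by (intro mult_right_mono power_le_one) auto
  then have "8 * T / ln q < n" using large by linarith
  then have "T < n * ln q / 8" using ln_q by (simp add: field_simps)
  then show T_less: "T < q powr (n / 8)" using Y_ge by (simp add: Y_def)
  have "8 / ln q \<le> 8 * T / ln q" using T_ge_1 ln_q by (simp add: divide_right_mono)
  then have "8 < \<delta> ^ Q * (n * ln q)" using large ln_q by (simp add: field_simps)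
  also have "\<dots> \<le> \<delta> ^ Q * (8 * Y)" using Y_ge \<delta>_bounds by (intro mult_left_mono) auto
  finally have "1 < Y * \<delta> ^ Q" by (simp add: mult.commute)
  also have "Y * \<delta> ^ Q \<le> Y * \<delta> ^ i" if "i \<le> Q"
    using \<delta>_bounds that by (intro mult_left_mono power_decreasing) (auto simp: Y_def)
  finally show "1 < q powr (n / 8) * \<delta> ^ i" if "i \<le> Q" using that by (simp add: Y_def)
qed

lemma power_nat_ceiling_le:
  fixes q x :: real and n :: nat
  assumes q_gt_1: "1 < q" and x_bounds: "0 \<le> x" "x \<le> n / 4"
  shows "q ^ nat \<lceil>x\<rceil> \<le> q * (q powr (n / 8))\<^sup>2"
proof -
  have "real (nat \<lceil>x\<rceil>) \<le> 1 + n / 4" using x_bounds by linarith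
  then have "q powr real (nat \<lceil>x\<rceil>) \<le> q powr (1 + n / 4)" using q_gt_1 by (intro powr_mono) auto
  also have "\<dots> = q * (q powr (n / 8))\<^sup>2" using q_gt_1 by (simp add: powr_add powr_power)
  finally show ?thesis using q_gt_1 by (simp add: powr_realpow)
qed

lemma quintic_exceeds_octic:
  fixes c d M Y :: real
  assumes "0 < c" "1 \<le> Y" "64 < c * Y" "1 < Y * d" "Y ^ 3 \<le> M"
  shows "64 * Y ^ 8 < c * d * M ^ 4"
proof -
  have "Y * (64 * Y ^ 8) = 64 * Y ^ 9" by (simp flip: power_Suc)
  also have "\<dots> < (c * Y) * Y ^ 9" using assms by (intro mult_strict_right_mono) auto
  also have "\<dots> \<le> c * (Y ^ 3) ^ 4"
    using assms by (simp add: power_increasing flip: power_Suc power_mult)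
  also have "\<dots> \<le> c * M ^ 4" using assms by (intro mult_left_mono power_mono) auto
  also have "\<dots> \<le> (c * M ^ 4) * (Y * d)" using assms mult_left_mono[of 1 "Y * d" "c * M ^ 4"] by simp
  finally have "Y * (64 * Y ^ 8) < Y * (c * d * M ^ 4)" by (simp add: mult_ac)
  then show ?thesis using assms(2) by simp
qed

lemma cube_le_of_power_ge:
  fixes d M Y :: real
  assumes "1 \<le> Y" "0 \<le> M" "2 \<le> s" "1 < Y * d" "d * (Y ^ 8) ^ (s - 1) \<le> M ^ s"
  shows "Y ^ 3 \<le> M"
proof (rule ccontr)
  assume less: "\<not> Y ^ 3 \<le> M"
  have "Y * d * (Y ^ 8) ^ (s - 1) \<le> Y * M ^ s" using assms by (simp add: mult.assoc)
  also have "\<dots> \<le> Y * (Y ^ 3) ^ s"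
    using less assms by (intro mult_left_mono power_mono) auto
  also have "\<dots> = Y ^ (3 * s + 1)" by (simp flip: power_mult)
  also have "\<dots> \<le> Y ^ (8 * (s - 1))" using assms by (intro power_increasing) auto
  also have "\<dots> = 1 * (Y ^ 8) ^ (s - 1)" by (simp add: power_mult)
  also have "\<dots> < Y * d * (Y ^ 8) ^ (s - 1)" using assms by (intro mult_strict_right_mono) auto
  finally show False by simp
qed

lemma card_le_of_codimension_le:
  fixes R :: real and q h k L m N :: nat
  assumes "k \<le> L" "q ^ L * m \<le> N * R" "N \<le> q ^ k * h" "2 \<le> q" "0 \<le> R"
  shows "m \<le> h * R"
proof -
  have "real N \<le> real (q ^ k * h)" using assms(3) by (rule of_nat_mono)
  also have "\<dots> \<le> real (q ^ L * h)"
    using assms(1,4) by (intro of_nat_mono mult_right_mono power_increasing) auto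
  finally have "N * R \<le> real (q ^ L * h) * R" using assms(5) by (intro mult_right_mono) auto
  then have "q ^ L * m \<le> q ^ L * (h * R)" using assms(2) by simp
  then show ?thesis using assms(4) by (simp add: mult_le_cancel_left_pos)
qed

context five_term_supersaturation
begin

lemma smoothed_solution_count_ge:
  fixes A H :: "(nat \<Rightarrow> 'a) set" and R :: real
  assumes corr: "small_correlations (coord_space n) A R" and pairable: "pairable a"
    and H_large: "H \<subseteq> coord_space n" "card A \<le> card H * R"
  defines "\<delta> \<equiv> popular_density (coord_space n) A R"
  shows "2 * (c * \<delta> ^ K * card A ^ 5 / (64 * CARD('a) ^ n))
    \<le> (\<Sum>x\<in>solutions {..<5} a (coord_space n). \<Prod>j<5. translate_density A H (x j))"
proof -
  interpret small_correlations "coord_space n" A R by (rule corr)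
  define N m where "N = real (CARD('a) ^ n)" and "m = card A / (2 * N)"
  define D where "D = {x \<in> coord_space n. m \<le> translate_density A H x}"
  have pos: "N > 0" "m \<ge> 0" by (auto simp: N_def m_def)
  have D_sub: "D \<subseteq> coord_space n" by (auto simp: D_def)
  have "\<delta> * CARD('a) ^ n \<le> card D"
    using card_popular_translates_ge[OF H_large]
    by (simp add: \<delta>_def D_def m_def N_def card_coord_space)
  then have "c * \<delta> ^ K * N ^ 4 \<le> card (solutions {..<5} a D)"
    using card_solutions_ge[OF pairable D_sub] popular_density_pos by (simp add: \<delta>_def N_def)
  then have "m ^ 5 * (c * \<delta> ^ K * N ^ 4) \<le> m ^ 5 * card (solutions {..<5} a D)"
    using pos by (intro mult_left_mono) auto
  also have "\<dots> = (\<Sum>x\<in>solutions {..<5} a D. \<Prod>j<5::nat. m)" by simp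
  also have "\<dots> \<le> (\<Sum>x\<in>solutions {..<5} a D. \<Prod>j<5. translate_density A H (x j))"
    using pos by (intro sum_mono prod_mono) (auto simp: solutions_def D_def PiE_def Pi_def)
  also have "\<dots> \<le> (\<Sum>x\<in>solutions {..<5} a (coord_space n). \<Prod>j<5. translate_density A H (x j))"
    by (intro sum_mono2 solutions_mono[OF D_sub]) (auto intro!: prod_nonneg)
  also have "m ^ 5 * (c * \<delta> ^ K * N ^ 4) = 2 * (c * \<delta> ^ K * card A ^ 5 / (64 * N))"
    using pos by (simp add: m_def power_divide power_mult_distrib field_simps eval_nat_numeral)
  finally show ?thesis by (simp add: N_def)
qed

definition saving_exponent :: nat where
  "saving_exponent = 4 * K + 5"

definition codimension_constant :: real where
  "codimension_constant = 16 ^ 4 / (4 * c ^ 4)"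

lemma codimension_constant_pos: "0 < codimension_constant"
  using c_pos by (simp add: codimension_constant_def)

text \<open>The threshold for the large spectrum of \<open>A\<close> is \<open>\<epsilon> |A|\<close>, where \<open>\<epsilon>\<close> is chosen such that the
  transference error is half of the main term.\<close>

lemma card_solutions_ge_of_small_correlations:
  fixes A :: "(nat \<Rightarrow> 'a) set" and R :: real
  assumes corr: "small_correlations (coord_space n) A R" and pairable: "pairable a"
  defines "\<delta> \<equiv> popular_density (coord_space n) A R"
  assumes L_large: "codimension_constant / \<delta> ^ saving_exponent \<le> real L"
    "CARD('a) ^ L * card A \<le> CARD('a) ^ n * R"
  shows "c * \<delta> ^ K * card A ^ 5 / (64 * CARD('a) ^ n) \<le> card (solutions {..<5} a A)"
proof -
  interpret small_correlations "coord_space n" A R by (rule corr)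
  have \<delta>_pos: "0 < \<delta>" using popular_density_pos by (simp add: \<delta>_def)
  define \<epsilon> where "\<epsilon> = c * \<delta> ^ (K + 1) / 16"
  have \<epsilon>_pos: "0 < \<epsilon>" using c_pos \<delta>_pos by (simp add: \<epsilon>_def)
  let ?E = "additive_energy (coord_space n) A"
    and ?main = "c * \<delta> ^ K * card A ^ 5 / (64 * CARD('a) ^ n)"
  obtain H k where smoothing: "H \<subseteq> coord_space n" "CARD('a) ^ n \<le> CARD('a) ^ k * card H"
    and codimension: "k * (\<epsilon> * card A) ^ 4 \<le> CARD('a) ^ n * ?E"
    and error: "\<And>a :: nat \<Rightarrow> 'a. (\<And>j. j < 5 \<Longrightarrow> a j \<noteq> 0) \<Longrightarrow> \<bar>card (solutions {..<5} a A)
      - (\<Sum>x\<in>solutions {..<5} a (coord_space n). \<Prod>j<5. translate_density A H (x j))\<bar>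
        \<le> \<epsilon> * card A * ?E"
    using ex_smoothing_subset[OF A_subset, of "\<epsilon> * card A"] \<epsilon>_pos
    by (metis less_imp_le mult_nonneg_nonneg of_nat_0_le_iff)
  have "k \<le> 1 / (4 * \<delta> * \<epsilon> ^ 4)"
    using le_of_mult_power4_le_energy[OF \<epsilon>_pos, of "real k"] codimension
    by (simp add: \<delta>_def card_coord_space)
  also have "\<dots> = codimension_constant / ((\<delta> ^ (K + 1)) ^ 4 * \<delta>)"
    by (simp add: \<epsilon>_def codimension_constant_def power_divide power_mult_distrib mult_ac)
  also have "(\<delta> ^ (K + 1)) ^ 4 * \<delta> = \<delta> ^ Suc ((K + 1) * 4)"
    by (simp only: power_mult power_Suc2)
  also have "Suc ((K + 1) * 4) = saving_exponent" by (simp add: saving_exponent_def)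
  finally have "k \<le> L" using L_large(1) by linarith
  then have "card A \<le> card H * R"
    using R_ge_1 card_field_ge_2[where 'a = 'a]
    by (intro card_le_of_codimension_le[OF _ L_large(2) smoothing(2)]) auto
  then have "2 * ?main \<le> (\<Sum>x\<in>solutions {..<5} a (coord_space n). \<Prod>j<5. translate_density A H (x j))"
    using smoothed_solution_count_ge[OF corr pairable smoothing(1)] by (simp add: \<delta>_def)
  moreover have "\<epsilon> * card A * ?E \<le> ?main"
  proof -
    have "\<epsilon> * card A * ?E \<le> \<epsilon> * card A * (card A ^ 4 / (4 * \<delta> * CARD('a) ^ n))"
      using additive_energy_le \<epsilon>_pos by (intro mult_left_mono) (auto simp: \<delta>_def card_coord_space)
    also have "\<dots> = ?main" using \<delta>_pos by (simp add: \<epsilon>_def field_simps eval_nat_numeral)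
    finally show ?thesis .
  qed
  moreover have "\<bar>card (solutions {..<5} a A)
      - (\<Sum>x\<in>solutions {..<5} a (coord_space n). \<Prod>j<5. translate_density A H (x j))\<bar>
        \<le> \<epsilon> * card A * ?E"
    using pairable by (intro error) (auto simp: pairable_def)
  ultimately show ?thesis by linarith
qed

lemma only_trivial_solutions_bound:
  fixes A :: "(nat \<Rightarrow> 'a) set" and R :: real
  assumes corr: "small_correlations (coord_space n) A R" and pairable: "pairable a"
    and triv: "only_trivial_solutions {..<5} a A"
  defines "\<delta> \<equiv> popular_density (coord_space n) A R"
  assumes L_large: "codimension_constant / \<delta> ^ saving_exponent \<le> real L"
    "CARD('a) ^ L * card A \<le> CARD('a) ^ n * R"
  shows "c * \<delta> ^ K * card A ^ 4 \<le> 64 * CARD('a) ^ n"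
proof -
  interpret small_correlations "coord_space n" A R by (rule corr)
  have "card (solutions {..<5} a A) \<le> card A"
    using coord_space.finite_subset_G[OF A_subset]
    by (intro card_only_trivial_solutions_le[OF triv, of 0]) auto
  moreover have "c * \<delta> ^ K * card A ^ 5 / (64 * CARD('a) ^ n) \<le> card (solutions {..<5} a A)"
    using card_solutions_ge_of_small_correlations[OF corr pairable] L_large by (simp add: \<delta>_def)
  ultimately have "c * \<delta> ^ K * card A ^ 5 / (64 * CARD('a) ^ n) \<le> card A" by linarith
  then have "card A * (c * \<delta> ^ K * card A ^ 4) \<le> card A * (64 * real (CARD('a) ^ n))"
    by (simp add: field_simps eval_nat_numeral)
  then show ?thesis using card_A_pos by simp
qed

definition largeness_threshold :: real where
  "largeness_threshold = max (8 * CARD('a)) (64 / c)"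

definition density_constant :: real where
  "density_constant = max (4 * codimension_constant) (8 * largeness_threshold / ln CARD('a))"

lemma density_constant_pos: "0 < density_constant"
  using codimension_constant_pos by (simp add: density_constant_def less_max_iff_disj)

text \<open>With \<open>Y = q\<bsup>n/8\<esup>\<close>, a violation would make \<open>\<delta>\<close> larger than \<open>1 / Y\<close> and the codimension \<open>L\<close> about
  \<open>n / 4\<close>, so that \<open>|A| \<ge> Y\<^sup>3\<close> has more than \<open>|A|\<close> solutions.\<close>

lemma popular_density_power_le:
  fixes A :: "(nat \<Rightarrow> 'a) set" and R :: real
  assumes corr: "small_correlations (coord_space n) A R" and pairable: "pairable a"
    and triv: "only_trivial_solutions {..<5} a A" and s_ge_2: "2 \<le> s"
  defines "\<delta> \<equiv> popular_density (coord_space n) A R"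
  assumes size: "\<delta> * real (CARD('a) ^ n) ^ (s - 1) \<le> real (card A) ^ s"
  shows "\<delta> ^ saving_exponent * n \<le> density_constant"
proof (rule ccontr)
  assume "\<not> ?thesis"
  then have large: "4 * codimension_constant < \<delta> ^ saving_exponent * n"
    "8 * largeness_threshold / ln CARD('a) < \<delta> ^ saving_exponent * n"
    by (auto simp: density_constant_def)
  interpret small_correlations "coord_space n" A R by (rule corr)
  define q M N Y where "q = real CARD('a)" and "M = real (card A)"
    and "N = real (CARD('a) ^ n)" and "Y = q powr (n / 8)"
  have q_gt_1: "1 < q" using card_field_ge_2[where 'a = 'a] by (simp add: q_def)
  have \<delta>_bounds: "0 < \<delta>" "\<delta> \<le> 1"
    using popular_density_pos popular_density_le_1 by (auto simp: \<delta>_def)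
  have threshold: "8 * q \<le> largeness_threshold" "64 / c \<le> largeness_threshold"
    "1 \<le> largeness_threshold"
    using q_gt_1 by (auto simp: largeness_threshold_def q_def)
  have Y_large: "largeness_threshold < Y" "1 \<le> Y"
    and \<delta>_large: "i \<le> saving_exponent \<Longrightarrow> 1 < Y * \<delta> ^ i" for i
    using exponential_beats_linear[OF q_gt_1 threshold(3) \<delta>_bounds] large(2) threshold(3)
    unfolding Y_def q_def by fastforce+
  have N_eq: "N = Y ^ 8" using q_gt_1 by (simp add: N_def Y_def q_def powr_power powr_realpow)
  have M_ge: "Y ^ 3 \<le> M"
    using size \<delta>_large[of 1] Y_large(2) s_ge_2
    by (intro cube_le_of_power_ge[where d = \<delta> and s = s])
      (auto simp: M_def N_def saving_exponent_def simp flip: N_eq)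
  define L where "L = nat \<lceil>codimension_constant / \<delta> ^ saving_exponent\<rceil>"
  have "q ^ L \<le> q * Y\<^sup>2"
    unfolding L_def Y_def using q_gt_1 large(1) \<delta>_bounds codimension_constant_pos
    by (intro power_nat_ceiling_le) (auto simp: field_simps)
  moreover have "8 * q * Y\<^sup>2 \<le> Y * Y\<^sup>2" using threshold Y_large by (intro mult_right_mono) auto
  ultimately have "8 * q ^ L \<le> M" using M_ge by (simp add: power3_eq_cube power2_eq_square)
  then have "CARD('a) ^ L * card A \<le> CARD('a) ^ n * R"
    using mult_card_le_of_le_card[of "q ^ L"] by (simp add: q_def M_def card_coord_space)
  moreover have "codimension_constant / \<delta> ^ saving_exponent \<le> L"
    by (simp add: L_def real_nat_ceiling_ge)
  ultimately have "c * \<delta> ^ K * M ^ 4 \<le> 64 * N"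
    using only_trivial_solutions_bound[OF corr pairable triv] by (simp add: \<delta>_def M_def N_def)
  moreover have "64 / c < Y" using threshold(2) Y_large(1) by simp
  then have "64 < c * Y" using c_pos by (simp add: pos_divide_less_eq mult.commute)
  then have "64 * N < c * \<delta> ^ K * M ^ 4"
    unfolding N_eq using c_pos Y_large(2) M_ge \<delta>_large[of K]
    by (intro quintic_exceeds_octic) (auto simp: saving_exponent_def)
  ultimately show False by simp
qed

definition Kst_constant :: "nat \<Rightarrow> nat \<Rightarrow> real" where
  "Kst_constant s t
    = density_constant * (8 * t * (2 * s) ^ (s - 2)) ^ saving_exponent * ln CARD('a)"

lemma Kst_constant_pos: "1 \<le> s \<Longrightarrow> 1 \<le> t \<Longrightarrow> 0 < Kst_constant s t"
  using density_constant_pos card_field_ge_2[where 'a = 'a] by (simp add: Kst_constant_def)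

lemma Kst_free_solution_free_bound:
  fixes A :: "(nat \<Rightarrow> 'a) set"
  assumes s_ge_2: "2 \<le> s" and t_ge_1: "1 \<le> t" and pairable: "pairable a"
    and A_sub: "A \<subseteq> coord_space n"
    and Kst: "Kst_free_in (coord_space n) s t A" and triv: "only_trivial_solutions {..<5} a A"
  shows "real (card A) ^ (s * saving_exponent) * ln (real (CARD('a) ^ n))
    \<le> Kst_constant s t * real (CARD('a) ^ n) ^ ((s - 1) * saving_exponent)"
proof (cases "A = {}")
  case True
  then show ?thesis
    using s_ge_2 t_ge_1 Kst_constant_pos[of s t] by (simp add: saving_exponent_def power_0_left)
next
  case False
  define q N B where "q = real CARD('a)" and "N = real (CARD('a) ^ n)"
    and "B = real (8 * t * (2 * s) ^ (s - 2))"
  define R where "R = t * (2 * s * card (coord_space n :: (nat \<Rightarrow> 'a) set) / card A) ^ (s - 2)"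
  define \<delta> where "\<delta> = popular_density (coord_space n) A R"
  have q_gt_1: "1 < q" using card_field_ge_2[where 'a = 'a] by (simp add: q_def)
  have corr: "small_correlations (coord_space n) A R"
    unfolding R_def
    by (rule coord_space.Kst_free_in_small_correlations[OF A_sub False Kst s_ge_2 t_ge_1])
  then interpret small_correlations "coord_space n" A R .
  have size: "real (card A) ^ s = \<delta> * (B * N ^ (s - 1))"
    using coord_space.card_power_eq_popular_density[OF A_sub False s_ge_2 t_ge_1]
    by (simp add: \<delta>_def R_def B_def N_def card_coord_space)
  have "0 < 8 * t * (2 * s) ^ (s - 2)" using s_ge_2 t_ge_1 by simp
  then have "1 \<le> B" unfolding B_def by linarith
  then have "1 * (\<delta> * N ^ (s - 1)) \<le> B * (\<delta> * N ^ (s - 1))"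
    using popular_density_pos by (intro mult_right_mono) (auto simp: \<delta>_def N_def)
  then have "\<delta> ^ saving_exponent * n \<le> density_constant"
    using popular_density_power_le[OF corr pairable triv s_ge_2] size
    by (simp add: \<delta>_def N_def mult_ac)
  then have "\<delta> ^ saving_exponent * n * ((B * N ^ (s - 1)) ^ saving_exponent * ln q)
      \<le> density_constant * ((B * N ^ (s - 1)) ^ saving_exponent * ln q)"
    using q_gt_1 by (intro mult_right_mono) (auto simp: B_def N_def)
  moreover have "real (card A) ^ (s * saving_exponent)
      = \<delta> ^ saving_exponent * (B * N ^ (s - 1)) ^ saving_exponent"
    by (simp only: power_mult size power_mult_distrib)
  moreover have "ln N = n * ln q" using q_gt_1 by (simp add: N_def q_def ln_realpow)
  moreover have "(B * N ^ (s - 1)) ^ saving_exponent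
    = B ^ saving_exponent * N ^ ((s - 1) * saving_exponent)"
    by (simp only: power_mult_distrib power_mult)
  ultimately have "real (card A) ^ (s * saving_exponent) * ln N
      \<le> density_constant * B ^ saving_exponent * ln q * N ^ ((s - 1) * saving_exponent)"
    by (simp add: mult_ac)
  then show ?thesis by (simp add: Kst_constant_def N_def B_def q_def)
qed

end

section \<open>Merging variables\<close>

lemma two_nonzero_of_odd_card:
  assumes "odd CARD('a::{field,finite})"
  shows "(2::'a) \<noteq> 0"
proof
  assume "(2::'a) = 0"
  then have "of_nat 2 = (0::'a)" by simp
  then have "CHAR('a) dvd 2" by (simp only: of_nat_eq_0_iff_char_dvd)
  moreover have "prime CHAR('a)" by (simp add: prime_CHAR_semidom finite_imp_CHAR_pos)
  ultimately have "CHAR('a) = 2" using primes_dvd_imp_eq two_is_prime_nat by blast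
  then show False using CHAR_dvd_CARD[where 'a = 'a] assms by simp
qed

lemma ex_pair_nonzero_sum:
  fixes a :: "'i \<Rightarrow> 'a::field"
  assumes two_nonzero: "(2::'a) \<noteq> 0" and card_I: "3 \<le> card I" and nonzero: "\<And>i. i \<in> I \<Longrightarrow> a i \<noteq> 0"
  obtains i j where "i \<in> I" "j \<in> I" "i \<noteq> j" "a i + a j \<noteq> 0"
proof -
  obtain J where "J \<subseteq> I" "card J = 3" by (rule obtain_subset_with_card_n[OF card_I])
  then obtain i j k where distinct: "i \<in> I" "j \<in> I" "k \<in> I" "i \<noteq> j" "j \<noteq> k" "i \<noteq> k"
    by (auto simp: card_3_iff)
  have "(a i + a j) + (a i + a k) - (a j + a k) = 2 * a i" by simp
  also have "\<dots> \<noteq> 0" using two_nonzero nonzero[OF distinct(1)] by simp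
  finally have "a i + a j \<noteq> 0 \<or> a j + a k \<noteq> 0 \<or> a i + a k \<noteq> 0" by fastforce
  then show ?thesis using that distinct by blast
qed

definition merged :: "'i set \<Rightarrow> ('i \<Rightarrow> 'a::comm_monoid_add) \<Rightarrow> ('i \<Rightarrow> 'l) \<Rightarrow> 'l \<Rightarrow> 'a" where
  "merged I a g l = (\<Sum>i\<in>{i\<in>I. g i = l}. a i)"

lemma merged_absorb:
  fixes a :: "'i \<Rightarrow> 'a::comm_monoid_add" and g :: "'i \<Rightarrow> 'l"
  assumes distinct: "finite I" "i \<in> I" "j \<in> I" "i \<noteq> j"
  shows "merged I a (g(j := g i)) = merged (I - {j}) (a(i := a i + a j)) g"
proof
  fix l :: 'l
  have merged_eq: "merged J b h l = (\<Sum>k\<in>J. if h k = l then b k else 0)" if "finite J"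
    for J and b :: "'i \<Rightarrow> 'a" and h :: "'i \<Rightarrow> 'l"
    using that by (simp add: merged_def sum.inter_filter)
  have rest: "(\<Sum>k\<in>I - {j} - {i}. if (g(j := g i)) k = l then a k else 0)
      = (\<Sum>k\<in>I - {j} - {i}. if g k = l then (a(i := a i + a j)) k else 0)"
    by (intro sum.cong) auto
  have "i \<in> I - {j}" "finite (I - {j})" using distinct by auto
  then show "merged I a (g(j := g i)) l = merged (I - {j}) (a(i := a i + a j)) g l"
    using distinct rest
    by (simp add: merged_eq sum.remove[of I j] sum.remove[of "I - {j}" i] add_ac)
qed

lemma ex_pairable_enumeration:
  fixes a :: "'i \<Rightarrow> 'a::field"
  assumes two_nonzero: "(2::'a) \<noteq> 0" and card_I: "card I = 5"
    and coeffs: "\<And>i. i \<in> I \<Longrightarrow> a i \<noteq> 0" "(\<Sum>i\<in>I. a i) = 0"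
  shows "\<exists>g. g ` I \<subseteq> {..<5} \<and> pairable (merged I a g)"
proof -
  have finite_I: "finite I" using card_I by (simp add: card_ge_0_finite)
  obtain i\<^sub>0 i\<^sub>1 where pair\<^sub>0\<^sub>1: "i\<^sub>0 \<in> I" "i\<^sub>1 \<in> I" "i\<^sub>0 \<noteq> i\<^sub>1" "a i\<^sub>0 + a i\<^sub>1 \<noteq> 0"
    using ex_pair_nonzero_sum[OF two_nonzero, of I a] card_I coeffs(1) by auto
  have "card (I - {i\<^sub>0, i\<^sub>1}) = 3" using pair\<^sub>0\<^sub>1 card_I finite_I by (simp add: card_Diff_subset)
  then obtain i\<^sub>2 i\<^sub>3
    where pair\<^sub>2\<^sub>3: "i\<^sub>2 \<in> I - {i\<^sub>0, i\<^sub>1}" "i\<^sub>3 \<in> I - {i\<^sub>0, i\<^sub>1}" "i\<^sub>2 \<noteq> i\<^sub>3" "a i\<^sub>2 + a i\<^sub>3 \<noteq> 0"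
    using ex_pair_nonzero_sum[OF two_nonzero, of "I - {i\<^sub>0, i\<^sub>1}" a] coeffs(1) by auto
  have "card (I - {i\<^sub>0, i\<^sub>1, i\<^sub>2, i\<^sub>3}) = 1"
    using pair\<^sub>0\<^sub>1 pair\<^sub>2\<^sub>3 card_I finite_I by (subst card_Diff_subset) auto
  then obtain i\<^sub>4 where "I - {i\<^sub>0, i\<^sub>1, i\<^sub>2, i\<^sub>3} = {i\<^sub>4}" by (auto simp: card_1_singleton_iff)
  then have I_eq: "I = {i\<^sub>0, i\<^sub>1, i\<^sub>2, i\<^sub>3, i\<^sub>4}" and distinct: "distinct [i\<^sub>0, i\<^sub>1, i\<^sub>2, i\<^sub>3, i\<^sub>4]"
    using pair\<^sub>0\<^sub>1 pair\<^sub>2\<^sub>3 by auto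
  define g where "g = (\<lambda>i. if i = i\<^sub>0 then 0 else if i = i\<^sub>1 then 1 else if i = i\<^sub>2 then 2
    else if i = i\<^sub>3 then 3 else 4::nat)"
  have "{i\<in>I. g i = 0} = {i\<^sub>0}" "{i\<in>I. g i = 1} = {i\<^sub>1}" "{i\<in>I. g i = 2} = {i\<^sub>2}"
    "{i\<in>I. g i = 3} = {i\<^sub>3}" "{i\<in>I. g i = 4} = {i\<^sub>4}"
    using distinct by (auto simp: I_eq g_def split: if_splits)
  then have merged_eq: "merged I a g 0 = a i\<^sub>0" "merged I a g 1 = a i\<^sub>1" "merged I a g 2 = a i\<^sub>2"
    "merged I a g 3 = a i\<^sub>3" "merged I a g 4 = a i\<^sub>4"
    by (simp_all add: merged_def)
  have "\<forall>l\<in>{..<5}. merged I a g l \<noteq> 0"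
    unfolding lessThan_5 using coeffs(1) merged_eq by (auto simp: I_eq)
  moreover have "(\<Sum>l<5. merged I a g l) = (\<Sum>i\<in>I. a i)"
    using distinct merged_eq by (simp add: lessThan_5 I_eq)
  ultimately have "pairable (merged I a g)"
    using pair\<^sub>0\<^sub>1(4) pair\<^sub>2\<^sub>3(4) coeffs(2) merged_eq by (simp add: pairable_def)
  then show ?thesis by (intro exI[of _ g]) (auto simp: g_def)
qed

lemma ex_pairable_merging:
  fixes a :: "'i \<Rightarrow> 'a::field"
  assumes two_nonzero: "(2::'a) \<noteq> 0" and "card I = m + 5" "\<And>i. i \<in> I \<Longrightarrow> a i \<noteq> 0" "(\<Sum>i\<in>I. a i) = 0"
  shows "\<exists>g. g ` I \<subseteq> {..<5} \<and> pairable (merged I a g)"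
  using assms(2-)
proof (induction m arbitrary: I a)
  case 0
  then show ?case by (intro ex_pairable_enumeration[OF two_nonzero]) auto
next
  case (Suc m)
  have finite_I: "finite I" using Suc.prems by (simp add: card_ge_0_finite)
  obtain i j where pair: "i \<in> I" "j \<in> I" "i \<noteq> j" "a i + a j \<noteq> 0"
    using ex_pair_nonzero_sum[OF two_nonzero, of I a] Suc.prems by auto
  define a' where "a' = a(i := a i + a j)"
  have "(\<Sum>l\<in>I - {j}. a' l) = (\<Sum>l\<in>I. a l)"
  proof -
    have "(\<Sum>l\<in>I - {j} - {i}. a' l) = (\<Sum>l\<in>I - {j} - {i}. a l)"
      by (intro sum.cong) (auto simp: a'_def)
    then show ?thesis
      using finite_I pair by (simp add: a'_def sum.remove[of I j] sum.remove[of "I - {j}" i] add_ac)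
  qed
  moreover have "card (I - {j}) = m + 5" using pair Suc.prems finite_I by simp
  moreover have "a' l \<noteq> 0" if "l \<in> I - {j}" for l
    using that pair Suc.prems by (auto simp: a'_def)
  ultimately obtain g where merging: "g ` (I - {j}) \<subseteq> {..<5}" "pairable (merged (I - {j}) a' g)"
    using Suc.IH[of "I - {j}" a'] Suc.prems by auto
  show ?case
  proof (intro exI conjI)
    show "g(j := g i) ` I \<subseteq> {..<5}" using merging pair by auto
    show "pairable (merged I a (g(j := g i)))"
      using merging(2) unfolding a'_def by (simp only: merged_absorb[OF finite_I pair(1-3)])
  qed
qed

definition fun_of_vec :: "nat \<Rightarrow> 'a::zero vec \<Rightarrow> nat \<Rightarrow> 'a" where
  "fun_of_vec n v = (\<lambda>i. if i < n then v $ i else 0)"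

lemma fun_of_vec_in_coord_space [simp]: "fun_of_vec n v \<in> coord_space n"
  by (simp add: fun_of_vec_def coord_space_def)

lemma vec_fun_of_vec: "v \<in> carrier_vec n \<Longrightarrow> vec n (fun_of_vec n v) = v"
  by (intro eq_vecI) (auto simp: fun_of_vec_def)

lemma inj_on_fun_of_vec: "inj_on (fun_of_vec n) (carrier_vec n)"
  by (intro inj_on_inverseI[where g = "vec n"]) (auto simp: vec_fun_of_vec)

lemma inj_on_vec_coord_space: "inj_on (vec n) (coord_space n)"
proof (rule inj_onI)
  fix x y :: "nat \<Rightarrow> 'a"
  assume in_space: "x \<in> coord_space n" "y \<in> coord_space n" and vec_eq: "vec n x = vec n y"
  have "x i = y i" for i
  proof (cases "i < n")
    case True
    then show ?thesis using arg_cong[OF vec_eq, of "\<lambda>v. v $ i"] by simp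
  qed (use in_space in \<open>auto simp: coord_space_def\<close>)
  then show "x = y" by blast
qed

lemma ex_enumeration_vec:
  assumes "X \<subseteq> coord_space n" "card X = s"
  obtains x where "x ` {1..s} \<subseteq> X" "inj_on (vec n \<circ> x) {1..s}"
proof (cases "finite X")
  case True
  then obtain x where "bij_betw x {1..s} X" using ex_bij_betw_nat_finite_1 assms(2) by blast
  then have enumeration: "x ` {1..s} = X" "inj_on x {1..s}" by (auto simp: bij_betw_def)
  then have "inj_on (vec n) (x ` {1..s})"
    using inj_on_vec_coord_space assms(1) inj_on_subset by metis
  then show ?thesis using that enumeration by (auto intro: comp_inj_on)
next
  case False
  then show ?thesis using that assms(2) by simp
qed

lemma Kst_free_fun_of_vec:
  fixes A :: "'a::field vec set"
  assumes A_sub: "A \<subseteq> carrier_vec n" and Kst: "Kst_free n s t A"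
  shows "Kst_free_in (coord_space n) s t (fun_of_vec n ` A)"
  unfolding Kst_free_in_def
proof (rule notI, elim exE conjE)
  fix X Y :: "(nat \<Rightarrow> 'a) set"
  assume sets: "X \<subseteq> coord_space n" "Y \<subseteq> coord_space n" "card X = s" "card Y = t"
    and sums: "\<forall>x\<in>X. \<forall>y\<in>Y. x + y \<in> fun_of_vec n ` A"
  obtain x y where enumeration_X: "x ` {1..s} \<subseteq> X" "inj_on (vec n \<circ> x) {1..s}"
    and enumeration_Y: "y ` {1..t} \<subseteq> Y" "inj_on (vec n \<circ> y) {1..t}"
    using ex_enumeration_vec[OF sets(1,3)] ex_enumeration_vec[OF sets(2,4)] by metis
  have "(vec n \<circ> x) i + (vec n \<circ> y) j \<in> A" if "i \<in> {1..s}" "j \<in> {1..t}" for i j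
  proof -
    have "x i \<in> X" "y j \<in> Y" using enumeration_X(1) enumeration_Y(1) that by auto
    then have "x i + y j \<in> fun_of_vec n ` A" using sums by simp
    then obtain v where preimage: "v \<in> A" "x i + y j = fun_of_vec n v" by (metis imageE)
    have "(vec n \<circ> x) i + (vec n \<circ> y) j = vec n (x i + y j)" by (intro eq_vecI) auto
    then show ?thesis using preimage A_sub by (simp add: vec_fun_of_vec subsetD)
  qed
  then have "\<exists>x y. x ` {1..s} \<subseteq> carrier_vec n \<and> inj_on x {1..s} \<and>
      y ` {1..t} \<subseteq> carrier_vec n \<and> inj_on y {1..t} \<and> (\<forall>i\<in>{1..s}. \<forall>j\<in>{1..t}. x i + y j \<in> A)"
    using enumeration_X(2) enumeration_Y(2)
    by (intro exI[of _ "vec n \<circ> x"] exI[of _ "vec n \<circ> y"]) auto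
  then show False using Kst unfolding Kst_free_def by blast
qed

lemma merged_solution_imp_lin_solution:
  fixes A :: "'a::field vec set"
  assumes A_sub: "A \<subseteq> carrier_vec n" and merging: "g ` {1..k} \<subseteq> J" "finite J"
    and solution: "x \<in> solutions J (merged {1..k} a g) (fun_of_vec n ` A)"
  shows "lin_solution n k a A (\<lambda>i. vec n (x (g i)))"
proof -
  let ?v = "\<lambda>i. vec n (x (g i))"
  have "?v i \<in> A" if "i \<in> {1..k}" for i
  proof -
    have "g i \<in> J" using merging that by auto
    then have "x (g i) \<in> fun_of_vec n ` A" using solution by (auto simp: solutions_def)
    then show ?thesis using A_sub by (auto simp: vec_fun_of_vec subsetD)
  qed
  moreover have "finsum_vec TYPE('a) n (\<lambda>i. a i \<cdot>\<^sub>v ?v i) {1..k} = 0\<^sub>v n"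
  proof (rule eq_vecI)
    show "dim_vec (finsum_vec TYPE('a) n (\<lambda>i. a i \<cdot>\<^sub>v ?v i) {1..k}) = dim_vec (0\<^sub>v n :: 'a vec)"
      using finsum_vec_closed[of "\<lambda>i. a i \<cdot>\<^sub>v ?v i" "{1..k}" n] by auto
    fix m assume "m < dim_vec (0\<^sub>v n :: 'a vec)"
    then have m_less: "m < n" by simp
    have "finsum_vec TYPE('a) n (\<lambda>i. a i \<cdot>\<^sub>v ?v i) {1..k} $ m = (\<Sum>i\<in>{1..k}. a i * x (g i) m)"
      using m_less by (subst index_finsum_vec) auto
    also have "\<dots> = (\<Sum>l\<in>J. \<Sum>i\<in>{i\<in>{1..k}. g i = l}. a i * x (g i) m)"
      by (rule sum.group[symmetric]) (use merging in auto)
    also have "\<dots> = (\<Sum>l\<in>J. merged {1..k} a g l \<star> x l) m"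
      unfolding sum_fun_apply
      by (intro sum.cong refl) (auto simp: merged_def sum_distrib_right intro!: sum.cong)
    also have "\<dots> = 0" using solution by (simp add: solutions_def)
    finally show "finsum_vec TYPE('a) n (\<lambda>i. a i \<cdot>\<^sub>v ?v i) {1..k} $ m = 0\<^sub>v n $ m"
      using m_less by simp
  qed
  ultimately show ?thesis by (simp add: lin_solution_def)
qed

lemma only_trivial_solutions_merged:
  fixes A :: "'a::field vec set"
  assumes A_sub: "A \<subseteq> carrier_vec n"
    and no_solution: "\<not> (\<exists>x. lin_solution n k a A x \<and> \<not> trivial_solution k x)"
    and merging: "g ` {1..k} \<subseteq> J" "finite J" and nonzero: "\<And>l. l \<in> J \<Longrightarrow> merged {1..k} a g l \<noteq> 0"
  shows "only_trivial_solutions J (merged {1..k} a g) (fun_of_vec n ` A)"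
  unfolding only_trivial_solutions_def
proof (intro ballI)
  fix x i j
  assume solution: "x \<in> solutions J (merged {1..k} a g) (fun_of_vec n ` A)"
    and in_J: "i \<in> J" "j \<in> J"
  have surj: "\<exists>i'\<in>{1..k}. g i' = l" if "l \<in> J" for l
  proof (rule ccontr)
    assume "\<not> ?thesis"
    then have "{i\<in>{1..k}. g i = l} = {}" by blast
    then have "merged {1..k} a g l = 0" unfolding merged_def by (simp only: sum.empty)
    then show False using nonzero[OF that] by simp
  qed
  obtain i' where preimage_i: "i' \<in> {1..k}" "g i' = i" using surj[OF in_J(1)] by blast
  obtain j' where preimage_j: "j' \<in> {1..k}" "g j' = j" using surj[OF in_J(2)] by blast
  have "trivial_solution k (\<lambda>i. vec n (x (g i)))"
    using merged_solution_imp_lin_solution[OF A_sub merging solution] no_solution by blast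
  then have "vec n (x i) = vec n (x j)"
    using preimage_i preimage_j unfolding trivial_solution_def by blast
  moreover have "x l \<in> coord_space n" if "l \<in> J" for l
  proof -
    have "x l \<in> fun_of_vec n ` A" using solution that by (auto simp: solutions_def)
    then show ?thesis by auto
  qed
  ultimately show "x i = x j" using in_J by (intro inj_onD[OF inj_on_vec_coord_space]) auto
qed

lemma (in five_term_supersaturation) Kst_free_solution_free_vec_bound:
  fixes A :: "'a vec set" and a :: "nat \<Rightarrow> 'a"
  assumes odd_card: "odd CARD('a)" and s_ge_2: "2 \<le> s" and t_ge_1: "1 \<le> t" and k_ge_5: "5 \<le> k"
    and coeffs: "\<forall>i\<in>{1..k}. a i \<noteq> 0" "(\<Sum>i=1..k. a i) = 0" and A_sub: "A \<subseteq> carrier_vec n"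
    and Kst: "Kst_free n s t A"
    and no_solution: "\<not> (\<exists>x. lin_solution n k a A x \<and> \<not> trivial_solution k x)"
  shows "real (card A) ^ (s * saving_exponent) * ln (real (CARD('a) ^ n))
    \<le> Kst_constant s t * real (CARD('a) ^ n) ^ ((s - 1) * saving_exponent)"
proof -
  have "card {1..k} = (k - 5) + 5" using k_ge_5 by simp
  then obtain g where merging: "g ` {1..k} \<subseteq> {..<5}" "pairable (merged {1..k} a g)"
    using ex_pairable_merging[OF two_nonzero_of_odd_card[OF odd_card], of "{1..k}" "k - 5" a] coeffs
    by blast
  then have "only_trivial_solutions {..<5} (merged {1..k} a g) (fun_of_vec n ` A)"
    by (intro only_trivial_solutions_merged[OF A_sub no_solution]) (auto simp: pairable_def)
  moreover have "fun_of_vec n ` A \<subseteq> coord_space n" by (rule image_subsetI) simp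
  moreover have "card (fun_of_vec n ` A) = card A"
    by (rule card_image[OF inj_on_subset[OF inj_on_fun_of_vec A_sub]])
  ultimately show ?thesis
    using Kst_free_solution_free_bound[OF s_ge_2 t_ge_1 merging(2) _
        Kst_free_fun_of_vec[OF A_sub Kst]]
    by simp
qed

lemma powr_bound_of_power_bound:
  fixes M N C :: real
  assumes s_ge_2: "2 \<le> s" and Q_ge_1: "1 \<le> Q" and C_pos: "0 < C" and N_gt_1: "1 < N"
    and bound: "M ^ (s * Q) * ln N \<le> C * N ^ ((s - 1) * Q)"
  shows "M \<le> C powr (1 / real (s * Q)) * N powr (1 - 1 / real s) * ln N powr (- (1 / real (s * Q)))"
    (is "M \<le> ?r")
proof -
  define W where "W = s * Q"
  have W_pos: "0 < W" using s_ge_2 Q_ge_1 by (simp add: W_def)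
  have ln_N_pos: "0 < ln N" using N_gt_1 by simp
  have "?r ^ W = C powr (W * (1 / W)) * N powr (W * (1 - 1 / s)) * ln N powr (W * - (1 / W))"
    using C_pos N_gt_1 ln_N_pos by (simp add: W_def power_mult_distrib powr_power mult_ac)
  also have "W * (1 - 1 / s) = real ((s - 1) * Q)"
    using s_ge_2 by (simp add: W_def field_simps of_nat_diff)
  also have "N powr real ((s - 1) * Q) = N ^ ((s - 1) * Q)"
    using N_gt_1 by (subst powr_realpow) auto
  also have "C powr (W * (1 / W)) = C" using C_pos W_pos by simp
  also have "ln N powr (W * - (1 / W)) = 1 / ln N"
    using W_pos ln_N_pos by (simp add: powr_minus_divide)
  finally have "M ^ W \<le> ?r ^ W" using bound ln_N_pos by (simp add: W_def pos_le_divide_eq)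
  moreover have "0 \<le> ?r" using C_pos by simp
  ultimately show ?thesis using power_le_imp_le_base[of M "W - 1" ?r] W_pos by simp
qed

theorem theorem1p2:
  fixes q s t k :: nat
  assumes "CARD('a::{field,finite}) = q" and "odd q"
    and "2 \<le> s" and "s \<le> t" and "5 \<le> k"
  shows "\<exists>c::real. c > 0 \<and>
    (\<forall>a :: nat \<Rightarrow> 'a.
      (\<forall>i\<in>{1..k}. a i \<noteq> 0) \<and> (\<Sum>i=1..k. a i) = 0 \<longrightarrow>
      (\<exists>C::real. C > 0 \<and>
        (\<forall>n N :: nat. \<forall>A :: 'a vec set.
          n \<ge> 1 \<and> N = q ^ n \<and> A \<subseteq> carrier_vec n \<and> Kst_free n s t A \<and>
          \<not> (\<exists>x. lin_solution n k a A x \<and> \<not> trivial_solution k x) \<longrightarrow>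
          real (card A) \<le> C * real N powr (1 - 1 / real s) * ln (real N) powr (- c))))"
proof -
  obtain c K where "five_term_supersaturation TYPE('a) c K"
    using ex_five_term_supersaturation by blast
  then interpret five_term_supersaturation "TYPE('a)" c K .
  let ?c = "1 / real (s * saving_exponent)"
  let ?C = "Kst_constant s t powr ?c"
  have t_ge_1: "1 \<le> t" and constants: "0 < Kst_constant s t" "1 \<le> saving_exponent"
    using assms(3,4) Kst_constant_pos[of s t] by (auto simp: saving_exponent_def)
  have bound: "real (card A) \<le> ?C * real N powr (1 - 1 / real s) * ln (real N) powr (- ?c)"
    if "\<forall>i\<in>{1..k}. a i \<noteq> 0" "(\<Sum>i=1..k. a i) = 0" "n \<ge> 1" "N = q ^ n" "A \<subseteq> carrier_vec n"
      "Kst_free n s t A" "\<not> (\<exists>x. lin_solution n k a A x \<and> \<not> trivial_solution k x)"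
    for a :: "nat \<Rightarrow> 'a" and n N and A :: "'a vec set"
  proof (rule powr_bound_of_power_bound[OF assms(3) constants(2,1)])
    show "1 < real N"
      using that(3,4) card_field_ge_2[where 'a = 'a] assms(1) by (simp add: one_less_power)
    show "real (card A) ^ (s * saving_exponent) * ln (real N)
        \<le> Kst_constant s t * real N ^ ((s - 1) * saving_exponent)"
      using Kst_free_solution_free_vec_bound[OF _ assms(3) t_ge_1 assms(5) that(1,2,5-7)]
        that(4) assms(1,2) by simp
  qed
  show ?thesis
    using bound constants assms(3)
    by (intro exI[of _ ?c] conjI allI impI exI[of _ ?C]) auto
qed

end
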